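(* Let $\varphi$ be a toric plurisubharmonic function on a polydisk $X\subset\mathbb{C}^n$ centered at $0$, and let $\mathbf{1}=(1,\ldots,1)\in\mathbb{R}^n$. Then the multiplier ideal $\mathscr{I}(\varphi)\subset \mathcal{O}_X(X)$ is a monomial ideal (i.e. generated by monomials), and for every $\alpha=(\alpha_1,\ldots,\alpha_n)\in\mathbb{N}^n$, $$\mathbf{z}^{\alpha}=z_1^{\alpha_1}\cdots z_n^{\alpha_n}\in\mathscr{I}(\varphi)\quad\Longleftrightarrow\quad \alpha+\mathbf{1}\in \operatorname{int} P(\varphi),$$ where $\operatorname{int}P(\varphi)$ is the interior of the Newton convex body $P(\varphi)\subset\mathbb{R}^n$ of $\varphi$.
   Context: Plurisubharmonic (psh) functions are assumed not identically $-\infty$. Let $X=\{z\in\mathbb{C}^n: |z_i|<r_i,\ 1\le i\le n\}$ be a polydisk centered at $0$. A psh function $\varphi$ on $X$ is toric if it is pointwise invariant under $(z_1,\ldots,z_n)\mapsto(e^{i\theta_1}z_1,\ldots,e^{i\theta_n}z_n)$ for all real $\theta_j$. It is then of the form $\varphi(z)=f(\log|z_1|,\ldots,\log|z_n|)$ (at points with all $z_i\ne0$), where $f$ is a convex function on $\prod_i\,]-\infty,\log r_i[$, non-decreasing in each variable. The concave function attached to $\varphi$ is $g(x)=-f(-x)$, defined on $\prod_i\,]-\log r_i,+\infty[$. The Newton convex body of $\varphi$ is $$P(\varphi)=P(g)=\{\lambda\in\mathbb{R}^n:\ g-\langle\lambda,\cdot\rangle\text{ is bounded above}\},$$ where $\langle\cdot,\cdot\rangle$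 is the standard scalar product. The multiplier ideal $\mathscr{I}(\varphi)$, viewed as an ideal of the ring $\mathcal{O}_X(X)$ of holomorphic functions on the Stein manifold $X$, consists of the holomorphic functions $F$ on $X$ such that $|F|^2e^{-2\varphi}$ is locally integrable on $X$ with respect to Lebesgue measure. *)

theory Defs
  imports "HOL-Analysis.Analysis" "HOL-Algebra.Ideal"
begin

section \<open>Plurisubharmonic functions\<close>

definition usc_on :: "'a::topological_space set \<Rightarrow> ('a \<Rightarrow> ereal) \<Rightarrow> bool" where
  "usc_on X u \<longleftrightarrow> (\<forall>c. openin (top_of_set X) {z \<in> X. u z < c})"

text \<open>Integral of an extended-real function that is bounded above, with value in
  \<open>[-\<infinity>, \<infinity>)\<close> on a finite measure space. As \<^const>\<open>e2ennreal\<close> truncates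
  negative numbers to \<open>0\<close>, the two terms are the integrals of the positive and negative parts,
  and the first of them is finite.\<close>

definition ereal_integral :: "'a measure \<Rightarrow> ('a \<Rightarrow> ereal) \<Rightarrow> ereal" where
  "ereal_integral M u =
     enn2ereal (\<integral>\<^sup>+ x. e2ennreal (u x) \<partial>M) - enn2ereal (\<integral>\<^sup>+ x. e2ennreal (- u x) \<partial>M)"

definition circle_mean :: "(complex \<Rightarrow> ereal) \<Rightarrow> complex \<Rightarrow> real \<Rightarrow> ereal" where
  "circle_mean u a \<rho> =
     ereal (1 / (2 * pi)) *
       ereal_integral (restrict_space lborel {0..2 * pi}) (\<lambda>t. u (a + of_real \<rho> * cis t))"

text \<open>The constant \<open>-\<infinity>\<close> counts as subharmonic here, so that a plurisubharmonic function may
  be \<open>-\<infinity>\<close> on a complex line.\<close>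

definition subharmonic_on :: "complex set \<Rightarrow> (complex \<Rightarrow> ereal) \<Rightarrow> bool" where
  "subharmonic_on U u \<longleftrightarrow>
     (\<forall>z\<in>U. u z < \<infinity>) \<and> usc_on U u \<and>
     (\<forall>a \<rho>. 0 < \<rho> \<longrightarrow> cball a \<rho> \<subseteq> U \<longrightarrow> u a \<le> circle_mean u a \<rho>)"

text \<open>Here \<open>X\<close> is meant to be open and connected, and \<open>-\<infinity>\<close> is excluded.\<close>

definition psh_on :: "(complex ^ 'n) set \<Rightarrow> (complex ^ 'n \<Rightarrow> ereal) \<Rightarrow> bool" where
  "psh_on X \<phi> \<longleftrightarrow>
     (\<forall>z\<in>X. \<phi> z < \<infinity>) \<and> usc_on X \<phi> \<and>
     (\<forall>a b. subharmonic_on {t. a + t *s b \<in> X} (\<lambda>t. \<phi> (a + t *s b))) \<and>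
     (\<exists>z\<in>X. \<phi> z \<noteq> -\<infinity>)"


section \<open>Toric functions on polydisks and their Newton convex bodies\<close>

definition polydisk :: "real ^ 'n \<Rightarrow> (complex ^ 'n) set" where
  "polydisk r = {z. \<forall>i. cmod (z $ i) < r $ i}"

definition toric_on :: "(complex ^ 'n) set \<Rightarrow> (complex ^ 'n \<Rightarrow> ereal) \<Rightarrow> bool" where
  "toric_on X \<phi> \<longleftrightarrow> (\<forall>\<theta> :: real ^ 'n. \<forall>z\<in>X. \<phi> (\<chi> i. cis (\<theta> $ i) * z $ i) = \<phi> z)"

text \<open>For a toric \<open>\<phi>\<close> this is the function \<open>f\<close> with
  \<open>\<phi>(z) = f(log |z\<^sub>1|, \<dots>, log |z\<^sub>n|)\<close>: evaluate \<open>\<phi>\<close> at the point with the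
  positive coordinates \<open>exp x\<^sub>i\<close>.\<close>

definition log_profile :: "(complex ^ 'n \<Rightarrow> ereal) \<Rightarrow> real ^ 'n \<Rightarrow> ereal" where
  "log_profile \<phi> x = \<phi> (\<chi> i. of_real (exp (x $ i)))"

definition concave_profile :: "(complex ^ 'n \<Rightarrow> ereal) \<Rightarrow> real ^ 'n \<Rightarrow> ereal" where
  "concave_profile \<phi> x = - log_profile \<phi> (- x)"

text \<open>Boundedness above means by a real constant (every set of extended reals is bounded above
  by \<open>\<infinity>\<close>).\<close>

definition newton_body_on :: "(real ^ 'n) set \<Rightarrow> (real ^ 'n \<Rightarrow> ereal) \<Rightarrow> (real ^ 'n) set" where
  "newton_body_on D g = {\<mu>. \<exists>C::real. \<forall>x\<in>D. g x - ereal (\<mu> \<bullet> x) \<le> ereal C}"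

definition newton_body :: "real ^ 'n \<Rightarrow> (complex ^ 'n \<Rightarrow> ereal) \<Rightarrow> (real ^ 'n) set" where
  "newton_body r \<phi> = newton_body_on {x. \<forall>i. - ln (r $ i) < x $ i} (concave_profile \<phi>)"


section \<open>Holomorphic functions and multiplier ideals\<close>

definition holomorphic_on_Cn :: "(complex ^ 'n \<Rightarrow> complex) \<Rightarrow> (complex ^ 'n) set \<Rightarrow> bool" where
  "holomorphic_on_Cn F X \<longleftrightarrow>
     (\<forall>z\<in>X. \<exists>D. (F has_derivative D) (at z) \<and> (\<forall>c v. D (c *s v) = c * D v))"

text \<open>The elements are normalised to be \<^term>\<open>undefined\<close> outside \<open>X\<close>, so that equality
  in the ring is equality on \<open>X\<close>.\<close>

definition holo_ring :: "(complex ^ 'n) set \<Rightarrow> (complex ^ 'n \<Rightarrow> complex) ring" where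
  "holo_ring X =
     \<lparr>carrier = {F \<in> extensional X. holomorphic_on_Cn F X},
      mult = (\<lambda>F G. \<lambda>z\<in>X. F z * G z),
      one = (\<lambda>z\<in>X. 1),
      zero = (\<lambda>z\<in>X. 0),
      add = (\<lambda>F G. \<lambda>z\<in>X. F z + G z)\<rparr>"

definition ereal_exp :: "ereal \<Rightarrow> ennreal" where
  "ereal_exp x = (case x of ereal t \<Rightarrow> ennreal (exp t) | PInfty \<Rightarrow> \<infinity> | MInfty \<Rightarrow> 0)"

definition locally_integrable_on :: "'a::euclidean_space set \<Rightarrow> ('a \<Rightarrow> ennreal) \<Rightarrow> bool" where
  "locally_integrable_on X w \<longleftrightarrow>
     (\<forall>K. compact K \<longrightarrow> K \<subseteq> X \<longrightarrow> (\<integral>\<^sup>+ z\<in>K. w z \<partial>lborel) < \<infinity>)"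

text \<open>Where \<open>F z = 0\<close> and \<open>\<phi> z = -\<infinity>\<close> the weight below is \<open>0\<close>; this is
  harmless, as \<open>{\<phi> = -\<infinity>}\<close> is a null set for plurisubharmonic \<open>\<phi>\<close>.\<close>

definition multiplier_ideal ::
  "(complex ^ 'n) set \<Rightarrow> (complex ^ 'n \<Rightarrow> ereal) \<Rightarrow> (complex ^ 'n \<Rightarrow> complex) set" where
  "multiplier_ideal X \<phi> =
     {F \<in> carrier (holo_ring X).
        locally_integrable_on X (\<lambda>z. ennreal ((cmod (F z))\<^sup>2) * ereal_exp (- 2 * \<phi> z))}"

definition monomial_fun :: "(complex ^ 'n) set \<Rightarrow> nat ^ 'n \<Rightarrow> complex ^ 'n \<Rightarrow> complex" where
  "monomial_fun X \<alpha> = (\<lambda>z\<in>X. \<Prod>i\<in>UNIV. z $ i ^ (\<alpha> $ i))"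

definition monomial_ideal :: "(complex ^ 'n) set \<Rightarrow> (complex ^ 'n \<Rightarrow> complex) set \<Rightarrow> bool" where
  "monomial_ideal X I \<longleftrightarrow>
     ideal I (holo_ring X) \<and>
     (\<exists>S. I = genideal (holo_ring X) (monomial_fun X ` S))"

end

theory Submission
  imports Defs "HOL-Complex_Analysis.Conformal_Mappings" "HOL-Real_Asymp.Real_Asymp"
begin

text \<open>In logarithmic coordinates \<open>\<phi>\<close> is a convex function \<open>f\<close>, and up to a constant
  \<open>|z\<^sup>\<alpha>|\<^sup>2 e\<^sup>-\<^sup>2\<^sup>\<phi>\<close> times Lebesgue measure is \<open>e\<^sup>2\<^sup>h\<close> times Lebesgue measure, where
  \<open>h(y) = \<langle>\<alpha> + \<one>, y\<rangle> - f(y)\<close> is concave. If \<open>\<alpha> + \<one>\<close> is interior to the Newton body, \<open>h\<close> decreases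
  linearly towards \<open>-\<infinity>\<close>, and the integral is finite. Otherwise \<open>h\<close> does not decrease along some
  \<open>d \<le> 0\<close>, \<open>d \<noteq> 0\<close>; the translation by \<open>d\<close> then maps the domain onto a strictly smaller one with at
  least the same integral, so the integral is infinite. The multiplier ideal is invariant under
  rotations of the coordinates. Averaging over them, it contains the monomial components of its
  elements, and Dickson's lemma reduces these to finitely many monomials.\<close>

section \<open>Separately holomorphic functions on polydisks\<close>

text \<open>No integral over the torus or in polar coordinates is ever formed. Translation by
  \<open>d\<close> in log-coordinates is the linear scaling of each z_i by exp(d_i), whose Jacobian
  produces the shift from \<alpha> to \<alpha> + 1; rotation averages are finite means over roots of
  unity. Convexity of f has to be extracted from upper semicontinuity and circle means on complex
  lines. As f is neither smooth nor finite a priori, this is done by contact with quadratic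
  polynomials from above and not by second derivatives. The obstacle for monomiality is that a
  generated ideal only has finite sums, while F has an infinite power series. Hence F is expanded to
  a fixed finite order, with holomorphic remainders as coefficients. Two operations make all the
  terms: setting z_j = 0, and dividing the difference by z_j. The averaging controls the first, and
  the second follows from it after multiplication by z_j.\<close>

definition upd_coord :: "complex ^ 'n \<Rightarrow> 'n \<Rightarrow> complex \<Rightarrow> complex ^ 'n" where
  "upd_coord z j w = (\<chi> i. if i = j then w else z $ i)"

lemma upd_coord_nth [simp]: "upd_coord z j w $ i = (if i = j then w else z $ i)"
  by (simp add: upd_coord_def)

lemma upd_coord_same [simp]: "upd_coord z j (z $ j) = z"
  by (simp add: vec_eq_iff)

lemma upd_coord_idem [simp]: "upd_coord (upd_coord z j v) j w = upd_coord z j w"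
  by (simp add: vec_eq_iff)

lemma upd_coord_swap: "i \<noteq> j \<Longrightarrow> upd_coord (upd_coord z i v) j w = upd_coord (upd_coord z j w) i v"
  by (auto simp: vec_eq_iff)

lemma continuous_on_upd_coord [continuous_intros]:
  assumes "continuous_on S f" "continuous_on S g"
  shows "continuous_on S (\<lambda>x. upd_coord (f x) j (g x))"
proof -
  have "continuous_on S (\<lambda>x. if i = j then g x else f x $ i)" for i
    using assms by (cases "i = j") (auto intro!: continuous_intros)
  then show ?thesis
    unfolding upd_coord_def by (intro continuous_on_vec_lambda)
qed

lemma open_polydisk: "open (polydisk r)"
proof -
  have "polydisk r = (\<Inter>i. {z. cmod (z $ i) < r $ i})"
    by (auto simp: polydisk_def)
  also have "open \<dots>"
    by (intro open_INT ballI open_Collect_less continuous_intros) auto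
  finally show ?thesis .
qed

lemma upd_coord_in_polydisk:
  "z \<in> polydisk r \<Longrightarrow> upd_coord z j w \<in> polydisk r \<longleftrightarrow> cmod w < r $ j"
  by (auto simp: polydisk_def)

lemma polydisk_coord: "z \<in> polydisk r \<Longrightarrow> cmod (z $ j) < r $ j"
  by (simp add: polydisk_def)

lemma polydisk_radius_pos: "z \<in> polydisk r \<Longrightarrow> 0 < r $ j"
  using polydisk_coord[of z r j] norm_ge_zero[of "z $ j"] by linarith

text \<open>Continuity is built in, so that Osgood's lemma suffices for the equivalence with complex
  differentiability. In this form each closure property is a statement about one complex
  variable.\<close>

definition sep_holomorphic :: "real ^ 'n \<Rightarrow> (complex ^ 'n \<Rightarrow> complex) \<Rightarrow> bool" where
  "sep_holomorphic r F \<longleftrightarrow>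
     continuous_on (polydisk r) F \<and>
     (\<forall>z\<in>polydisk r. \<forall>i. (\<lambda>w. F (upd_coord z i w)) holomorphic_on ball 0 (r $ i))"

text \<open>The quotient in the division of \<open>F\<close> by z_j - a, with remainder the
  restriction of \<open>F\<close> to z_j = a. For general \<open>a\<close> it gives the factors in
  Osgood's lemma; for a = 0 its iterates are the remainders of the Taylor expansion in z_j.\<close>

definition coord_quot :: "(complex ^ 'n \<Rightarrow> complex) \<Rightarrow> 'n \<Rightarrow> complex \<Rightarrow> complex ^ 'n \<Rightarrow> complex" where
  "coord_quot F j a z =
     (if z $ j = a then deriv (\<lambda>w. F (upd_coord z j w)) a
      else (F z - F (upd_coord z j a)) / (z $ j - a))"

lemma coord_quot_mult:
  "F z = F (upd_coord z j a) + (z $ j - a) * coord_quot F j a z"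
proof (cases "z $ j = a")
  case True
  then have "upd_coord z j a = z" using upd_coord_same[of z j] by simp
  then show ?thesis using True by simp
qed (simp add: coord_quot_def)

lemma coord_quot_upd:
  "coord_quot F j a (upd_coord z j w) =
    (if w = a then deriv (\<lambda>w. F (upd_coord z j w)) a
     else (F (upd_coord z j w) - F (upd_coord z j a)) / (w - a))"
  by (simp add: coord_quot_def)

lemma coord_quot_holomorphic_same:
  assumes "sep_holomorphic r F" "z \<in> polydisk r" "a \<in> ball 0 (r $ j)"
  shows "(\<lambda>w. coord_quot F j a (upd_coord z j w)) holomorphic_on ball 0 (r $ j)"
  unfolding coord_quot_upd
  using assms by (intro pole_lemma) (auto simp: sep_holomorphic_def)

text \<open>The two branches of the definition do not visibly fit together at z_j = a. Cauchy's
  formula in z_j expresses both by the values on a circle around \<open>a\<close> and z_j, where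
  only the ordinary quotient occurs; an integral of a jointly continuous function depends
  continuously on the parameter.\<close>

lemma continuous_on_coord_quot:
  assumes F: "sep_holomorphic r F" and a: "a \<in> ball 0 (r $ j)"
  shows "continuous_on (polydisk r) (coord_quot F j a)"
proof (rule continuous_at_imp_continuous_on, rule ballI)
  fix z0 assume z0: "z0 \<in> polydisk r"
  obtain \<rho> where \<rho>: "max (cmod a) (cmod (z0 $ j)) < \<rho>" "\<rho> < r $ j"
    using dense[of "max (cmod a) (cmod (z0 $ j))" "r $ j"] a polydisk_coord[OF z0] by auto
  then have \<rho>0: "0 < \<rho>" using norm_ge_zero[of a] by linarith
  define U where "U = polydisk r \<inter> {z. cmod (z $ j) < \<rho>}"
  have "open U" unfolding U_def
    by (intro open_Int open_polydisk open_Collect_less continuous_intros)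
  define c where "c t = circlepath 0 \<rho> t" for t
  define K where "K z t = (F (upd_coord z j (c t)) - F (upd_coord z j a)) / ((c t - a) * (c t - z $ j))
     * (2 * pi * \<i> * \<rho> * exp (2 * of_real pi * \<i> * t))" for z and t :: real
  have cn: "cmod (c t) = \<rho>" for t
    using \<rho>0 by (simp add: c_def circlepath norm_mult)
  have formula: "coord_quot F j a z = integral {0..1} (K z) / (2 * pi * \<i>)" if "z \<in> U" for z
  proof -
    have z: "z \<in> polydisk r" "cmod (z $ j) < \<rho>" using that by (auto simp: U_def)
    define G where "G w = coord_quot F j a (upd_coord z j w)" for w
    have "G holomorphic_on cball 0 \<rho>"
      using coord_quot_holomorphic_same[OF F z(1) a] unfolding G_def
      by (rule holomorphic_on_subset) (use \<rho> in auto)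
    then have "((\<lambda>u. G u / (u - z $ j)) has_contour_integral (2 * of_real pi * \<i> * G (z $ j))) (circlepath 0 \<rho>)"
      using z by (intro Cauchy_integral_circlepath_simple) auto
    then have "((\<lambda>t. G (c t) / (c t - z $ j) * (2 * pi * \<i> * \<rho> * exp (2 * of_real pi * \<i> * t)))
        has_integral (2 * of_real pi * \<i> * G (z $ j))) {0..1}"
      unfolding has_contour_integral c_def vector_derivative_circlepath by simp
    moreover have "G (c t) / (c t - z $ j) = (F (upd_coord z j (c t)) - F (upd_coord z j a)) / ((c t - a) * (c t - z $ j))" for t
    proof -
      have "c t \<noteq> a" using cn[of t] \<rho> by auto
      then show ?thesis unfolding G_def coord_quot_upd by simp
    qed
    ultimately have "(K z has_integral (2 * of_real pi * \<i> * G (z $ j))) {0..1}"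
      by (simp add: K_def[abs_def])
    then show ?thesis
      by (simp add: integral_unique G_def)
  qed
  have "continuous_on U (\<lambda>z. integral (cbox 0 1) (K z))"
  proof (rule integral_continuous_on_param)
    have cc: "continuous_on S (\<lambda>p. c (snd p))" for S :: "((complex ^ 'a) \<times> real) set"
      unfolding c_def circlepath by (intro continuous_intros)
    have F': "continuous_on (U \<times> cbox 0 1) (\<lambda>p. F (upd_coord (fst p) j (h p)))"
      if h: "continuous_on (U \<times> cbox 0 1) h" "\<And>p. cmod (h p) < r $ j"
      for h :: "(complex ^ 'a) \<times> real \<Rightarrow> complex"
    proof (rule continuous_on_compose2[of "polydisk r" F])
      show "continuous_on (polydisk r) F" using F by (simp add: sep_holomorphic_def)
      show "continuous_on (U \<times> cbox 0 1) (\<lambda>p. upd_coord (fst p) j (h p))"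
        by (intro continuous_intros h)
      show "(\<lambda>p. upd_coord (fst p) j (h p)) ` (U \<times> cbox 0 1) \<subseteq> polydisk r"
        using h(2) by (auto simp: U_def upd_coord_in_polydisk)
    qed
    have nz: "(c (snd p) - a) * (c (snd p) - fst p $ j) \<noteq> 0" if "p \<in> U \<times> cbox 0 1" for p
    proof -
      have "cmod (fst p $ j) < \<rho>" using that by (auto simp: U_def)
      then show ?thesis using cn[of "snd p"] \<rho> by auto
    qed
    show "continuous_on (U \<times> cbox 0 1) (\<lambda>(z, t). K z t)"
      unfolding K_def case_prod_unfold
      using cn \<rho> a nz by (intro continuous_intros F' cc) auto
  qed
  then have "continuous_on U (coord_quot F j a)"
    by (subst continuous_on_cong[OF refl formula]) (auto intro!: continuous_intros)
  moreover have "z0 \<in> U" using z0 \<rho> by (simp add: U_def)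
  ultimately show "isCont (coord_quot F j a) z0"
    using \<open>open U\<close> by (simp add: continuous_on_eq_continuous_at)
qed

text \<open>Since y_j - z_j vanishes at y = z, continuity of \<open>q\<close> replaces
  differentiability: the remainder (y_j - z_j) (q y - q z) is small compared with
  \<open>norm (y - z)\<close>.\<close>

lemma has_derivative_coord_mult:
  fixes q :: "complex ^ 'n \<Rightarrow> complex"
  assumes "isCont q z"
  shows "((\<lambda>y. (y $ j - z $ j) * q y) has_derivative (\<lambda>h. q z * h $ j)) (at z)"
proof (rule has_derivativeI_sandwich[of 1])
  show "bounded_linear (\<lambda>h :: complex ^ 'n. q z * h $ j)"
    by (intro bounded_linear_const_mult bounded_linear_vec_nth)
  show "((\<lambda>y. cmod (q y - q z)) \<longlongrightarrow> 0) (at z)"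
    using assms unfolding isCont_def by (intro tendsto_norm_zero) (simp add: LIM_zero_iff)
  fix y assume "y \<noteq> z"
  have "norm ((y $ j - z $ j) * q y - (z $ j - z $ j) * q z - q z * (y - z) $ j)
    = cmod ((y - z) $ j) * cmod (q y - q z)"
    by (simp add: norm_mult[symmetric] algebra_simps)
  also have "\<dots> \<le> norm (y - z) * cmod (q y - q z)"
    using Finite_Cartesian_Product.norm_nth_le[of "y - z" j] by (intro mult_right_mono) auto
  finally show "norm ((y $ j - z $ j) * q y - (z $ j - z $ j) * q z - q z * (y - z) $ j) / norm (y - z)
    \<le> cmod (q y - q z)"
    using \<open>y \<noteq> z\<close> by (simp add: divide_le_eq mult.commute)
qed auto

text \<open>Osgood's lemma: changing the coordinates one at a time, \<open>F y - F z\<close> is a sum of terms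
  \<open>(y\<^sub>j - z\<^sub>j) q\<^sub>j(y)\<close> with continuous \<open>q\<^sub>j\<close>.\<close>

lemma sep_holomorphic_imp_holomorphic:
  assumes F: "sep_holomorphic r F"
  shows "holomorphic_on_Cn F (polydisk r)"
  unfolding holomorphic_on_Cn_def
proof
  fix z assume z: "z \<in> polydisk r"
  define mix where "mix S y = (\<chi> i. if i \<in> S then y $ i else z $ i)" for S and y :: "complex ^ 'a"
  define D where "D S h = (\<Sum>i\<in>S. coord_quot F i (z $ i) z * h $ i)" for S h
  have mixz: "mix S z = z" for S by (simp add: mix_def vec_eq_iff)
  have mix_cont: "continuous_on S' (mix S)" for S S'
  proof -
    have "continuous_on S' (\<lambda>y. if i \<in> S then y $ i else z $ i)" for i
      by (cases "i \<in> S") (auto intro!: continuous_intros)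
    then show ?thesis unfolding mix_def by (intro continuous_on_vec_lambda)
  qed
  have "((\<lambda>y. F (mix S y)) has_derivative D S) (at z)" for S
    using finite[of S]
  proof (induction S rule: finite_induct)
    case empty
    then show ?case by (simp add: mix_def D_def[abs_def])
  next
    case (insert j S)
    let ?q = "\<lambda>y. coord_quot F j (z $ j) (mix (insert j S) y)"
    have "isCont (coord_quot F j (z $ j)) z"
      using continuous_on_coord_quot[OF F, of "z $ j" j] z polydisk_coord[OF z, of j]
      by (simp add: continuous_on_eq_continuous_at[OF open_polydisk])
    moreover have "isCont (mix (insert j S)) z"
      using mix_cont[of UNIV] by (simp add: continuous_on_eq_continuous_at)
    ultimately have "isCont ?q z"
      using isCont_o2[of z "mix (insert j S)" "coord_quot F j (z $ j)"] by (simp add: mixz)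
    then have "((\<lambda>y. F (mix S y) + (y $ j - z $ j) * ?q y) has_derivative
        (\<lambda>h. D S h + ?q z * h $ j)) (at z)"
      by (intro has_derivative_add insert.IH has_derivative_coord_mult)
    moreover have "F (mix (insert j S) y) = F (mix S y) + (y $ j - z $ j) * ?q y" for y
    proof -
      have "upd_coord (mix (insert j S) y) j (z $ j) = mix S y"
        using insert.hyps by (auto simp: mix_def vec_eq_iff)
      moreover have "mix (insert j S) y $ j = y $ j" by (simp add: mix_def)
      ultimately show ?thesis
        using coord_quot_mult[of F "mix (insert j S) y" j "z $ j"] by simp
    qed
    moreover have "D (insert j S) h = D S h + ?q z * h $ j" for h
      using insert.hyps by (simp add: D_def mixz)
    ultimately show ?case by simp
  qed
  from this[of UNIV] have "(F has_derivative D UNIV) (at z)"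
    by (simp add: mix_def)
  moreover have "D UNIV (c *s v) = c * D UNIV v" for c v
    by (simp add: D_def sum_distrib_left mult_ac)
  ultimately show "\<exists>D. (F has_derivative D) (at z) \<and> (\<forall>c v. D (c *s v) = c * D v)"
    by blast
qed

lemma holomorphic_imp_sep_holomorphic:
  assumes F: "holomorphic_on_Cn F (polydisk r)"
  shows "sep_holomorphic r F"
  unfolding sep_holomorphic_def
proof (intro conjI ballI allI)
  show "continuous_on (polydisk r) F"
    using F unfolding holomorphic_on_Cn_def
    by (intro continuous_at_imp_continuous_on) (blast dest: has_derivative_continuous)
  fix z i assume z: "z \<in> polydisk r"
  show "(\<lambda>w. F (upd_coord z i w)) holomorphic_on ball 0 (r $ i)"
  proof (rule holomorphic_onI)
    fix w :: complex assume w: "w \<in> ball 0 (r $ i)"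
    then have "upd_coord z i w \<in> polydisk r"
      using z by (simp add: upd_coord_in_polydisk)
    then obtain D where D: "(F has_derivative D) (at (upd_coord z i w))" "\<And>c v. D (c *s v) = c * D v"
      using F unfolding holomorphic_on_Cn_def by blast
    have eq: "upd_coord z i = (\<lambda>w :: complex. upd_coord z i 0 + w *s axis i 1)"
      by (auto simp: vec_eq_iff axis_def fun_eq_iff)
    have "bounded_linear (\<lambda>w :: complex. w *s (axis i 1 :: complex ^ 'a))"
      by (subst linear_conv_bounded_linear[symmetric]) (auto intro!: linearI simp: vec_eq_iff algebra_simps)
    then have "(upd_coord z i has_derivative (\<lambda>w. w *s axis i 1)) (at w)"
      by (subst eq) (auto intro!: derivative_eq_intros bounded_linear_imp_has_derivative)
    from has_derivative_compose[OF this D(1)]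
    have "((\<lambda>w. F (upd_coord z i w)) has_derivative (\<lambda>h. D (axis i 1) * h)) (at w)"
      by (simp add: D(2) mult.commute)
    then show "(\<lambda>w. F (upd_coord z i w)) field_differentiable at w within ball 0 (r $ i)"
      by (metis field_differentiable_at_within field_differentiable_def has_field_derivative_def)
  qed
qed

lemma holomorphic_on_Cn_iff_sep: "holomorphic_on_Cn F (polydisk r) \<longleftrightarrow> sep_holomorphic r F"
  using sep_holomorphic_imp_holomorphic holomorphic_imp_sep_holomorphic by blast

section \<open>Closure properties of separately holomorphic functions\<close>

lemma sep_holomorphic_const: "sep_holomorphic r (\<lambda>z. c)"
  by (auto simp: sep_holomorphic_def)

lemma sep_holomorphic_coord: "sep_holomorphic r (\<lambda>z. z $ i)"
proof -
  have "(\<lambda>w. upd_coord z j w $ i) holomorphic_on S" for z j S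
    by (cases "i = j") auto
  then show ?thesis
    unfolding sep_holomorphic_def by (auto intro!: continuous_intros simp del: upd_coord_nth)
qed

lemma sep_holomorphic_add:
  "sep_holomorphic r F \<Longrightarrow> sep_holomorphic r G \<Longrightarrow> sep_holomorphic r (\<lambda>z. F z + G z)"
  by (auto simp: sep_holomorphic_def intro!: continuous_intros holomorphic_intros)

lemma sep_holomorphic_mult:
  "sep_holomorphic r F \<Longrightarrow> sep_holomorphic r G \<Longrightarrow> sep_holomorphic r (\<lambda>z. F z * G z)"
  by (auto simp: sep_holomorphic_def intro!: continuous_intros holomorphic_intros)

lemma sep_holomorphic_power:
  "sep_holomorphic r F \<Longrightarrow> sep_holomorphic r (\<lambda>z. F z ^ k)"
  by (auto simp: sep_holomorphic_def intro!: continuous_intros holomorphic_intros)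

lemma sep_holomorphic_prod:
  "(\<And>i. i \<in> A \<Longrightarrow> sep_holomorphic r (F i)) \<Longrightarrow> sep_holomorphic r (\<lambda>z. \<Prod>i\<in>A. F i z)"
  by (auto simp: sep_holomorphic_def intro!: continuous_intros holomorphic_intros)

lemma sep_holomorphic_cong:
  assumes eq: "\<And>z. z \<in> polydisk r \<Longrightarrow> F z = G z"
  shows "sep_holomorphic r F \<longleftrightarrow> sep_holomorphic r G"
proof -
  have "continuous_on (polydisk r) F \<longleftrightarrow> continuous_on (polydisk r) G"
    by (intro continuous_on_cong refl eq)
  moreover have "(\<lambda>w. F (upd_coord z i w)) holomorphic_on ball 0 (r $ i) \<longleftrightarrow>
    (\<lambda>w. G (upd_coord z i w)) holomorphic_on ball 0 (r $ i)" if "z \<in> polydisk r" for z i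
    using that by (intro holomorphic_cong refl eq) (simp add: upd_coord_in_polydisk)
  ultimately show ?thesis
    unfolding sep_holomorphic_def by blast
qed

lemma sep_holomorphic_upd_zero:
  assumes F: "sep_holomorphic r F"
  shows "sep_holomorphic r (\<lambda>z. F (upd_coord z j 0))"
  unfolding sep_holomorphic_def
proof (intro conjI ballI allI)
  have in_X: "upd_coord z j 0 \<in> polydisk r" if "z \<in> polydisk r" for z
    using that polydisk_radius_pos[OF that] by (simp add: upd_coord_in_polydisk)
  then show "continuous_on (polydisk r) (\<lambda>z. F (upd_coord z j 0))"
    using F unfolding sep_holomorphic_def
    by (elim conjE continuous_on_compose2) (auto intro!: continuous_intros)
  fix z i assume z: "z \<in> polydisk r"
  show "(\<lambda>w. F (upd_coord (upd_coord z i w) j 0)) holomorphic_on ball 0 (r $ i)"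
  proof (cases "i = j")
    case False
    then show ?thesis
      using F in_X[OF z] by (simp add: upd_coord_swap[OF False] sep_holomorphic_def)
  qed simp
qed

text \<open>In another coordinate z_i the quotient is plainly holomorphic as long as z_j is nonzero.
  On z_j = 0 it is a derivative, reached as a uniform limit of the quotients at z_j =
  \<open>e n\<close>; the uniformity comes from joint continuity on a compact product of
  disks.\<close>

lemma sep_holomorphic_coord_quot:
  assumes F: "sep_holomorphic r F"
  shows "sep_holomorphic r (coord_quot F j 0)"
  unfolding sep_holomorphic_def
proof (intro conjI ballI allI)
  show cont: "continuous_on (polydisk r) (coord_quot F j 0)"
  proof (cases "polydisk r = {}")
    case False
    then show ?thesis using polydisk_radius_pos by (intro continuous_on_coord_quot[OF F]) auto
  qed simp
  fix z i assume z: "z \<in> polydisk r"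
  have r: "0 < r $ k" for k using polydisk_radius_pos[OF z] .
  show "(\<lambda>w. coord_quot F j 0 (upd_coord z i w)) holomorphic_on ball 0 (r $ i)"
  proof (cases "i = j")
    case True
    then show ?thesis
      using coord_quot_holomorphic_same[OF F z, of 0 j] r by simp
  next
    case ij: False
    have nonzero: "(\<lambda>w. coord_quot F j 0 (upd_coord z i w)) holomorphic_on ball 0 (r $ i)"
      if z: "z \<in> polydisk r" and "z $ j \<noteq> 0" for z
    proof -
      have "upd_coord z j 0 \<in> polydisk r" using z r by (simp add: upd_coord_in_polydisk)
      then show ?thesis
        using F z that(2) ij
        by (auto simp: coord_quot_def upd_coord_swap[OF ij] sep_holomorphic_def intro!: holomorphic_intros)
    qed
    show ?thesis
    proof (cases "z $ j = 0")
      case False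
      then show ?thesis using nonzero[OF z] by blast
    next
      case True
      define p where "p s w = upd_coord (upd_coord z j s) i w" for s w
      \<comment> \<open>The denominator n + 2 keeps every \<open>e n\<close> nonzero and inside the
        compact disk of radius r_j / 2 on which uniform continuity is used.\<close>
      define e where "e n = complex_of_real (r $ j / (real n + 2))" for n :: nat
      have p_in: "p s w \<in> polydisk r" if "cmod s < r $ j" "cmod w < r $ i" for s w
        using z that by (auto simp: p_def polydisk_def)
      have e_le: "cmod (e n) \<le> r $ j / 2" for n
        unfolding e_def norm_of_real using r[of j] by (simp add: field_simps)
      have e_lim: "e \<longlonglongrightarrow> 0"
      proof -
        have "(\<lambda>n. r $ j / (real n + 2)) \<longlonglongrightarrow> 0" by real_asymp
        from tendsto_of_real[OF this, where 'a = complex] show ?thesis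
          unfolding e_def[abs_def] of_real_0 .
      qed
      have "(\<lambda>w. coord_quot F j 0 (p 0 w)) holomorphic_on ball 0 (r $ i)"
      proof (rule holomorphic_uniform_sequence)
        fix n
        have "e n \<noteq> 0" unfolding e_def of_real_eq_0_iff using r[of j] by simp
        moreover have "upd_coord z j (e n) \<in> polydisk r"
          using z e_le[of n] r[of j] by (simp add: upd_coord_in_polydisk)
        ultimately show "(\<lambda>w. coord_quot F j 0 (p (e n) w)) holomorphic_on ball 0 (r $ i)"
          unfolding p_def using nonzero[of "upd_coord z j (e n)"] by simp
      next
        fix w0 :: complex assume "w0 \<in> ball 0 (r $ i)"
        then obtain d where d: "0 < d" "cball w0 d \<subseteq> ball 0 (r $ i)"
          using open_contains_cball_eq[OF open_ball] by metis
        have "continuous_on (cball 0 (r $ j / 2) \<times> cball w0 d) (\<lambda>(s, w). coord_quot F j 0 (p s w))"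
          unfolding case_prod_unfold
        proof (rule continuous_on_compose2[OF cont])
          show "continuous_on (cball 0 (r $ j / 2) \<times> cball w0 d) (\<lambda>x. p (fst x) (snd x))"
            unfolding p_def by (intro continuous_intros)
          show "(\<lambda>x. p (fst x) (snd x)) ` (cball 0 (r $ j / 2) \<times> cball w0 d) \<subseteq> polydisk r"
            using d(2) r[of j] by (force intro!: p_in)
        qed
        then have uc: "uniformly_continuous_on (cball 0 (r $ j / 2) \<times> cball w0 d) (\<lambda>(s, w). coord_quot F j 0 (p s w))"
          by (intro compact_uniformly_continuous compact_Times) auto
        have "uniform_limit (cball w0 d) (\<lambda>n w. coord_quot F j 0 (p (e n) w)) (\<lambda>w. coord_quot F j 0 (p 0 w)) sequentially"
        proof (rule uniform_limitI)
          fix \<epsilon> :: real assume "0 < \<epsilon>"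
          with uc obtain \<delta> where \<delta>: "0 < \<delta>"
            "\<And>x x'. x \<in> cball 0 (r $ j / 2) \<times> cball w0 d \<Longrightarrow> x' \<in> cball 0 (r $ j / 2) \<times> cball w0 d \<Longrightarrow> dist x' x < \<delta> \<Longrightarrow>
               dist ((\<lambda>(s, w). coord_quot F j 0 (p s w)) x') ((\<lambda>(s, w). coord_quot F j 0 (p s w)) x) < \<epsilon>"
            unfolding uniformly_continuous_on_def by metis
          have "eventually (\<lambda>n. dist (e n) 0 < \<delta>) sequentially"
            using e_lim \<delta>(1) by (rule tendstoD)
          then show "\<forall>\<^sub>F n in sequentially. \<forall>w\<in>cball w0 d. dist (coord_quot F j 0 (p (e n) w)) (coord_quot F j 0 (p 0 w)) < \<epsilon>"
          proof eventually_elim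
            case (elim n)
            show ?case
            proof
              fix w assume "w \<in> cball w0 d"
              then show "dist (coord_quot F j 0 (p (e n) w)) (coord_quot F j 0 (p 0 w)) < \<epsilon>"
                using \<delta>(2)[of "(0, w)" "(e n, w)"] e_le[of n] elim r[of j] by (simp add: dist_Pair_Pair)
            qed
          qed
        qed
        with d show "\<exists>d>0. cball w0 d \<subseteq> ball 0 (r $ i) \<and>
          uniform_limit (cball w0 d) (\<lambda>n w. coord_quot F j 0 (p (e n) w)) (\<lambda>w. coord_quot F j 0 (p 0 w)) sequentially"
          by blast
      qed auto
      moreover have "p 0 w = upd_coord z i w" for w
        using True upd_coord_same[of z j] by (simp add: p_def)
      ultimately show ?thesis by simp
    qed
  qed
qed


section \<open>Taylor coefficients in one coordinate\<close>

lemma sep_holomorphic_coord_quot_funpow: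
  "sep_holomorphic r F \<Longrightarrow> sep_holomorphic r (((\<lambda>G. coord_quot G j 0) ^^ k) F)"
  by (induction k) (auto intro: sep_holomorphic_coord_quot)

definition indep_coord :: "real ^ 'n \<Rightarrow> 'n \<Rightarrow> (complex ^ 'n \<Rightarrow> complex) \<Rightarrow> bool" where
  "indep_coord r i F \<longleftrightarrow> (\<forall>z\<in>polydisk r. F z = F (upd_coord z i 0))"

lemma upd_zero_in_polydisk: "z \<in> polydisk r \<Longrightarrow> upd_coord z j 0 \<in> polydisk r"
  using polydisk_radius_pos[of z r j] by (simp add: upd_coord_in_polydisk)

lemma indep_coord_upd_zero_same: "indep_coord r j (\<lambda>z. F (upd_coord z j 0))"
  by (simp add: indep_coord_def)

lemma indep_coord_upd_zero:
  assumes "indep_coord r i F"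
  shows "indep_coord r i (\<lambda>z. F (upd_coord z j 0))"
proof (cases "i = j")
  case False
  have "F (upd_coord z j 0) = F (upd_coord (upd_coord z i 0) j 0)" if "z \<in> polydisk r" for z
    using assms upd_zero_in_polydisk[OF that, of j]
    unfolding indep_coord_def by (metis False upd_coord_swap)
  then show ?thesis by (simp add: indep_coord_def)
qed (simp add: indep_coord_def)

lemma indep_coord_quot:
  assumes F: "indep_coord r i F" and ij: "i \<noteq> j"
  shows "indep_coord r i (coord_quot F j 0)"
  unfolding indep_coord_def
proof
  fix z assume z: "z \<in> polydisk r"
  have eq: "F (upd_coord z j w) = F (upd_coord (upd_coord z i 0) j w)" if "cmod w < r $ j" for w
  proof -
    have "upd_coord z j w \<in> polydisk r" using z that by (simp add: upd_coord_in_polydisk)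
    then show ?thesis using F ij unfolding indep_coord_def by (metis upd_coord_swap)
  qed
  \<comment> \<open>On z_j = 0 the quotient is a derivative, so the equality must hold for all w
    near 0 and not only at 0.\<close>
  have "eventually (\<lambda>w. w \<in> ball 0 (r $ j)) (nhds 0)"
    using polydisk_radius_pos[OF z] by (intro eventually_nhds_in_open) auto
  then have "eventually (\<lambda>w. F (upd_coord z j w) = F (upd_coord (upd_coord z i 0) j w)) (nhds 0)"
    by eventually_elim (simp add: eq)
  then have "deriv (\<lambda>w. F (upd_coord z j w)) 0 = deriv (\<lambda>w. F (upd_coord (upd_coord z i 0) j w)) 0"
    by (intro deriv_cong_ev) auto
  moreover have "F z = F (upd_coord z i 0)" using F z by (simp add: indep_coord_def)
  moreover have "F (upd_coord z j 0) = F (upd_coord (upd_coord z i 0) j 0)"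
    using eq[of 0] polydisk_radius_pos[OF z] by simp
  ultimately show "coord_quot F j 0 z = coord_quot F j 0 (upd_coord z i 0)"
    using ij by (simp add: coord_quot_def)
qed

lemma indep_coord_quot_funpow:
  "indep_coord r i F \<Longrightarrow> i \<noteq> j \<Longrightarrow> indep_coord r i (((\<lambda>G. coord_quot G j 0) ^^ k) F)"
  by (induction k) (auto intro: indep_coord_quot)

lemma indep_all_coords_const:
  assumes "\<And>i. indep_coord r i F" and z: "z \<in> polydisk r"
  shows "F z = F 0"
proof -
  have "F z = F (\<chi> i. if i \<in> S then 0 else z $ i)" for S
    using finite[of S]
  proof (induction S rule: finite_induct)
    case (insert j S)
    let ?m = "\<chi> i. if i \<in> S then 0 else z $ i"
    have "?m \<in> polydisk r"
      using polydisk_coord[OF z] polydisk_radius_pos[OF z] by (auto simp: polydisk_def)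
    then have "F ?m = F (upd_coord ?m j 0)"
      using assms(1)[of j] by (simp add: indep_coord_def)
    also have "upd_coord ?m j 0 = (\<chi> i. if i \<in> insert j S then 0 else z $ i)"
      by (auto simp: vec_eq_iff)
    finally show ?case using insert.IH by simp
  qed simp
  from this[of UNIV] show ?thesis by (simp add: zero_vec_def)
qed

text \<open>The l-th iterate at z_j = 0 is the l-th Taylor coefficient in z_j. When the first
  \<open>k\<close> of them vanish, only the remainder term is left.\<close>

lemma coord_quot_expansion:
  assumes zero: "\<And>l. l < k \<Longrightarrow> ((\<lambda>G. coord_quot G j 0) ^^ l) F (upd_coord z j 0) = 0"
  shows "F z = (z $ j) ^ k * ((\<lambda>G. coord_quot G j 0) ^^ k) F z"
  using zero
proof (induction k)
  case (Suc k)
  then show ?case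
    using coord_quot_mult[of "((\<lambda>G. coord_quot G j 0) ^^ k) F" z j 0] by simp
qed simp

text \<open>The identity theorem in z_j: if all coefficients vanished, \<open>g\<close> would vanish
  at 0 to every order, whereas a nonconstant holomorphic function vanishes there to a finite
  order.\<close>

lemma ex_nonzero_coefficient:
  assumes F: "sep_holomorphic r F" and z: "z \<in> polydisk r" "F z \<noteq> 0"
  shows "\<exists>k. \<exists>y\<in>polydisk r. ((\<lambda>G. coord_quot G j 0) ^^ k) F (upd_coord y j 0) \<noteq> 0"
proof (rule ccontr)
  let ?T = "\<lambda>k. ((\<lambda>G. coord_quot G j 0) ^^ k) F"
  assume "\<not> ?thesis"
  then have zero: "?T k (upd_coord z j 0) = 0" for k using z by blast
  define g where "g w = F (upd_coord z j w)" for w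
  define B where "B = ball (0::complex) (r $ j)"
  have r: "0 < r $ j" using polydisk_radius_pos[OF z(1)] .
  have g_eq: "g w = w ^ k * ?T k (upd_coord z j w)" for w k
    unfolding g_def using coord_quot_expansion[where F = F and j = j and k = k and z = "upd_coord z j w"] zero by simp
  have T_hol: "(\<lambda>w. ?T k (upd_coord z j w)) holomorphic_on B" for k
    using sep_holomorphic_coord_quot_funpow[OF F, where j = j and k = k] z(1) unfolding sep_holomorphic_def B_def by blast
  have g_hol: "g holomorphic_on B" unfolding g_def using T_hol[of 0] by simp
  have g0: "g 0 = 0" using g_eq[of 0 1] by simp
  have "z $ j \<in> B" using polydisk_coord[OF z(1)] by (simp add: B_def)
  moreover have "g (z $ j) \<noteq> 0" using z(2) by (simp add: g_def)
  ultimately have "\<not> g constant_on B"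
    using g0 r unfolding constant_on_def B_def by (metis centre_in_ball)
  then obtain h \<rho> n where h: "0 < \<rho>" "ball 0 \<rho> \<subseteq> B" "h holomorphic_on ball 0 \<rho>"
    "\<And>w. w \<in> ball 0 \<rho> \<Longrightarrow> g w = (w - 0) ^ n * h w" "\<And>w. w \<in> ball 0 \<rho> \<Longrightarrow> h w \<noteq> 0"
    using holomorphic_factor_zero_nonconstant[OF g_hol, of 0 thesis] g0 r unfolding B_def by auto
  \<comment> \<open>The expansion to order \<open>Suc n\<close> has one more factor w than the
    factorization w^n h with h 0 \<noteq> 0; comparing limits at 0 forces h 0 = 0.\<close>
  let ?q = "\<lambda>w. w * ?T (Suc n) (upd_coord z j w)"
  have "h w = ?q w" if "w \<in> ball 0 \<rho> - {0}" for w
    using h(4)[of w] g_eq[of w "Suc n"] that by simp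
  then have ev: "eventually (\<lambda>w. h w = ?q w) (at 0)"
    using h(1) by (intro eventually_mono[OF eventually_at_in_open[of "ball 0 \<rho>" 0]]) auto
  have "continuous_on (ball 0 \<rho>) h"
    using h(3) by (rule holomorphic_on_imp_continuous_on)
  then have "isCont h 0"
    by (rule continuous_on_interior) (use h(1) in simp)
  then have "(h \<longlongrightarrow> h 0) (at 0)"
    by (rule isContD)
  moreover have "continuous_on B ?q"
    by (intro continuous_intros holomorphic_on_imp_continuous_on T_hol)
  then have "isCont ?q 0"
    by (rule continuous_on_interior) (use r in \<open>simp add: B_def\<close>)
  then have "(?q \<longlongrightarrow> ?q 0) (at 0)"
    by (rule isContD)
  then have "(h \<longlongrightarrow> ?q 0) (at 0)"
    using ev by (simp add: tendsto_cong)
  ultimately have "h 0 = ?q 0" by (rule tendsto_unique[rotated]) simp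
  then show False using h(5)[of 0] h(1) by simp
qed

section \<open>Averages over roots of unity\<close>

lemma sum_cis_root_of_unity:
  assumes "0 < N"
  shows "(\<Sum>l<N. cis (2 * pi * real l / real N) ^ n) = (if N dvd n then of_nat N else 0)"
proof -
  define \<omega> where "\<omega> = cis (2 * pi * n / N)"
  have eq: "cis (2 * pi * real l / real N) ^ n = \<omega> ^ l" for l :: nat
    unfolding \<omega>_def Complex.DeMoivre by (rule arg_cong[of _ _ cis]) (simp add: field_simps)
  have "\<omega> ^ N = 1"
  proof -
    have "\<omega> ^ N = cis (2 * pi * n)" using assms by (simp add: \<omega>_def Complex.DeMoivre)
    then show ?thesis by (simp add: cis_multiple_2pi)
  qed
  moreover have "\<omega> = 1 \<longleftrightarrow> N dvd n"
  proof -
    have "\<omega> = cis (2 * pi * (n / N))" by (simp add: \<omega>_def)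
    also have "\<dots> = 1 \<longleftrightarrow> (\<exists>k::int. real n / N = k)"
    proof
      assume "cis (2 * pi * (n / N)) = 1"
      then have "cos (2 * pi * (n / N)) = 1" by (simp add: complex_eq_iff)
      then obtain k :: int where "2 * pi * (n / N) = real_of_int k * 2 * pi" unfolding cos_one_2pi_int by blast
      moreover have "x = real_of_int k" if "2 * pi * x = real_of_int k * 2 * pi" for x
        using that by simp
      ultimately have "real n / N = k" by blast
      then show "\<exists>k::int. real n / N = k" ..
    next
      assume "\<exists>k::int. real n / N = k"
      then obtain k :: int where "real n / N = k" ..
      then show "cis (2 * pi * (n / N)) = 1" by (simp only:) (simp add: cis_multiple_2pi)
    qed
    also have "\<dots> \<longleftrightarrow> N dvd n"
    proof
      assume "\<exists>k::int. real n / N = k"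
      then obtain k :: int where "real n = k * real N" using assms by (auto simp: field_simps)
      then have "int n = k * int N" by (metis of_int_eq_iff of_int_mult of_int_of_nat_eq)
      then show "N dvd n" by (metis dvd_triv_right int_dvd_int_iff)
    qed (use assms in \<open>auto elim!: dvdE intro: exI[of _ "int _"]\<close>)
    finally show ?thesis .
  qed
  ultimately show ?thesis
    unfolding eq by (auto simp: geometric_sum)
qed

text \<open>Averaging over the N-th roots of unity keeps exactly the powers of degree divisible by
  N. Below degree N only the constant term \<open>g 0\<close> survives; the rest is dominated by the
  tail \<open>\<tau> N\<close> of an absolutely convergent series.\<close>

lemma rotation_average_tendsto:
  assumes g: "g holomorphic_on ball 0 R" and \<zeta>: "cmod \<zeta> < R"
  shows "(\<lambda>N. (\<Sum>l<N. g (cis (2 * pi * real l / real N) * \<zeta>)) / of_nat N) \<longlonglongrightarrow> g 0"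
proof -
  define a where "a n = (deriv ^^ n) g 0 / fact n" for n
  have sums: "(\<lambda>n. a n * w ^ n) sums g w" if "cmod w < R" for w
    using holomorphic_power_series[OF g, of w] that by (simp add: a_def)
  have summ: "summable (\<lambda>n. norm (a n * \<zeta> ^ n))"
  proof -
    obtain R' where R': "cmod \<zeta> < R'" "R' < R" using dense[OF \<zeta>] by blast
    have "summable (\<lambda>n. a n * of_real R' ^ n)"
      using sums[of "of_real R'"] R' norm_ge_zero[of \<zeta>] by (auto simp: sums_iff)
    from powser_insidea[OF this, of \<zeta>] show ?thesis using R' by (simp add: norm_mult norm_power)
  qed
  define \<tau> where "\<tau> N = (\<Sum>n. norm (a (n + N) * \<zeta> ^ (n + N)))" for N
  have tail: "\<tau> \<longlonglongrightarrow> 0"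
    unfolding \<tau>_def by (rule suminf_exist_split2[OF summ])
  have bound: "norm ((\<Sum>l<N. g (cis (2 * pi * real l / real N) * \<zeta>)) / of_nat N - g 0) \<le> \<tau> N" if N: "0 < N" for N
  proof -
    define b where "b n = (if N dvd n then a n * \<zeta> ^ n else 0)" for n
    have "(\<lambda>n. \<Sum>l<N. a n * (cis (2 * pi * real l / real N) * \<zeta>) ^ n) sums (\<Sum>l<N. g (cis (2 * pi * real l / real N) * \<zeta>))"
      using \<zeta> by (intro sums_sum sums) (simp add: norm_mult)
    moreover have "(\<Sum>l<N. a n * (cis (2 * pi * real l / real N) * \<zeta>) ^ n) = b n * of_nat N" for n
    proof -
      have "(\<Sum>l<N. a n * (cis (2 * pi * real l / real N) * \<zeta>) ^ n) = a n * \<zeta> ^ n * (\<Sum>l<N. cis (2 * pi * real l / real N) ^ n)"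
        by (simp add: sum_distrib_left power_mult_distrib mult_ac)
      also have "\<dots> = b n * of_nat N"
        unfolding sum_cis_root_of_unity[OF N] by (simp add: b_def)
      finally show ?thesis .
    qed
    ultimately have "(\<lambda>n. b n * of_nat N) sums (\<Sum>l<N. g (cis (2 * pi * real l / real N) * \<zeta>))" by simp
    from sums_divide[OF this, of "of_nat N"]
    have b: "b sums ((\<Sum>l<N. g (cis (2 * pi * real l / real N) * \<zeta>)) / of_nat N)" using N by simp
    have "(\<Sum>n<N. b n) = (\<Sum>n<N. if n = 0 then a 0 else 0)"
      by (intro sum.cong) (auto simp: b_def dest: dvd_imp_le)
    also have "\<dots> = g 0"
    proof -
      have "g 0 = a 0" by (simp add: a_def)
      then show ?thesis using N by simp
    qed
    finally have bN: "(\<lambda>n. b (n + N)) sums ((\<Sum>l<N. g (cis (2 * pi * real l / real N) * \<zeta>)) / of_nat N - g 0)"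
      using sums_split_initial_segment[OF b, of N] by simp
    have "norm ((\<Sum>l<N. g (cis (2 * pi * real l / real N) * \<zeta>)) / of_nat N - g 0) = norm (\<Sum>n. b (n + N))"
      using bN by (simp add: sums_iff)
    also have "\<dots> \<le> \<tau> N"
      unfolding \<tau>_def
      using summ by (intro norm_suminf_le) (auto simp: b_def intro!: summable_ignore_initial_segment[where f="\<lambda>n. norm (a n * \<zeta> ^ n)"])
    finally show ?thesis .
  qed
  show ?thesis
    using tail by (subst LIM_zero_iff[symmetric], intro Lim_null_comparison[OF eventually_mono[OF eventually_gt_at_top[of 0] bound] tail]) auto
qed

section \<open>Convexity of the logarithmic profile\<close>

text \<open>If no point were maximal, each \<open>x\<close> would have a level \<open>c x\<close>
  strictly between \<open>u x\<close> and some larger value \<open>u (y x)\<close>. A finite cover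
  by sets on which \<open>u\<close> is below these levels has a largest level, yet one of the chosen
  values exceeds it.\<close>

lemma usc_attains_sup:
  fixes u :: "'a::topological_space \<Rightarrow> ereal"
  assumes K: "compact K" "K \<noteq> {}"
    and usc: "\<And>c x. x \<in> K \<Longrightarrow> u x < ereal c \<Longrightarrow> \<exists>U. open U \<and> x \<in> U \<and> (\<forall>y\<in>K \<inter> U. u y < ereal c)"
  shows "\<exists>x\<in>K. \<forall>y\<in>K. u y \<le> u x"
proof (rule ccontr)
  assume "\<not> ?thesis"
  then have "\<forall>x\<in>K. \<exists>y c. y \<in> K \<and> u x < ereal c \<and> ereal c < u y"
    by (metis ereal_dense2 not_le)
  then obtain y c where yc: "\<And>x. x \<in> K \<Longrightarrow> y x \<in> K \<and> u x < ereal (c x) \<and> ereal (c x) < u (y x)"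
    by metis
  then have "\<forall>x\<in>K. \<exists>U. open U \<and> x \<in> U \<and> (\<forall>y\<in>K \<inter> U. u y < ereal (c x))"
    using usc by blast
  then obtain U where U: "\<And>x. x \<in> K \<Longrightarrow> open (U x) \<and> x \<in> U x \<and> (\<forall>y\<in>K \<inter> U x. u y < ereal (c x))"
    by metis
  obtain D where D: "D \<subseteq> K" "finite D" "K \<subseteq> (\<Union>x\<in>D. U x)"
    using compactE_image[OF K(1), of K U] U by blast
  then have "D \<noteq> {}" using K(2) by auto
  define m where "m = Max (c ` D)"
  have "m \<in> c ` D" using D(2) \<open>D \<noteq> {}\<close> by (simp add: m_def)
  then obtain x where x: "x \<in> D" "c x = m" by auto
  then have "y x \<in> K" "ereal m < u (y x)" using yc[of x] D(1) by auto
  moreover from this(1) D(3) obtain x' where x': "x' \<in> D" "y x \<in> U x'" by blast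
  ultimately have "u (y x) < ereal (c x')" using U[of x'] D(1) by blast
  moreover have "c x' \<le> m" using D(2) x'(1) by (simp add: m_def)
  ultimately show False using \<open>ereal m < u (y x)\<close> by (meson ereal_less_eq(3) less_le_trans not_less_iff_gr_or_eq)
qed

section \<open>Logarithmic coordinates\<close>

definition log_domain :: "real ^ 'n \<Rightarrow> (real ^ 'n) set" where
  "log_domain r = {y. \<forall>i. y $ i < ln (r $ i)}"

lemma open_log_domain: "open (log_domain r)"
proof -
  have "log_domain r = (\<Inter>i. {y. y $ i < ln (r $ i)})"
    by (auto simp: log_domain_def)
  also have "open \<dots>"
    by (intro open_INT ballI open_Collect_less continuous_intros) auto
  finally show ?thesis .
qed

lemma convex_log_domain: "convex (log_domain r)"
proof -
  have "log_domain r = (\<Inter>i. {y. axis i 1 \<bullet> y < ln (r $ i)})"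
    by (auto simp: log_domain_def inner_axis inner_commute[of "axis _ _"])
  also have "convex \<dots>"
    by (intro convex_INT convex_halfspace_lt)
  finally show ?thesis .
qed

context
  fixes r :: "real ^ 'n" and \<phi> :: "complex ^ 'n \<Rightarrow> ereal"
  assumes r_pos: "\<And>i. 0 < r $ i"
    and psh: "psh_on (polydisk r) \<phi>"
    and toric: "toric_on (polydisk r) \<phi>"
begin

lemma exp_in_polydisk:
  "(\<chi> i. of_real (exp (y $ i))) \<in> polydisk r \<longleftrightarrow> y \<in> log_domain r"
  using r_pos by (auto simp: polydisk_def log_domain_def) (metis exp_less_cancel_iff exp_ln)+

lemma toric_eq_log_profile:
  assumes z: "z \<in> polydisk r" "\<And>i. z $ i \<noteq> 0"
  shows "\<phi> z = log_profile \<phi> (\<chi> i. ln (cmod (z $ i)))"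
proof -
  let ?x = "\<chi> i. (of_real (exp (ln (cmod (z $ i)))) :: complex)"
  have x: "?x = (\<chi> i. of_real (cmod (z $ i)))" using z(2) by (simp add: vec_eq_iff)
  have "?x \<in> polydisk r" using z unfolding x by (simp add: polydisk_def)
  then have "\<phi> (\<chi> i. cis ((\<chi> i. Arg (z $ i)) $ i) * ?x $ i) = \<phi> ?x"
    using toric unfolding toric_on_def by blast
  moreover have "(\<chi> i. cis ((\<chi> i. Arg (z $ i)) $ i) * ?x $ i) = z"
    unfolding x using z(2) by (simp add: vec_eq_iff cis_Arg sgn_eq)
  ultimately show ?thesis by (simp add: log_profile_def)
qed

lemma log_in_domain:
  assumes "z \<in> polydisk r" "\<And>i. z $ i \<noteq> 0"
  shows "(\<chi> i. ln (cmod (z $ i))) \<in> log_domain r"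
  using assms r_pos by (simp add: polydisk_def log_domain_def)

lemma log_profile_less_PInf: "y \<in> log_domain r \<Longrightarrow> log_profile \<phi> y < \<infinity>"
  using psh exp_in_polydisk[of y] unfolding psh_on_def log_profile_def by blast

lemma open_sublevel: "open {z \<in> polydisk r. \<phi> z < c}"
proof -
  have "openin (top_of_set (polydisk r)) {z \<in> polydisk r. \<phi> z < c}"
    using psh by (simp add: psh_on_def usc_on_def)
  then show ?thesis
    using openin_open_trans open_polydisk by blast
qed

lemma open_profile_sublevel: "open {y \<in> log_domain r. log_profile \<phi> y < c}"
proof -
  let ?e = "\<lambda>y :: real ^ 'n. \<chi> i. (of_real (exp (y $ i)) :: complex)"
  have "continuous_on UNIV ?e"
    by (intro continuous_intros)
  then have "open (?e -` {z \<in> polydisk r. \<phi> z < c})"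
    by (rule open_vimage[OF open_sublevel])
  also have "?e -` {z \<in> polydisk r. \<phi> z < c} = {y \<in> log_domain r. log_profile \<phi> y < c}"
    by (auto simp: exp_in_polydisk log_profile_def)
  finally show ?thesis .
qed

end

section \<open>Circle means\<close>

lemma ereal_integral_real:
  assumes "integrable M q"
  shows "ereal_integral M (\<lambda>x. ereal (q x)) = ereal (integral\<^sup>L M q)"
proof -
  have "(\<integral>\<^sup>+ x. ennreal (q x) \<partial>M) < \<infinity>" "(\<integral>\<^sup>+ x. ennreal (- q x) \<partial>M) < \<infinity>"
    using assms by (auto simp: real_integrable_def less_top)
  then obtain a b where ab: "(\<integral>\<^sup>+ x. ennreal (q x) \<partial>M) = ennreal a" "0 \<le> a"
      "(\<integral>\<^sup>+ x. ennreal (- q x) \<partial>M) = ennreal b" "0 \<le> b"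
    by (metis ennreal_cases infinity_ennreal_def less_irrefl)
  have "integral\<^sup>L M q = a - b"
    using real_lebesgue_integral_def[OF assms] ab by simp
  then show ?thesis
    using ab by (simp add: ereal_integral_def enn2ereal_ennreal)
qed

lemma ereal_integral_mono:
  assumes "\<And>x. x \<in> space M \<Longrightarrow> u x \<le> v x"
  shows "ereal_integral M u \<le> ereal_integral M v"
  unfolding ereal_integral_def
  using assms
  by (intro ereal_minus_mono)
     (auto simp: less_eq_ennreal.rep_eq[symmetric] ereal_uminus_le_reorder intro!: nn_integral_mono e2ennreal_mono)

text \<open>The extended integral is monotone, so the mean of \<open>u\<close>, which may take the
  value -\<infinity>, is bounded through a real continuous majorant.\<close>

lemma circle_mean_le:
  assumes u: "\<And>t. t \<in> {0..2 * pi} \<Longrightarrow> u (of_real \<rho> * cis t) \<le> ereal (q t)"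
    and q: "continuous_on {0..2 * pi} q" "(q has_integral I) {0..2 * pi}"
  shows "circle_mean u 0 \<rho> \<le> ereal (I / (2 * pi))"
proof -
  let ?M = "restrict_space lborel {0..2 * pi}"
  have "set_integrable lborel {0..2 * pi} q"
    using borel_integrable_atLeastAtMost'[OF q(1)] .
  then have int: "integrable ?M q" and "integral\<^sup>L ?M q = integral {0..2 * pi} q"
    using set_borel_integral_eq_integral(2)[of "{0..2 * pi}" q]
    by (auto simp: integrable_restrict_space set_integrable_def integral_restrict_space set_lebesgue_integral_def)
  then have "integral\<^sup>L ?M q = I" using q(2) by (simp add: integral_unique)
  then have "ereal_integral ?M (\<lambda>t. u (0 + of_real \<rho> * cis t)) \<le> ereal I"
    using ereal_integral_mono[of ?M "\<lambda>t. u (0 + of_real \<rho> * cis t)" "\<lambda>t. ereal (q t)"] u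
    by (simp add: ereal_integral_real[OF int] space_restrict_space)
  then have "circle_mean u 0 \<rho> \<le> ereal (1 / (2 * pi)) * ereal I"
    unfolding circle_mean_def by (intro ereal_mult_left_mono) auto
  then show ?thesis by simp
qed

text \<open>The mean value property of the harmonic function Re (Ln (1 + u v)), which is 0 at u = 0.
  The condition \<rho> |v| < 1 keeps 1 + u v in the right half-plane, off the branch cut.\<close>

lemma has_integral_ln_norm_circle:
  assumes "0 < \<rho>" "\<rho> * \<bar>v\<bar> < 1"
  shows "((\<lambda>t. ln (cmod (1 + of_real \<rho> * cis t * of_real v))) has_integral 0) {0..2 * pi}"
proof -
  define f where "f u = Ln (1 + u * of_real v)" for u
  have pos: "0 < Re (1 + u * of_real v)" if "cmod u \<le> \<rho>" for u
  proof -
    have "\<bar>Re u * v\<bar> \<le> \<rho> * \<bar>v\<bar>"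
      using abs_Re_le_cmod[of u] that by (simp add: abs_mult mult_right_mono)
    then show ?thesis using assms by auto
  qed
  have "f holomorphic_on cball 0 \<rho>"
    unfolding f_def using pos
    by (intro holomorphic_intros) (force simp: complex_nonpos_Reals_iff)
  from Cauchy_integral_circlepath_simple[OF this, of 0]
  have "((\<lambda>u. f u / (u - 0)) has_contour_integral 0) (part_circlepath 0 \<rho> 0 (2 * pi))"
    using assms by (simp add: f_def circlepath_def)
  then have "((\<lambda>t. f (\<rho> * cis t) / (\<rho> * cis t) * \<rho> * \<i> * cis t) has_integral 0) {0..2 * pi}"
    by (subst (asm) has_contour_integral_part_circlepath_iff) auto
  then have "((\<lambda>t. \<i> * f (\<rho> * cis t)) has_integral 0) {0..2 * pi}"
    using assms by (simp add: field_simps)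
  from has_integral_mult_right[OF this, of "- \<i>"]
  have "((\<lambda>t. f (\<rho> * cis t)) has_integral 0) {0..2 * pi}"
    by (simp add: mult.assoc[symmetric])
  then have "((\<lambda>t. Re (f (\<rho> * cis t))) has_integral Re 0) {0..2 * pi}"
    by (rule has_integral_Re)
  moreover have "Re (f (\<rho> * cis t)) = ln (cmod (1 + of_real \<rho> * cis t * of_real v))" for t
  proof -
    have "1 + \<rho> * cis t * of_real v \<noteq> 0"
      using pos[of "\<rho> * cis t"] assms(1) by (auto simp: norm_mult dest: arg_cong[of _ _ Re])
    then show ?thesis by (simp add: f_def)
  qed
  ultimately show ?thesis by simp
qed

lemma has_integral_cos_squared: "((\<lambda>t. (cos t)\<^sup>2) has_integral pi) {0..2 * pi}"
proof -
  have "((\<lambda>t. (cos t)\<^sup>2) has_integral ((2 * pi + sin (2 * pi) * cos (2 * pi)) / 2 - (0 + sin 0 * cos 0) / 2)) {0..2 * pi}"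
  proof (rule fundamental_theorem_of_calculus)
    fix t :: real
    have "((\<lambda>t. (t + sin t * cos t) / 2) has_field_derivative (1 + (cos t * cos t - sin t * sin t)) / 2) (at t within {0..2 * pi})"
      by (auto intro!: derivative_eq_intros)
    moreover have "(1 + (cos t * cos t - sin t * sin t)) / 2 = (cos t)\<^sup>2"
      using sin_cos_squared_add[of t] by (simp add: power2_eq_square field_simps)
    ultimately show "((\<lambda>t. (t + sin t * cos t) / 2) has_vector_derivative (cos t)\<^sup>2) (at t within {0..2 * pi})"
      by (simp add: has_real_derivative_iff_has_vector_derivative)
  qed simp
  then show ?thesis by simp
qed

lemma ln_norm_approx:
  assumes "cmod w \<le> 1 / 2"
  shows "\<bar>ln (cmod (1 + w)) - Re w\<bar> \<le> 2 * (cmod w)\<^sup>2"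
proof -
  have nz: "1 + w \<noteq> 0" using assms by (auto simp: add_eq_0_iff)
  have "\<bar>ln (cmod (1 + w)) - Re w\<bar> = \<bar>Re (Ln (1 + w) - w)\<bar>"
    using nz by simp
  also have "\<dots> \<le> cmod (Ln (1 + w) - w)" by (rule abs_Re_le_cmod)
  also have "\<dots> \<le> (cmod w)\<^sup>2 / (1 - cmod w)"
    using assms by (intro Ln_approx_linear) auto
  also have "\<dots> \<le> (cmod w)\<^sup>2 / (1 / 2)"
    using assms by (intro divide_left_mono) auto
  finally show ?thesis by simp
qed


context
  fixes r :: "real ^ 'n" and \<phi> :: "complex ^ 'n \<Rightarrow> ereal"
  assumes r_pos: "\<And>i. 0 < r $ i"
    and psh: "psh_on (polydisk r) \<phi>"
    and toric: "toric_on (polydisk r) \<phi>"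
begin

text \<open>A viscosity argument. Let \<open>z\<close> be the point with log-coordinates \<open>x\<close>. On the complex line
  \<open>t \<mapsto> (1 + t v\<^sub>i) z\<^sub>i\<close> the log-coordinates are \<open>x\<^sub>i + ln |1 + t v\<^sub>i|\<close>, whose mean over a circle is
  \<open>x\<^sub>i\<close> and which equal \<open>x + (Re t) v + O(t\<^sup>2)\<close>. A quadratic upper bound that is strictly concave along
  \<open>v\<close> then violates the mean value inequality.\<close>

lemma no_concave_contact:
  fixes v l x :: "real ^ 'n"
  assumes x: "x \<in> log_domain r" and fx: "log_profile \<phi> x = ereal c"
    and v: "norm v = 1" and N: "0 \<le> N" and \<delta>: "0 < \<delta>" and \<eta>: "0 < \<eta>"
    and upper: "\<And>h. norm h < \<eta> \<Longrightarrow> x + h \<in> log_domain r \<Longrightarrow>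
      log_profile \<phi> (x + h) \<le> ereal (c + l \<bullet> h + N * (h \<bullet> h) - (N + \<delta>) * (h \<bullet> v)\<^sup>2)"
  shows False
proof -
  define n where "n = real CARD('n)"
  have n: "1 \<le> n" unfolding n_def by (simp add: Suc_leI)
  \<comment> \<open>K \<rho>^2 bounds the deviation \<open>e\<close> of \<open>h t\<close> from (Re
    t) v, since each of the n coordinates contributes at most 2 \<rho>^2. \<open>C\<close> collects
    the higher errors: the cross term 2 \<delta> K \<rho>^3, and N K^2 \<rho>^4, which is at most N
    K^2 \<rho>^3.\<close>
  define K where "K = 2 * n"
  define C where "C = 2 * \<delta> * K + N * K\<^sup>2"
  have C: "0 \<le> C" using N \<delta> n by (simp add: C_def K_def)
  obtain \<eta>' where \<eta>': "0 < \<eta>'" "ball x \<eta>' \<subseteq> log_domain r"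
    using x open_log_domain openE by blast
  \<comment> \<open>The three bounds on \<rho> serve the logarithm estimate, the containment of
    \<open>h t\<close> in the ball of radius \<open>min \<eta> \<eta>'\<close>, and the final sign
    of \<delta> / 2 - C \<rho>.\<close>
  obtain \<rho> where "0 < \<rho>" and \<rho>_less: "\<rho> < min (1/2) (min (min \<eta> \<eta>' / (2 * n)) (\<delta> / (2 * C + 1)))"
    using n \<eta> \<eta>'(1) \<delta> C dense[of 0 "min (1/2) (min (min \<eta> \<eta>' / (2 * n)) (\<delta> / (2 * C + 1)))"] by auto
  then have \<rho>: "0 < \<rho>" "\<rho> < 1/2" "\<rho> < min \<eta> \<eta>' / (2 * n)" "\<rho> < \<delta> / (2 * C + 1)"
    by (simp_all only: min_less_iff_conj)
  have v_le: "\<bar>v $ i\<bar> \<le> 1" for i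
    using component_le_norm_cart[of v i] v by simp
  define z where "z = (\<chi> i. (of_real (exp (x $ i)) :: complex))"
  define b where "b = (\<chi> i. (of_real (v $ i * exp (x $ i)) :: complex))"
  define h where "h t = (\<chi> i. ln (cmod (1 + t * of_real (v $ i))))" for t :: complex
  have tv: "cmod (t * of_real (v $ i)) \<le> 1/2" if "cmod t \<le> \<rho>" for t i
  proof -
    have "cmod t * \<bar>v $ i\<bar> \<le> \<rho> * 1" using that v_le[of i] \<rho>(1) by (intro mult_mono) auto
    then show ?thesis using \<rho>(2) by (simp add: norm_mult)
  qed
  have nz: "1 + t * of_real (v $ i) \<noteq> 0" if "cmod t \<le> \<rho>" for t i
    using tv[OF that, of i] by (auto simp: add_eq_0_iff)
  have line: "(z + t *s b) $ i = of_real (exp (x $ i)) * (1 + t * of_real (v $ i))" for t i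
    by (simp add: z_def b_def algebra_simps)
  have err: "\<bar>h t $ i - Re t * v $ i\<bar> \<le> 2 * (cmod t)\<^sup>2" if "cmod t \<le> \<rho>" for t i
  proof -
    have "\<bar>h t $ i - Re t * v $ i\<bar> \<le> 2 * (cmod (t * of_real (v $ i)))\<^sup>2"
      using ln_norm_approx[OF tv[OF that, of i]] by (simp add: h_def)
    also have "\<dots> \<le> 2 * (cmod t)\<^sup>2"
      using v_le[of i] by (auto simp: norm_mult power_mult_distrib abs_square_le_1 intro!: mult_left_le)
    finally show ?thesis .
  qed
  have h_norm: "norm (h t) < min \<eta> \<eta>'" if "cmod t \<le> \<rho>" for t
  proof -
    have "\<bar>h t $ i\<bar> \<le> 2 * \<rho>" for i
    proof -
      have "\<bar>Re t * v $ i\<bar> \<le> \<rho> * 1"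
        unfolding abs_mult using that abs_Re_le_cmod[of t] v_le[of i] \<rho>(1) by (intro mult_mono) auto
      moreover have "2 * (cmod t)\<^sup>2 \<le> \<rho>"
      proof -
        have "(cmod t)\<^sup>2 \<le> \<rho> * \<rho>" using that \<rho>(1) by (simp add: power2_eq_square mult_mono)
        also have "\<dots> \<le> \<rho> * (1/2)" using \<rho>(1,2) by (intro mult_left_mono) auto
        finally show ?thesis by simp
      qed
      ultimately show ?thesis using err[OF that, of i] by linarith
    qed
    then have "(\<Sum>i\<in>UNIV. \<bar>h t $ i\<bar>) \<le> n * (2 * \<rho>)"
      using sum_bounded_above[of UNIV "\<lambda>i. \<bar>h t $ i\<bar>" "2 * \<rho>"] by (simp add: n_def)
    moreover have "n * (2 * \<rho>) < min \<eta> \<eta>'" using \<rho>(3) n by (simp add: field_simps del: min_less_iff_conj)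
    ultimately show ?thesis using norm_le_l1_cart[of "h t"] by linarith
  qed
  have dom: "x + h t \<in> log_domain r" if "cmod t \<le> \<rho>" for t
    using h_norm[OF that] \<eta>'(2) by (auto simp: dist_norm subset_iff)
  have in_X: "z + t *s b \<in> polydisk r" and \<phi>_line: "\<phi> (z + t *s b) = log_profile \<phi> (x + h t)"
    if "cmod t \<le> \<rho>" for t
  proof -
    have eq: "cmod ((z + t *s b) $ i) = exp ((x + h t) $ i)" for i
      unfolding line using nz[OF that, of i] by (simp add: norm_mult exp_add h_def)
    have "exp ((x + h t) $ i) < r $ i" for i
      using dom[OF that] r_pos[of i] by (auto simp: log_domain_def) (metis exp_less_cancel_iff exp_ln)
    then show *: "z + t *s b \<in> polydisk r"
      by (simp add: polydisk_def eq del: vector_add_component)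
    have "\<And>i. (z + t *s b) $ i \<noteq> 0" unfolding line using nz[OF that] by simp
    from toric_eq_log_profile[OF r_pos psh toric * this]
    show "\<phi> (z + t *s b) = log_profile \<phi> (x + h t)"
      by (simp add: eq del: vector_add_component)
  qed
  \<comment> \<open>The majorant on the circle. As \<open>v\<close> is a unit vector, the terms in N
    cancel to second order and leave -\<delta> (Re t)^2, of mean -\<delta> \<rho>^2 / 2. The linear
    term keeps the exact logarithms, whose mean is 0: replacing them by (Re t) v would cost an error
    of the same order \<rho>^2.\<close>
  define q where "q \<theta> = c + (\<Sum>i\<in>UNIV. l $ i * h (of_real \<rho> * cis \<theta>) $ i) - \<delta> * \<rho>\<^sup>2 * (cos \<theta>)\<^sup>2 + C * \<rho> ^ 3" for \<theta>
  have bound: "\<phi> (z + (of_real \<rho> * cis \<theta>) *s b) \<le> ereal (q \<theta>)" for \<theta>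
  proof -
    define t where "t = of_real \<rho> * cis \<theta>"
    have t: "cmod t = \<rho>" "Re t = \<rho> * cos \<theta>" using \<rho>(1) by (auto simp: t_def norm_mult)
    define e where "e = h t - Re t *\<^sub>R v"
    have e: "norm e \<le> K * \<rho>\<^sup>2"
    proof -
      have "(\<Sum>i\<in>UNIV. \<bar>e $ i\<bar>) \<le> n * (2 * \<rho>\<^sup>2)"
        using sum_bounded_above[of UNIV "\<lambda>i. \<bar>e $ i\<bar>" "2 * \<rho>\<^sup>2"] err[of t] t by (simp add: n_def e_def)
      then show ?thesis using norm_le_l1_cart[of e] by (simp add: K_def)
    qed
    define s where "s = Re t"
    define p where "p = e \<bullet> v"
    have s: "\<bar>s\<bar> \<le> \<rho>" using abs_Re_le_cmod[of t] t by (simp add: s_def)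
    have p: "\<bar>p\<bar> \<le> K * \<rho>\<^sup>2" using Cauchy_Schwarz_ineq2[of e v] e v by (simp add: p_def)
    have ht: "h t = s *\<^sub>R v + e" by (simp add: e_def s_def)
    have vv: "v \<bullet> v = 1" using v by (simp add: dot_square_norm)
    have hv: "h t \<bullet> v = s + p" by (simp add: ht inner_add_left p_def vv)
    have hh: "h t \<bullet> h t = s\<^sup>2 + 2 * s * p + e \<bullet> e"
      by (simp add: ht inner_add_left inner_add_right vv p_def inner_commute power2_eq_square)
    have "N * (h t \<bullet> h t) - (N + \<delta>) * (h t \<bullet> v)\<^sup>2 = - \<delta> * s\<^sup>2 - 2 * \<delta> * (s * p) + N * (e \<bullet> e) - (N + \<delta>) * p\<^sup>2"
      unfolding hh hv by (simp add: power2_eq_square algebra_simps)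
    also have "\<dots> \<le> - \<delta> * s\<^sup>2 + 2 * \<delta> * (\<rho> * (K * \<rho>\<^sup>2)) + N * (K * \<rho>\<^sup>2)\<^sup>2"
    proof -
      have "\<bar>s * p\<bar> \<le> \<rho> * (K * \<rho>\<^sup>2)" unfolding abs_mult using s p \<rho>(1) by (intro mult_mono) auto
      then have "- (s * p) \<le> \<rho> * (K * \<rho>\<^sup>2)" by linarith
      then have "2 * \<delta> * (- (s * p)) \<le> 2 * \<delta> * (\<rho> * (K * \<rho>\<^sup>2))" using \<delta> by (intro mult_left_mono) auto
      moreover have "e \<bullet> e \<le> (K * \<rho>\<^sup>2)\<^sup>2" using e by (simp add: dot_square_norm power_mono)
      then have "N * (e \<bullet> e) \<le> N * (K * \<rho>\<^sup>2)\<^sup>2" using N by (intro mult_left_mono) auto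
      moreover have "0 \<le> (N + \<delta>) * p\<^sup>2" using N \<delta> by simp
      ultimately show ?thesis by linarith
    qed
    also have "\<dots> \<le> - \<delta> * s\<^sup>2 + C * \<rho> ^ 3"
    proof -
      have "\<rho> ^ 4 \<le> \<rho> ^ 3" using \<rho>(1,2) by (intro power_decreasing) auto
      then have "N * K\<^sup>2 * \<rho> ^ 4 \<le> N * K\<^sup>2 * \<rho> ^ 3" using N by (intro mult_left_mono) auto
      then show ?thesis by (simp add: C_def algebra_simps power2_eq_square power3_eq_cube power4_eq_xxxx)
    qed
    finally have "N * (h t \<bullet> h t) - (N + \<delta>) * (h t \<bullet> v)\<^sup>2 \<le> - \<delta> * s\<^sup>2 + C * \<rho> ^ 3" .
    then have "c + l \<bullet> h t + N * (h t \<bullet> h t) - (N + \<delta>) * (h t \<bullet> v)\<^sup>2 \<le> q \<theta>"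
      by (simp add: q_def inner_vec_def t_def[symmetric] s_def t(2) power_mult_distrib mult.assoc)
    then have "log_profile \<phi> (x + h t) \<le> ereal (q \<theta>)"
      using upper[of "h t"] h_norm[of t] dom[of t] t(1) by (meson ereal_less_eq(3) min_less_iff_conj order_refl order_trans)
    then show ?thesis using \<phi>_line[of t] t(1) by (simp add: t_def)
  qed
  have const: "((\<lambda>\<theta>. a) has_integral a * (2 * pi)) {0..2 * pi}" for a :: real
    using has_integral_const_real[of a 0 "2 * pi"] by (simp add: mult.commute)
  have "(q has_integral (c * (2 * pi) + (\<Sum>i\<in>UNIV. l $ i * 0) - \<delta> * \<rho>\<^sup>2 * pi + C * \<rho> ^ 3 * (2 * pi))) {0..2 * pi}"
    unfolding q_def h_def vec_lambda_beta
  proof (intro has_integral_add has_integral_diff has_integral_sum has_integral_mult_right has_integral_cos_squared finite)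
    show "((\<lambda>\<theta>. ln (cmod (1 + of_real \<rho> * cis \<theta> * of_real (v $ i)))) has_integral 0) {0..2 * pi}" for i
    proof (rule has_integral_ln_norm_circle[OF \<rho>(1)])
      have "\<rho> * \<bar>v $ i\<bar> \<le> \<rho> * 1" using v_le[of i] \<rho>(1) by (intro mult_left_mono) auto
      then show "\<rho> * \<bar>v $ i\<bar> < 1" using \<rho>(2) by simp
    qed
  qed (rule const)+
  moreover have "continuous_on {0..2 * pi} q"
    unfolding q_def h_def vec_lambda_beta cis_conv_exp using nz \<rho>(1)
    by (intro continuous_intros) (auto simp: norm_mult)
  ultimately have mean: "circle_mean (\<lambda>t. \<phi> (z + t *s b)) 0 \<rho> \<le>
      ereal ((c * (2 * pi) + (\<Sum>i\<in>UNIV. l $ i * 0) - \<delta> * \<rho>\<^sup>2 * pi + C * \<rho> ^ 3 * (2 * pi)) / (2 * pi))"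
    by (intro circle_mean_le[where q = q] bound)
  also have "(c * (2 * pi) + (\<Sum>i\<in>UNIV. l $ i * 0) - \<delta> * \<rho>\<^sup>2 * pi + C * \<rho> ^ 3 * (2 * pi)) / (2 * pi)
      = c - \<rho>\<^sup>2 * (\<delta> / 2 - C * \<rho>)"
    by (simp add: field_simps power2_eq_square power3_eq_cube)
  also have "ereal \<dots> < ereal c"
  proof -
    have "(2 * C + 1) * \<rho> < \<delta>" using \<rho>(4) C by (simp add: field_simps)
    then have "0 < \<delta> / 2 - C * \<rho>" using \<rho>(1) by (simp add: algebra_simps)
    then show ?thesis using \<rho>(1) by simp
  qed
  finally have "circle_mean (\<lambda>t. \<phi> (z + t *s b)) 0 \<rho> < ereal c" .
  moreover have "\<phi> (z + 0 *s b) \<le> circle_mean (\<lambda>t. \<phi> (z + t *s b)) 0 \<rho>"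
  proof -
    have "subharmonic_on {t. z + t *s b \<in> polydisk r} (\<lambda>t. \<phi> (z + t *s b))"
      using psh by (simp add: psh_on_def)
    moreover have "cball 0 \<rho> \<subseteq> {t. z + t *s b \<in> polydisk r}"
      using in_X by auto
    ultimately show ?thesis using \<rho>(1) unfolding subharmonic_on_def by blast
  qed
  moreover have "\<phi> (z + 0 *s b) = ereal c"
    using fx by (simp add: z_def log_profile_def)
  ultimately show False by simp
qed


text \<open>Strict upper bounds in place of values admit -\<infinity> at the endpoints and persist
  on neighbourhoods. If the inequality failed at \<open>m\<close>, then f - Q would have a positive
  maximum on a cylinder around the segment, where \<open>Q\<close> is the affine interpolation plus
  N |w|^2 - \<delta> s^2. The maximum cannot lie on the boundary of the cylinder, so a translate of
  \<open>Q\<close> touches f from above at an interior point, against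
  \<open>no_concave_contact\<close>.\<close>

lemma log_profile_convex_strict:
  assumes x: "x \<in> log_domain r" and y: "y \<in> log_domain r"
    and fx: "log_profile \<phi> x < ereal A" and fy: "log_profile \<phi> y < ereal B"
    and t: "0 < t" "t < 1"
  shows "log_profile \<phi> ((1 - t) *\<^sub>R x + t *\<^sub>R y) \<le> ereal ((1 - t) * A + t * B)"
proof (cases "x = y")
  case True
  have "min A B \<le> (1 - t) * A + t * B"
  proof -
    have "(1 - t) * min A B + t * min A B \<le> (1 - t) * A + t * B"
      using t by (intro add_mono mult_left_mono) auto
    then show ?thesis by (simp add: algebra_simps)
  qed
  moreover have "log_profile \<phi> x \<le> ereal (min A B)"
    using fx fy True by (simp add: min_def less_imp_le)
  moreover have "(1 - t) *\<^sub>R x + t *\<^sub>R y = x" using True by (simp add: algebra_simps)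
  ultimately show ?thesis by (metis ereal_less_eq(3) order_trans)
next
  case False
  define f where "f = log_profile \<phi>"
  define L where "L = norm (y - x)"
  have L: "0 < L" using False by (simp add: L_def)
  define v where "v = (y - x) /\<^sub>R L"
  have v: "norm v = 1" using L by (simp add: v_def L_def)
  have vv: "v \<bullet> v = 1" using v by (simp add: dot_square_norm)
  have yLv: "y = x + L *\<^sub>R v" using L by (simp add: v_def)
  \<comment> \<open>\<open>s z\<close> is the position along the axis, measured from
    \<open>x\<close>, and \<open>w z\<close> the orthogonal offset from it.\<close>
  define s where "s z = (z - x) \<bullet> v" for z
  define w where "w z = z - x - s z *\<^sub>R v" for z
  have w_norm: "(norm (w z))\<^sup>2 = (z - x) \<bullet> (z - x) - (s z)\<^sup>2" for z
  proof -
    have "(u - (u \<bullet> v) *\<^sub>R v) \<bullet> (u - (u \<bullet> v) *\<^sub>R v) = u \<bullet> u - (u \<bullet> v)\<^sup>2" for u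
      by (simp add: inner_diff_left inner_diff_right vv inner_commute power2_eq_square)
    then show ?thesis unfolding w_def s_def power2_norm_eq_inner .
  qed
  define m where "m = (1 - t) *\<^sub>R x + t *\<^sub>R y"
  have m_eq: "m = x + (t * L) *\<^sub>R v" unfolding m_def yLv by (simp add: algebra_simps)
  have sm: "s m = t * L" by (simp add: s_def m_eq vv)
  have wm: "w m = 0" unfolding w_def sm by (simp add: m_eq)
  show ?thesis
  proof (rule ccontr)
    assume "\<not> ?thesis"
    then have fm: "ereal ((1 - t) * A + t * B) < f m" by (simp add: f_def m_def not_le)
    \<comment> \<open>The slack B - B' pays for the concave term: \<delta> L^2 = B - B', so
      \<open>Q\<close> is still at least \<open>B'\<close> at the far end.\<close>
    obtain B' where B': "f y < ereal B'" "B' < B"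
      using fy ereal_dense2[OF fy] by (auto simp: f_def)
    define \<delta> where "\<delta> = (B - B') / L\<^sup>2"
    have \<delta>: "0 < \<delta>" using B'(2) L by (simp add: \<delta>_def)
    have seg: "x + u *\<^sub>R v \<in> log_domain r" if "0 \<le> u" "u \<le> L" for u
    proof -
      have "(1 - u / L) *\<^sub>R x + (u / L) *\<^sub>R y \<in> log_domain r"
        using that L by (intro convexD[OF convex_log_domain x y]) auto
      also have "(1 - u / L) *\<^sub>R x + (u / L) *\<^sub>R y = x + u *\<^sub>R v"
        unfolding yLv using L by (simp add: algebra_simps)
      finally show ?thesis .
    qed
    have "compact ((\<lambda>u. x + u *\<^sub>R v) ` {0..L})"
      by (intro compact_continuous_image continuous_intros) auto
    moreover have "(\<lambda>u. x + u *\<^sub>R v) ` {0..L} \<subseteq> log_domain r"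
      using seg by auto
    ultimately obtain \<eta>0 where \<eta>0: "0 < \<eta>0" "(\<Union>a\<in>(\<lambda>u. x + u *\<^sub>R v) ` {0..L}. cball a \<eta>0) \<subseteq> log_domain r"
      by (rule compact_subset_open_imp_cball_epsilon_subset[OF _ open_log_domain])
    obtain \<eta>1 where \<eta>1: "0 < \<eta>1" "cball x \<eta>1 \<subseteq> {z \<in> log_domain r. f z < ereal A}"
      using open_profile_sublevel[OF r_pos psh toric, of "ereal A"] x fx
      by (auto simp: f_def open_contains_cball)
    obtain \<eta>2 where \<eta>2: "0 < \<eta>2" "cball y \<eta>2 \<subseteq> {z \<in> log_domain r. f z < ereal B'}"
      using open_profile_sublevel[OF r_pos psh toric, of "ereal B'"] y B'(1)
      by (auto simp: f_def open_contains_cball)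
    define \<eta> where "\<eta> = min \<eta>0 (min \<eta>1 \<eta>2)"
    have \<eta>: "0 < \<eta>" "\<eta> \<le> \<eta>0" "\<eta> \<le> \<eta>1" "\<eta> \<le> \<eta>2" using \<eta>0(1) \<eta>1(1) \<eta>2(1) by (auto simp: \<eta>_def)
    define Cyl where "Cyl = {z. 0 \<le> s z \<and> s z \<le> L \<and> norm (w z) \<le> \<eta>}"
    have z_eq: "z = (x + s z *\<^sub>R v) + w z" for z by (simp add: w_def)
    have Cyl_sub: "Cyl \<subseteq> log_domain r"
    proof
      fix z assume z: "z \<in> Cyl"
      then have "z \<in> cball (x + s z *\<^sub>R v) \<eta>0"
        using \<eta>(2) by (simp add: Cyl_def dist_norm norm_minus_commute w_def algebra_simps)
      moreover have "s z \<in> {0..L}" using z by (simp add: Cyl_def)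
      ultimately have "z \<in> (\<Union>a\<in>(\<lambda>u. x + u *\<^sub>R v) ` {0..L}. cball a \<eta>0)" by blast
      then show "z \<in> log_domain r" using \<eta>0(2) by blast
    qed
    have s_cont: "continuous_on S s" for S unfolding s_def by (intro continuous_intros)
    have w_cont: "continuous_on S w" for S unfolding w_def by (intro continuous_intros s_cont)
    have "closed Cyl"
      unfolding Cyl_def by (intro closed_Collect_conj closed_Collect_le continuous_intros s_cont w_cont)
    moreover have "bounded Cyl"
    proof (rule boundedI)
      fix z assume z: "z \<in> Cyl"
      have "norm z \<le> norm x + norm (s z *\<^sub>R v) + norm (w z)"
        using z_eq[of z] norm_triangle_ineq[of "x + s z *\<^sub>R v" "w z"] norm_triangle_ineq[of x "s z *\<^sub>R v"] by simp
      then show "norm z \<le> norm x + L + \<eta>" using z v by (simp add: Cyl_def)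
    qed
    ultimately have "compact Cyl" by (simp add: compact_eq_bounded_closed)
    have "m \<in> Cyl" using sm wm t L \<eta>(1) by (simp add: Cyl_def)
    have usc: "\<exists>U. open U \<and> a \<in> U \<and> (\<forall>z\<in>Cyl \<inter> U. f z < ereal d)" if "a \<in> Cyl" "f a < ereal d" for a d
      using open_profile_sublevel[OF r_pos psh toric, of "ereal d"] that Cyl_sub
      by (intro exI[of _ "{z \<in> log_domain r. f z < ereal d}"]) (auto simp: f_def)
    then obtain a where a: "a \<in> Cyl" "\<forall>z\<in>Cyl. f z \<le> f a"
      using usc_attains_sup[OF \<open>compact Cyl\<close>, of f] \<open>m \<in> Cyl\<close> by auto
    have "f a < \<infinity>" using log_profile_less_PInf[OF r_pos psh toric, of a] a(1) Cyl_sub by (auto simp: f_def)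
    then obtain M0 where M0: "f a \<le> ereal M0" by (cases "f a") auto
    define M where "M = \<bar>M0\<bar>"
    have M: "f z \<le> ereal M" if "z \<in> Cyl" for z
    proof -
      have "f z \<le> ereal M0" using a(2) that M0 order_trans by blast
      also have "\<dots> \<le> ereal M" by (simp add: M_def)
      finally show ?thesis .
    qed
    \<comment> \<open>Large enough that \<open>Q\<close> is at least \<open>M\<close>, hence at
      least f, on the lateral boundary \<open>norm (w z) = \<eta>\<close>, whatever the affine term
      and \<delta> s^2 contribute there.\<close>
    define N where "N = (M + \<bar>A\<bar> + \<bar>B - A\<bar> + \<delta> * L\<^sup>2) / \<eta>\<^sup>2"
    have N: "0 \<le> N" using \<delta> by (simp add: N_def M_def)
    define Q where "Q z = A + (B - A) / L * s z + N * (norm (w z))\<^sup>2 - \<delta> * (s z)\<^sup>2" for z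
    have Q_cont: "continuous_on S Q" for S
      unfolding Q_def by (intro continuous_intros s_cont w_cont)
    have "\<exists>p\<in>Cyl. \<forall>z\<in>Cyl. f z - ereal (Q z) \<le> f p - ereal (Q p)"
    proof (rule usc_attains_sup[OF \<open>compact Cyl\<close>])
      show "Cyl \<noteq> {}" using \<open>m \<in> Cyl\<close> by blast
      fix d p assume p: "p \<in> Cyl" "f p - ereal (Q p) < ereal d"
      then have "f p < ereal (d + Q p)" by (cases "f p") auto
      then obtain e where e: "f p < ereal e" "e < d + Q p" using ereal_dense2 by (metis less_ereal.simps(1))
      obtain U where U: "open U" "p \<in> U" "\<forall>z\<in>Cyl \<inter> U. f z < ereal e" using usc[OF p(1) e(1)] by blast
      have "open {z. e < d + Q z}" by (intro open_Collect_less continuous_intros Q_cont)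
      moreover have "f z - ereal (Q z) < ereal d" if "z \<in> Cyl \<inter> (U \<inter> {z. e < d + Q z})" for z
      proof -
        have "f z < ereal e" "e < d + Q z" using that U(3) by auto
        then show ?thesis by (cases "f z") auto
      qed
      ultimately show "\<exists>U. open U \<and> p \<in> U \<and> (\<forall>z\<in>Cyl \<inter> U. f z - ereal (Q z) < ereal d)"
        using U(1,2) e(2) by (intro exI[of _ "U \<inter> {z. e < d + Q z}"]) auto
    qed
    then obtain p where p: "p \<in> Cyl" "\<And>z. z \<in> Cyl \<Longrightarrow> f z - ereal (Q z) \<le> f p - ereal (Q p)" by blast
    have "Q m < (1 - t) * A + t * B"
    proof -
      have "Q m = (1 - t) * A + t * B - \<delta> * (t * L)\<^sup>2"
        unfolding Q_def sm wm using L by (simp add: field_simps)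
      then show ?thesis using \<delta> t L by simp
    qed
    then have "ereal (Q m) < f m" using fm by (meson ereal_less_eq(3) le_less_trans less_imp_le)
    then have "0 < f m - ereal (Q m)" by (cases "f m") auto
    also have "\<dots> \<le> f p - ereal (Q p)" using p(2) \<open>m \<in> Cyl\<close> by blast
    finally have above: "ereal (Q p) < f p" by (cases "f p") auto
    have not_s0: "s p \<noteq> 0"
    proof
      assume s0: "s p = 0"
      then have "p \<in> cball x \<eta>1" using p(1) \<eta>(3) by (simp add: Cyl_def w_def dist_norm norm_minus_commute)
      then have "f p < ereal A" using \<eta>1(2) by blast
      moreover have "A \<le> Q p" using N s0 by (simp add: Q_def)
      ultimately show False using above by (meson ereal_less_eq(3) le_less_trans less_asym less_le_trans)
    qed
    have not_sL: "s p \<noteq> L"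
    proof
      assume sL: "s p = L"
      then have "p \<in> cball y \<eta>2" using p(1) \<eta>(4) yLv by (simp add: Cyl_def w_def dist_norm norm_minus_commute algebra_simps)
      then have "f p < ereal B'" using \<eta>2(2) by blast
      moreover have "B' \<le> Q p" using N sL L by (simp add: Q_def \<delta>_def)
      ultimately show False using above by (meson ereal_less_eq(3) le_less_trans less_asym less_le_trans)
    qed
    have not_w: "norm (w p) \<noteq> \<eta>"
    proof
      assume w\<eta>: "norm (w p) = \<eta>"
      have sp: "0 \<le> s p" "s p \<le> L" using p(1) by (auto simp: Cyl_def)
      have "\<bar>(B - A) / L * s p\<bar> \<le> \<bar>B - A\<bar>"
      proof -
        have "\<bar>(B - A) / L * s p\<bar> = \<bar>B - A\<bar> * (s p / L)" using sp L by (simp add: abs_mult)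
        also have "\<dots> \<le> \<bar>B - A\<bar> * 1" using sp L by (intro mult_left_mono) auto
        finally show ?thesis by simp
      qed
      moreover have "\<delta> * (s p)\<^sup>2 \<le> \<delta> * L\<^sup>2" using sp \<delta> by (intro mult_left_mono power_mono) auto
      moreover have "N * (norm (w p))\<^sup>2 = M + \<bar>A\<bar> + \<bar>B - A\<bar> + \<delta> * L\<^sup>2"
        using \<eta>(1) by (simp add: w\<eta> N_def)
      ultimately have "M \<le> Q p" unfolding Q_def by linarith
      then show False using above M[OF p(1)] by (meson ereal_less_eq(3) leD order_trans)
    qed
    obtain c where c: "f p = ereal c"
      using above M[OF p(1)] by (cases "f p") auto
    have "open {z. 0 < s z \<and> s z < L \<and> norm (w z) < \<eta>}"
      by (intro open_Collect_conj open_Collect_less continuous_intros s_cont w_cont)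
    moreover have "p \<in> {z. 0 < s z \<and> s z < L \<and> norm (w z) < \<eta>}"
      using p(1) not_s0 not_sL not_w by (auto simp: Cyl_def)
    ultimately obtain \<eta>' where \<eta>': "0 < \<eta>'" "ball p \<eta>' \<subseteq> {z. 0 < s z \<and> s z < L \<and> norm (w z) < \<eta>}"
      by (meson openE)
    \<comment> \<open>The gradient of \<open>Q\<close> at \<open>p\<close>: as |w|^2 = |z - x|^2 -
      s^2, the function \<open>Q\<close> is affine in \<open>s\<close> plus N |z - x|^2 - (N +
      \<delta>) s^2. This also gives its exact second-order part.\<close>
    define l where "l = ((B - A) / L - 2 * (N + \<delta>) * s p) *\<^sub>R v + (2 * N) *\<^sub>R (p - x)"
    show False
    proof (rule no_concave_contact[of p c v N \<delta> \<eta>' l])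
      fix h :: "real ^ 'n" assume h: "norm h < \<eta>'"
      then have "p + h \<in> ball p \<eta>'" by (simp add: dist_norm)
      then have "p + h \<in> Cyl" using \<eta>'(2) by (force simp: Cyl_def)
      then have "f (p + h) - ereal (Q (p + h)) \<le> f p - ereal (Q p)" by (rule p(2))
      then have "f (p + h) \<le> ereal (c + (Q (p + h) - Q p))"
        unfolding c by (cases "f (p + h)") auto
      moreover have "Q (p + h) - Q p = l \<bullet> h + N * (h \<bullet> h) - (N + \<delta>) * (h \<bullet> v)\<^sup>2"
      proof -
        have sh: "s (p + h) = s p + h \<bullet> v" by (simp add: s_def inner_add_left inner_diff_left)
        have ph: "(p + h - x) \<bullet> (p + h - x) = (p - x) \<bullet> (p - x) + 2 * ((p - x) \<bullet> h) + h \<bullet> h"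
          by (simp add: inner_add_left inner_add_right inner_diff_left inner_diff_right inner_commute)
        show ?thesis
          unfolding Q_def w_norm sh ph l_def
          by (simp add: inner_add_left inner_commute[of v h] power2_eq_square algebra_simps)
      qed
      ultimately show "log_profile \<phi> (p + h) \<le> ereal (c + l \<bullet> h + N * (h \<bullet> h) - (N + \<delta>) * (h \<bullet> v)\<^sup>2)"
        by (simp add: f_def add_diff_eq add.assoc)
    qed (use p(1) Cyl_sub c v N \<delta> \<eta>' in \<open>auto simp: f_def\<close>)
  qed
qed

text \<open>Prolong the segment from \<open>y0\<close> to \<open>y\<close> slightly, up to
  \<open>y1\<close>. Then \<open>y\<close> is a proper convex combination of \<open>y1\<close> and
  \<open>y0\<close>, and the bound at \<open>y0\<close> can be taken arbitrarily negative. Hence f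
  is finite on the whole domain or nowhere.\<close>

lemma log_profile_eq_MInf:
  assumes y0: "y0 \<in> log_domain r" "log_profile \<phi> y0 = - \<infinity>" and y: "y \<in> log_domain r"
  shows "log_profile \<phi> y = - \<infinity>"
proof -
  obtain e where e: "0 < e" "cball y e \<subseteq> log_domain r"
    using y open_log_domain open_contains_cball by blast
  define d where "d = e / (norm (y - y0) + 1)"
  have d: "0 < d" using e(1) by (simp add: d_def add_nonneg_pos)
  define y1 where "y1 = y + d *\<^sub>R (y - y0)"
  have "d * norm (y - y0) \<le> e"
    using e(1) add_nonneg_pos[of "norm (y - y0)" 1] by (simp add: d_def divide_le_eq algebra_simps)
  then have y1: "y1 \<in> log_domain r"
    using e(2) d by (auto simp: y1_def dist_norm subset_iff)
  obtain A where A: "log_profile \<phi> y1 < ereal A"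
    using log_profile_less_PInf[OF r_pos psh toric y1] by (metis ereal_dense2)
  define t where "t = d / (1 + d)"
  have t: "0 < t" "t < 1" using d by (auto simp: t_def)
  have eq: "(1 - t) *\<^sub>R y1 + t *\<^sub>R y0 = y"
  proof -
    have "1 - t = 1 / (1 + d)" using d by (simp add: t_def field_simps)
    then have "(1 + d) *\<^sub>R ((1 - t) *\<^sub>R y1 + t *\<^sub>R y0) = y1 + d *\<^sub>R y0"
      using d by (simp add: t_def scaleR_add_right)
    also have "\<dots> = (1 + d) *\<^sub>R y" by (simp add: y1_def algebra_simps)
    finally show ?thesis using d by simp
  qed
  have "log_profile \<phi> y \<le> ereal b" for b
    using log_profile_convex_strict[OF y1 y0(1) A _ t, of "(b - (1 - t) * A) / t"] y0(2) t eq by simp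
  then show ?thesis by (simp add: ereal_bot)
qed

lemma log_profile_convex_on:
  assumes fin: "\<And>y. y \<in> log_domain r \<Longrightarrow> log_profile \<phi> y \<noteq> - \<infinity>"
  shows "convex_on (log_domain r) (\<lambda>y. real_of_ereal (log_profile \<phi> y))"
proof (rule convex_onI[OF _ convex_log_domain])
  fix t :: real and x y assume t: "0 < t" "t < 1" and xy: "x \<in> log_domain r" "y \<in> log_domain r"
  define f where "f y = real_of_ereal (log_profile \<phi> y)" for y
  have f: "log_profile \<phi> z = ereal (f z)" if "z \<in> log_domain r" for z
    using fin[OF that] log_profile_less_PInf[OF r_pos psh toric that]
    unfolding f_def by (cases "log_profile \<phi> z") auto
  let ?m = "(1 - t) *\<^sub>R x + t *\<^sub>R y"
  have m: "?m \<in> log_domain r" using t xy by (intro convexD[OF convex_log_domain]) auto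
  \<comment> \<open>\<open>f x + e\<close> and \<open>f y + e\<close> are the strict bounds that
    \<open>log_profile_convex_strict\<close> asks for.\<close>
  have "f ?m \<le> (1 - t) * f x + t * f y + e" if "0 < e" for e
  proof -
    have "log_profile \<phi> ?m \<le> ereal ((1 - t) * (f x + e) + t * (f y + e))"
      using that by (intro log_profile_convex_strict xy t) (simp_all add: f xy)
    then show ?thesis using f[OF m] by (simp add: algebra_simps)
  qed
  then show "f ?m \<le> (1 - t) * f x + t * f y" by (rule field_le_epsilon)
qed

end

section \<open>Integration over polydisks\<close>

lemma nn_integral_lborel_translate:
  fixes f :: "'a::euclidean_space \<Rightarrow> ennreal"
  assumes [measurable]: "f \<in> borel_measurable borel"
  shows "(\<integral>\<^sup>+ x. f (a + x) \<partial>lborel) = (\<integral>\<^sup>+ x. f x \<partial>lborel)"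
proof -
  have "(\<integral>\<^sup>+ x. f x \<partial>lborel) = (\<integral>\<^sup>+ x. f x \<partial>distr lborel borel ((+) a))"
    by (simp add: lborel_distr_plus)
  also have "\<dots> = (\<integral>\<^sup>+ x. f (a + x) \<partial>lborel)"
    by (subst nn_integral_distr) auto
  finally show ?thesis ..
qed

lemma lborel_pair_nn_integral_swap:
  fixes f :: "'a::euclidean_space \<Rightarrow> 'a \<Rightarrow> ennreal"
  assumes "(\<lambda>(x, y). f x y) \<in> borel_measurable (borel \<Otimes>\<^sub>M borel)"
  shows "(\<integral>\<^sup>+ x. \<integral>\<^sup>+ y. f x y \<partial>lborel \<partial>lborel) = (\<integral>\<^sup>+ y. \<integral>\<^sup>+ x. f x y \<partial>lborel \<partial>lborel)"
proof -
  have "(\<lambda>(x, y). f x y) \<in> borel_measurable (lborel \<Otimes>\<^sub>M lborel)"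
    using assms by (simp add: measurable_cong_sets[OF sets_pair_measure_cong[OF sets_lborel sets_lborel] refl])
  from lborel_pair.Fubini'[OF this] show ?thesis by simp
qed

text \<open>Uniqueness of translation invariant measures: by Fubini, \<open>|T\<inverse> E| |B| = |T\<inverse> B| |-E|\<close>
  for all \<open>E\<close> and \<open>B\<close>; then take for \<open>B\<close> the unit ball.\<close>

lemma nn_integral_orthogonal_transformation:
  fixes T :: "'a::euclidean_space \<Rightarrow> 'a"
  assumes T: "orthogonal_transformation T" and [measurable]: "f \<in> borel_measurable borel"
  shows "(\<integral>\<^sup>+ x. f (T x) \<partial>lborel) = (\<integral>\<^sup>+ x. f x \<partial>lborel)"
proof -
  have lin: "linear T" using T by (rule orthogonal_transformation_linear)
  have [measurable]: "T \<in> borel_measurable borel"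
    using lin by (intro borel_measurable_continuous_onI linear_continuous_on) (simp add: linear_linear)
  define g :: "'a \<Rightarrow> ennreal" where "g = indicator (cball 0 1)"
  have [measurable]: "g \<in> borel_measurable borel"
    unfolding g_def by (intro borel_measurable_indicator) simp
  \<comment> \<open>T is an isometry, so the indicator of the unit ball is T-invariant. Both sides
    of the Fubini identity then carry the same constant \<open>c\<close>, which is positive and
    finite and can be cancelled.\<close>
  have gT: "g (T x) = g x" for x
    using orthogonal_transformation_norm[OF T, of x] by (simp add: g_def indicator_def dist_norm)
  define c where "c = (\<integral>\<^sup>+ x. g x \<partial>lborel)"
  have c: "c = emeasure lborel (cball (0::'a) 1)"
    unfolding c_def g_def by simp
  have "c \<noteq> 0"
    using content_cball_pos[of 1 "0::'a"] unfolding c by (auto simp: measure_def)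
  moreover have "c < \<infinity>"
    unfolding c using emeasure_bounded_finite[of "cball (0::'a) 1"] by auto
  moreover have "c * (\<integral>\<^sup>+ x. f (T x) \<partial>lborel) = c * (\<integral>\<^sup>+ x. f (- x) \<partial>lborel)"
  proof -
    have "c * (\<integral>\<^sup>+ x. f (T x) \<partial>lborel) = (\<integral>\<^sup>+ x. \<integral>\<^sup>+ y. f (T x) * g y \<partial>lborel \<partial>lborel)"
      unfolding c_def by (simp add: nn_integral_cmult nn_integral_multc mult.commute)
    also have "\<dots> = (\<integral>\<^sup>+ x. \<integral>\<^sup>+ y. f (T x) * g (T x + y) \<partial>lborel \<partial>lborel)"
      by (rule nn_integral_cong, rule nn_integral_lborel_translate[symmetric]) measurable
    also have "\<dots> = (\<integral>\<^sup>+ y. \<integral>\<^sup>+ x. f (T x) * g (T x + y) \<partial>lborel \<partial>lborel)"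
      by (rule lborel_pair_nn_integral_swap) measurable
    also have "\<dots> = (\<integral>\<^sup>+ y. \<integral>\<^sup>+ x. f (T x - y) * g (T x) \<partial>lborel \<partial>lborel)"
    proof (rule nn_integral_cong)
      fix y
      \<comment> \<open>Translating x by \<open>v\<close> moves y from the argument of
        \<open>g\<close> to that of \<open>f\<close>.\<close>
      obtain v where v: "T v = - y"
        using orthogonal_transformation_surj[OF T] by (metis surjD)
      have "(\<integral>\<^sup>+ x. f (T x) * g (T x + y) \<partial>lborel) = (\<integral>\<^sup>+ x. f (T (v + x)) * g (T (v + x) + y) \<partial>lborel)"
        by (rule nn_integral_lborel_translate[symmetric]) measurable
      also have "\<dots> = (\<integral>\<^sup>+ x. f (T x - y) * g (T x) \<partial>lborel)"
        by (simp add: linear_add[OF lin] v)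
      finally show "(\<integral>\<^sup>+ x. f (T x) * g (T x + y) \<partial>lborel) = (\<integral>\<^sup>+ x. f (T x - y) * g (T x) \<partial>lborel)" .
    qed
    also have "\<dots> = (\<integral>\<^sup>+ x. \<integral>\<^sup>+ y. f (T x - y) * g (T x) \<partial>lborel \<partial>lborel)"
      by (rule lborel_pair_nn_integral_swap[symmetric]) measurable
    also have "\<dots> = (\<integral>\<^sup>+ x. g (T x) * (\<integral>\<^sup>+ y. f (- y) \<partial>lborel) \<partial>lborel)"
    proof (rule nn_integral_cong)
      \<comment> \<open>Translating y by \<open>T x\<close> frees the argument of \<open>f\<close>
        from x at the price of a reflection, which is undone at the end.\<close>
      fix x
      have "(\<integral>\<^sup>+ y. f (T x - y) \<partial>lborel) = (\<integral>\<^sup>+ y. f (T x - (T x + y)) \<partial>lborel)"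
        by (rule nn_integral_lborel_translate[symmetric]) measurable
      then show "(\<integral>\<^sup>+ y. f (T x - y) * g (T x) \<partial>lborel) = g (T x) * (\<integral>\<^sup>+ y. f (- y) \<partial>lborel)"
        by (simp add: nn_integral_cmult mult.commute)
    qed
    also have "\<dots> = c * (\<integral>\<^sup>+ x. f (- x) \<partial>lborel)"
      unfolding gT c_def by (simp add: nn_integral_multc)
    finally show ?thesis .
  qed
  ultimately have "(\<integral>\<^sup>+ x. f (T x) \<partial>lborel) = (\<integral>\<^sup>+ x. f (- x) \<partial>lborel)"
    by (auto simp: ennreal_mult_cancel_left)
  also have "\<dots> = (\<integral>\<^sup>+ x. f x \<partial>lborel)"
  proof -
    have "(\<integral>\<^sup>+ x. f x \<partial>lborel) = (\<integral>\<^sup>+ x. f x \<partial>density (distr lborel borel (\<lambda>x. 0 + (-1) *\<^sub>R x)) (\<lambda>_. \<bar>-1::real\<bar> ^ DIM('a)))"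
      by (subst lborel_affine[of "-1" "0::'a"]) auto
    also have "\<dots> = (\<integral>\<^sup>+ x. f (- x) \<partial>lborel)"
      by (simp add: nn_integral_density nn_integral_distr)
    finally show ?thesis ..
  qed
  finally show ?thesis .
qed

text \<open>Every complex coordinate spans two real basis directions, so \<open>c i\<close> enters
  the Jacobian squared. In log-coordinates this map is the translation by the vector of the
  \<open>ln (c i)\<close>.\<close>

lemma nn_integral_scale_coordinates:
  fixes c :: "'n::finite \<Rightarrow> real" and f :: "complex ^ 'n \<Rightarrow> ennreal"
  assumes c: "\<And>i. 0 < c i" and [measurable]: "f \<in> borel_measurable borel"
  shows "(\<integral>\<^sup>+ z. f z \<partial>lborel) = ennreal (\<Prod>i\<in>UNIV. (c i)\<^sup>2) * (\<integral>\<^sup>+ z. f (\<chi> i. c i *\<^sub>R z $ i) \<partial>lborel)"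
proof -
  \<comment> \<open>Recovers \<open>c i\<close> from a real basis vector \<open>axis i u\<close>,
    whose only nonzero entry has norm 1.\<close>
  define e where "e j = (\<Sum>i\<in>UNIV. c i * norm (j $ i))" for j :: "complex ^ 'n"
  have e: "e (axis i u) = c i" if "u \<in> Basis" for i and u :: complex
  proof -
    have "e (axis i u) = (\<Sum>k\<in>UNIV. if k = i then c i else 0)"
      unfolding e_def using that by (intro sum.cong) (auto simp: axis_def)
    then show ?thesis by simp
  qed
  have pos: "0 < e j" if "j \<in> Basis" for j
    using that e c by (auto simp: Basis_vec_def)
  have inj: "inj_on (\<lambda>(i, u). axis i u :: complex ^ 'n) (UNIV \<times> Basis)"
    by (auto simp: inj_on_def axis_eq_axis)
  have Basis_eq: "(Basis :: (complex ^ 'n) set) = (\<lambda>(i, u). axis i u) ` (UNIV \<times> Basis)"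
    by (auto simp: Basis_vec_def)
  have prod: "(\<Prod>j\<in>Basis. \<bar>e j\<bar>) = (\<Prod>i\<in>UNIV. (c i)\<^sup>2)"
  proof -
    have "(\<Prod>j\<in>Basis. \<bar>e j\<bar>) = (\<Prod>(i, u)\<in>UNIV \<times> (Basis :: complex set). \<bar>e (axis i u)\<bar>)"
      unfolding Basis_eq by (subst prod.reindex[OF inj]) (auto intro!: prod.cong)
    also have "\<dots> = (\<Prod>i\<in>UNIV. \<Prod>u\<in>(Basis :: complex set). \<bar>e (axis i u)\<bar>)"
      by (rule prod.cartesian_product[symmetric])
    also have "\<dots> = (\<Prod>i\<in>UNIV. (c i)\<^sup>2)"
      by (intro prod.cong) (auto simp: e power2_eq_square Basis_complex_def)
    finally show ?thesis .
  qed
  have T: "0 + (\<Sum>j\<in>Basis. (e j * (z \<bullet> j)) *\<^sub>R j) = (\<chi> i. c i *\<^sub>R z $ i)" for z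
  proof (subst euclidean_eq_iff, intro ballI)
    fix b :: "complex ^ 'n" assume b: "b \<in> Basis"
    then obtain i u where iu: "b = axis i u" "u \<in> Basis" by (auto simp: Basis_vec_def)
    have "(0 + (\<Sum>j\<in>Basis. (e j * (z \<bullet> j)) *\<^sub>R j)) \<bullet> b = e b * (z \<bullet> b)"
      using b by simp
    also have "\<dots> = (\<chi> i. c i *\<^sub>R z $ i) \<bullet> b"
      using iu by (simp add: e inner_axis)
    finally show "(0 + (\<Sum>j\<in>Basis. (e j * (z \<bullet> j)) *\<^sub>R j)) \<bullet> b = (\<chi> i. c i *\<^sub>R z $ i) \<bullet> b" .
  qed
  have [measurable]: "(\<lambda>z :: complex ^ 'n. \<chi> i. c i *\<^sub>R z $ i) \<in> borel_measurable borel"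
    by (intro borel_measurable_continuous_onI continuous_intros)
  have lb: "(lborel :: (complex ^ 'n) measure) = density (distr lborel borel (\<lambda>z. \<chi> i. c i *\<^sub>R z $ i)) (\<lambda>_. ennreal (\<Prod>i\<in>UNIV. (c i)\<^sup>2))"
    using lborel_affine_euclidean[of e "0 :: complex ^ 'n"] pos unfolding T prod by fastforce
  show ?thesis
    by (subst lb) (simp add: nn_integral_density nn_integral_distr nn_integral_cmult)
qed

lemma nn_integral_scale_coordinate:
  fixes f :: "complex ^ 'n::finite \<Rightarrow> ennreal"
  assumes c: "0 < c" and f: "f \<in> borel_measurable borel"
  shows "(\<integral>\<^sup>+ z. f z \<partial>lborel) =
    ennreal (c\<^sup>2) * (\<integral>\<^sup>+ z. f (\<chi> i. (if i = j then c else 1) *\<^sub>R z $ i) \<partial>lborel)"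
proof -
  have "(\<Prod>i\<in>UNIV. (if i = j then c else 1)\<^sup>2) = c\<^sup>2"
    by (simp add: if_distrib[of "\<lambda>x. x\<^sup>2"] cong: if_cong)
  then show ?thesis
    using nn_integral_scale_coordinates[of "\<lambda>i. if i = j then c else 1" f] c f by simp
qed


section \<open>Closed polydisks and power weights\<close>

definition cpolydisk :: "real ^ 'n \<Rightarrow> (complex ^ 'n) set" where
  "cpolydisk s = {z. \<forall>i. cmod (z $ i) \<le> s $ i}"

lemma closed_cpolydisk: "closed (cpolydisk s)"
proof -
  have "cpolydisk s = (\<Inter>i. {z. cmod (z $ i) \<le> s $ i})"
    by (auto simp: cpolydisk_def)
  also have "closed \<dots>"
    by (intro closed_INT ballI closed_Collect_le continuous_intros)
  finally show ?thesis .
qed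

lemma compact_cpolydisk: "compact (cpolydisk (s :: real ^ 'n::finite))"
proof -
  have "norm z \<le> (\<Sum>i\<in>UNIV. s $ i)" if "z \<in> cpolydisk s" for z
    using that by (auto simp: cpolydisk_def intro!: order_trans[OF norm_le_l1_cart] order_trans[OF L2_set_le_sum] sum_mono simp: norm_vec_def)
  then have "bounded (cpolydisk s)"
    by (auto simp: bounded_iff)
  with closed_cpolydisk show ?thesis
    by (simp add: compact_eq_bounded_closed)
qed

lemma borel_cpolydisk [measurable]: "cpolydisk s \<in> sets borel"
  using closed_cpolydisk by (rule borel_closed)

lemma AE_coordinates_nonzero: "AE z :: complex ^ 'n in lborel. \<forall>i. z $ i \<noteq> 0"
proof -
  have "AE z :: complex ^ 'n in lborel. z $ i \<noteq> 0" for i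
  proof -
    \<comment> \<open>This is the real hyperplane Re z_i = 0, which contains the set z_i =
      0.\<close>
    have "negligible {z :: complex ^ 'n. axis i 1 \<bullet> z = 0}"
      by (rule negligible_hyperplane) (simp add: axis_eq_0_iff)
    moreover have "closed {z :: complex ^ 'n. axis i 1 \<bullet> z = 0}"
      by (rule closed_hyperplane)
    ultimately have "{z :: complex ^ 'n. axis i 1 \<bullet> z = 0} \<in> null_sets lborel"
      by (metis borel_closed negligible_iff_null_sets null_sets_completion_iff sets_lborel)
    then show ?thesis
      by (rule AE_I') (auto simp: inner_axis inner_commute[of "axis i 1"])
  qed
  then show ?thesis by (simp add: AE_all_countable)
qed

text \<open>Halving the coordinate \<open>z\<^sub>j\<close> multiplies the integral by \<open>q = 4\<^sup>-\<^sup>e < 1\<close>, so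
  the integrals over \<open>|z\<^sub>j| > s\<^sub>j / 2\<^sup>k\<close> satisfy \<open>u (k + 1) \<le> u 1 + q u k\<close> and stay bounded. This
  replaces polar coordinates.\<close>

lemma nn_integral_power_weight_finite:
  fixes s :: "real ^ 'n::finite"
  assumes s: "\<And>i. 0 < s $ i" and e: "0 < e" "e < 1"
  shows "(\<integral>\<^sup>+ z. ennreal (\<Prod>i\<in>UNIV. cmod (z $ i) powr (2 * e - 2)) * indicator (cpolydisk s) z \<partial>lborel) < \<infinity>"
proof -
  define w where "w z = ennreal (\<Prod>i\<in>UNIV. cmod (z $ i) powr (2 * e - 2))" for z :: "complex ^ 'n"
  have [measurable]: "(\<lambda>z :: complex ^ 'n. z $ i) \<in> borel_measurable borel" for i
    by (intro borel_measurable_continuous_onI continuous_intros)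
  have w_meas [measurable]: "w \<in> borel_measurable borel"
    unfolding w_def by measurable
  \<comment> \<open>Coordinates outside \<open>V\<close> stay away from 0, where the weight is
    bounded; the induction releases them one at a time, up to \<open>V = UNIV\<close>.\<close>
  define D where "D V = {z \<in> cpolydisk s. \<forall>i. i \<notin> V \<longrightarrow> s $ i / 2 < cmod (z $ i)}" for V
  have D_meas [measurable]: "D V \<in> sets borel" for V
    unfolding D_def by measurable
  have "(\<integral>\<^sup>+ z. w z * indicator (D V) z \<partial>lborel) < \<infinity>" for V
    using finite[of V]
  proof (induction V rule: finite_induct)
    case empty
    define B where "B = (\<Prod>i\<in>UNIV. (s $ i / 2) powr (2 * e - 2))"
    have "w z * indicator (D {}) z \<le> ennreal B * indicator (cpolydisk s) z" for z
    proof (cases "z \<in> D {}")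
      case True
      then have "(\<Prod>i\<in>UNIV. cmod (z $ i) powr (2 * e - 2)) \<le> B"
        unfolding B_def using s e by (intro prod_mono conjI powr_mono2') (auto simp: D_def less_imp_le)
      then show ?thesis using True by (auto simp: w_def D_def intro!: ennreal_leI)
    qed auto
    then have "(\<integral>\<^sup>+ z. w z * indicator (D {}) z \<partial>lborel) \<le> (\<integral>\<^sup>+ z. ennreal B * indicator (cpolydisk s) z \<partial>lborel)"
      by (intro nn_integral_mono)
    also have "\<dots> = ennreal B * emeasure lborel (cpolydisk s)"
      by (simp add: nn_integral_cmult_indicator)
    also have "\<dots> < \<infinity>"
      using emeasure_compact_finite[OF compact_cpolydisk, of s] by (simp add: ennreal_mult_less_top)
    finally show ?case .
  next
    case (insert j V)
    define Dk where "Dk k = {z \<in> D (insert j V). s $ j / 2 ^ k < cmod (z $ j)}" for k :: nat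
    have [measurable]: "Dk k \<in> sets borel" for k unfolding Dk_def by measurable
    define u where "u k = (\<integral>\<^sup>+ z. w z * indicator (Dk k) z \<partial>lborel)" for k
    have Dk1: "Dk 1 = D V"
      using insert.hyps by (auto simp: Dk_def D_def)
    \<comment> \<open>The factor 1/4 is the Jacobian of halving z_j, and the power is what halving
      does to the weight.\<close>
    define q where "q = (1/4) * (1/2) powr (2 * e - 2)"
    have q: "0 < q" "q < 1"
    proof -
      have "q = (1/2) powr 2 * (1/2) powr (2 * e - 2)" by (simp add: q_def power2_eq_square)
      also have "\<dots> = (1/2) powr (2 * e)" by (subst powr_add[symmetric]) simp
      finally have "q = (1/2) powr (2 * e)" .
      then show "0 < q" "q < 1" using e powr01_less_one[of "1/2" "2 * e"] by auto
    qed
    have rec: "u (Suc k) \<le> u 1 + ennreal q * u k" for k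
    proof -
      define E where "E = {z \<in> Dk (Suc k). cmod (z $ j) \<le> s $ j / 2}"
      have [measurable]: "E \<in> sets borel" unfolding E_def by measurable
      define S where "S z = (\<chi> i. (if i = j then 1/2 else 1 :: real) *\<^sub>R z $ i)" for z :: "complex ^ 'n"
      have S: "S z $ i = (if i = j then z $ i / 2 else z $ i)" for z i
        by (simp add: S_def scaleR_conv_of_real)
      have [measurable]: "S \<in> borel_measurable borel"
        unfolding S_def by (intro borel_measurable_continuous_onI continuous_intros)
      have wS: "w (S z) = ennreal ((1/2) powr (2 * e - 2)) * w z" for z
      proof -
        have "(\<Prod>i\<in>UNIV. cmod (S z $ i) powr (2 * e - 2)) =
          (\<Prod>i\<in>UNIV. (if i = j then (1/2) powr (2 * e - 2) else 1) * cmod (z $ i) powr (2 * e - 2))"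
          by (intro prod.cong) (auto simp: S norm_divide powr_divide powr_mult[symmetric])
        also have "\<dots> = (1/2) powr (2 * e - 2) * (\<Prod>i\<in>UNIV. cmod (z $ i) powr (2 * e - 2))"
          by (simp add: prod.distrib)
        finally show ?thesis by (simp add: w_def ennreal_mult prod_nonneg)
      qed
      have ES: "indicator E (S z) \<le> (indicator (Dk k) z :: ennreal)" for z
      proof (cases "S z \<in> E")
        case True
        then have *: "cmod (S z $ i) \<le> s $ i" "i \<notin> insert j V \<Longrightarrow> s $ i / 2 < cmod (S z $ i)"
           "s $ j / 2 ^ Suc k < cmod (S z $ j)" "cmod (S z $ j) \<le> s $ j / 2" for i
          by (auto simp: E_def Dk_def D_def cpolydisk_def)
        have "z \<in> Dk k"
          using *(1) *(2) *(3,4) unfolding Dk_def D_def cpolydisk_def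
          by (auto simp: S norm_divide split: if_splits)
            (metis divide_right_mono_neg)
        with True show ?thesis by simp
      qed auto
      have "u (Suc k) \<le> (\<integral>\<^sup>+ z. w z * indicator (Dk 1) z + w z * indicator E z \<partial>lborel)"
        unfolding u_def by (intro nn_integral_mono) (auto simp: E_def Dk_def indicator_def)
      also have "\<dots> = u 1 + (\<integral>\<^sup>+ z. w z * indicator E z \<partial>lborel)"
        unfolding u_def by (intro nn_integral_add) measurable
      also have "(\<integral>\<^sup>+ z. w z * indicator E z \<partial>lborel) = ennreal ((1/2)\<^sup>2) * (\<integral>\<^sup>+ z. w (S z) * indicator E (S z) \<partial>lborel)"
        unfolding S_def by (rule nn_integral_scale_coordinate) auto
      also have "\<dots> \<le> ennreal ((1/2)\<^sup>2) * (\<integral>\<^sup>+ z. ennreal ((1/2) powr (2 * e - 2)) * (w z * indicator (Dk k) z) \<partial>lborel)"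
        using ES by (intro mult_left_mono nn_integral_mono) (auto simp: wS mult.assoc intro!: mult_left_mono)
      also have "\<dots> = ennreal q * u k"
      proof -
        have "ennreal q = ennreal ((1/2)\<^sup>2) * ennreal ((1/2) powr (2 * e - 2))"
          by (simp add: q_def power2_eq_square ennreal_mult[symmetric])
        then show ?thesis by (simp add: u_def nn_integral_cmult mult.assoc)
      qed
      finally show ?thesis by (simp add: add_left_mono)
    qed
    have fin: "u 1 < \<infinity>" using insert.IH unfolding u_def Dk1 .
    then obtain a where a: "u 1 = ennreal a" "0 \<le> a"
      by (cases "u 1") auto
    \<comment> \<open>a / (1 - q) solves x = a + q x, so the recursion preserves this bound.\<close>
    have bound: "u (Suc k) \<le> ennreal (a / (1 - q))" for k
    proof (induction k)
      case 0
      have "a * (1 - q) \<le> a" using a q by (simp add: algebra_simps)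
      then show ?case using a q by (auto simp: field_simps intro!: ennreal_leI)
    next
      case (Suc k)
      have "u (Suc (Suc k)) \<le> u 1 + ennreal q * u (Suc k)" by (rule rec)
      also have "\<dots> \<le> ennreal a + ennreal q * ennreal (a / (1 - q))"
        unfolding a(1) by (intro add_left_mono mult_left_mono Suc.IH) auto
      also have "\<dots> = ennreal (a + q * (a / (1 - q)))"
        using a q by (simp add: ennreal_mult[symmetric] ennreal_plus[symmetric] del: ennreal_plus)
      also have "a + q * (a / (1 - q)) = a / (1 - q)"
        using q by (simp add: field_simps)
      finally show ?case .
    qed
    have "w z * indicator (D (insert j V)) z = (SUP k. w z * indicator (Dk (Suc k)) z)" for z
    proof (cases "z \<in> D (insert j V) \<and> z $ j \<noteq> 0")
      case True
      have "(\<lambda>k. s $ j / 2 ^ Suc k) \<longlonglongrightarrow> 0" by real_asymp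
      then have "eventually (\<lambda>k. s $ j / 2 ^ Suc k < cmod (z $ j)) sequentially"
        using True by (intro order_tendstoD) auto
      then obtain k where "s $ j / 2 ^ Suc k < cmod (z $ j)"
        by (auto simp: eventually_sequentially)
      with True have "z \<in> Dk (Suc k)" by (auto simp: Dk_def)
      then have "w z * indicator (D (insert j V)) z \<le> (SUP k. w z * indicator (Dk (Suc k)) z)"
        by (intro SUP_upper2[of k]) (auto simp: indicator_def)
      moreover have "(SUP k. w z * indicator (Dk (Suc k)) z) \<le> w z * indicator (D (insert j V)) z"
        by (intro SUP_least) (auto simp: Dk_def indicator_def)
      ultimately show ?thesis by (rule antisym)
    next
      case False
      \<comment> \<open>\<open>0 powr x\<close> is 0, so the weight vanishes on z_j = 0, a set that
        no \<open>Dk\<close> reaches.\<close>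
      have w0: "w z = 0" if "z $ j = 0"
      proof -
        have "(\<Prod>i\<in>UNIV. cmod (z $ i) powr (2 * e - 2)) = 0"
          using that by (intro prod_zero) auto
        then show ?thesis by (simp only: w_def ennreal_0)
      qed
      then have "w z * indicator (D (insert j V)) z = 0" 
        using False by auto
      moreover have "w z * indicator (Dk (Suc k)) z = 0" for k
        using False w0 by (auto simp: Dk_def)
      ultimately show ?thesis by (simp only:) (simp add: SUP_const)
    qed
    then have "(\<integral>\<^sup>+ z. w z * indicator (D (insert j V)) z \<partial>lborel) = (\<integral>\<^sup>+ z. (SUP k. w z * indicator (Dk (Suc k)) z) \<partial>lborel)"
      by simp
    also have "\<dots> = (SUP k. u (Suc k))"
      unfolding u_def
    proof (rule nn_integral_monotone_convergence_SUP)
      have "Dk (Suc k) \<subseteq> Dk (Suc l)" if "k \<le> l" for k l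
      proof -
        have "s $ j / 2 ^ Suc l \<le> s $ j / 2 ^ Suc k"
          using that s[of j] by (intro divide_left_mono power_increasing) auto
        then show ?thesis by (auto simp: Dk_def)
      qed
      then show "incseq (\<lambda>k z. w z * indicator (Dk (Suc k)) z)"
        by (auto simp: incseq_def le_fun_def intro!: mult_left_mono) (auto simp: indicator_def)
    qed measurable
    also have "\<dots> \<le> ennreal (a / (1 - q))"
      by (intro SUP_least bound)
    also have "\<dots> < \<infinity>" by simp
    finally show ?case .
  qed
  from this[of UNIV] show ?thesis
    by (simp add: D_def w_def)
qed

section \<open>Monomials in the multiplier ideal\<close>

lemma ereal_exp_measurable [measurable]: "ereal_exp \<in> borel_measurable borel"
proof -
  have "ereal_exp = (\<lambda>x. if x = \<infinity> then \<infinity> else if x = -\<infinity> then 0 else ennreal (exp (real_of_ereal x)))"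
  proof
    fix x show "ereal_exp x = (if x = \<infinity> then \<infinity> else if x = -\<infinity> then 0 else ennreal (exp (real_of_ereal x)))"
      by (cases x) (auto simp: ereal_exp_def)
  qed
  also have "\<dots> \<in> borel_measurable borel" by measurable
  finally show ?thesis .
qed

lemma ereal_exp_minus2_le: "ereal a \<le> x \<Longrightarrow> ereal_exp (- 2 * x) \<le> ennreal (exp (- 2 * a))"
  by (cases x) (auto simp: ereal_exp_def intro!: ennreal_leI)

lemma ereal_exp_ereal [simp]: "ereal_exp (ereal a) = ennreal (exp a)"
  by (simp add: ereal_exp_def)

lemma ereal_exp_minus2_pos: "x < \<infinity> \<Longrightarrow> 0 < ereal_exp (- 2 * x)"
  by (cases x) (auto simp: ereal_exp_def)

lemma ereal_exp_minus2_MInf: "ereal_exp (- 2 * (- \<infinity>)) = \<infinity>"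
  by (simp add: ereal_exp_def)

definition weight_on :: "(complex ^ 'n \<Rightarrow> ereal) \<Rightarrow> real ^ 'n \<Rightarrow> (complex ^ 'n \<Rightarrow> complex) \<Rightarrow> complex ^ 'n \<Rightarrow> ennreal" where
  "weight_on \<phi> s F z = ennreal ((cmod (F z))\<^sup>2) * ereal_exp (- 2 * \<phi> z) * indicator (cpolydisk s) z"

lemma cpolydisk_subset: "(\<And>i. s $ i < r $ i) \<Longrightarrow> cpolydisk s \<subseteq> polydisk r"
  by (auto simp: cpolydisk_def polydisk_def intro: le_less_trans)

lemma compact_subset_cpolydisk:
  assumes r: "\<And>i. 0 < r $ i" and K: "compact K" "K \<subseteq> polydisk r"
  shows "\<exists>s. (\<forall>i. 0 < s $ i \<and> s $ i < r $ i) \<and> K \<subseteq> cpolydisk s"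
proof -
  have "\<exists>a. 0 < a \<and> a < r $ i \<and> (\<forall>z\<in>K. cmod (z $ i) \<le> a)" for i
  proof (cases "K = {}")
    case True
    then show ?thesis using r[of i] dense by blast
  next
    case False
    have "continuous_on K (\<lambda>z. cmod (z $ i))" by (intro continuous_intros)
    then obtain w where w: "w \<in> K" "\<And>z. z \<in> K \<Longrightarrow> cmod (z $ i) \<le> cmod (w $ i)"
      using continuous_attains_sup[OF K(1) False, of "\<lambda>z. cmod (z $ i)"] by blast
    have "max 0 (cmod (w $ i)) < r $ i" using w(1) K(2) r[of i] by (auto simp: polydisk_def)
    then obtain a where "max 0 (cmod (w $ i)) < a" "a < r $ i" using dense by blast
    then show ?thesis using w(2) by (intro exI[of _ a]) (auto intro: order_trans less_imp_le le_less_trans[OF norm_ge_zero])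
  qed
  then obtain a where "\<And>i. 0 < a i \<and> a i < r $ i \<and> (\<forall>z\<in>K. cmod (z $ i) \<le> a i)" by metis
  then show ?thesis by (intro exI[of _ "\<chi> i. a i"]) (auto simp: cpolydisk_def)
qed

lemma locally_integrable_iff_cpolydisk:
  assumes r: "\<And>i. 0 < r $ i"
  shows "locally_integrable_on (polydisk r) (\<lambda>z. ennreal ((cmod (F z))\<^sup>2) * ereal_exp (- 2 * \<phi> z)) \<longleftrightarrow>
    (\<forall>s. (\<forall>i. 0 < s $ i \<and> s $ i < r $ i) \<longrightarrow> (\<integral>\<^sup>+ z. weight_on \<phi> s F z \<partial>lborel) < \<infinity>)"
  (is "?L \<longleftrightarrow> ?R")
proof
  assume ?L
  then show ?R
    using compact_cpolydisk cpolydisk_subset unfolding locally_integrable_on_def weight_on_def by blast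
next
  assume R: ?R
  show ?L
    unfolding locally_integrable_on_def
  proof (intro allI impI)
    fix K assume "compact K" "K \<subseteq> polydisk r"
    from compact_subset_cpolydisk[OF r this] obtain s
      where s: "\<forall>i. 0 < s $ i \<and> s $ i < r $ i" "K \<subseteq> cpolydisk s" by blast
    have "(\<integral>\<^sup>+ z\<in>K. ennreal ((cmod (F z))\<^sup>2) * ereal_exp (- 2 * \<phi> z) \<partial>lborel) \<le> (\<integral>\<^sup>+ z. weight_on \<phi> s F z \<partial>lborel)"
      using s(2) unfolding weight_on_def by (intro nn_integral_mono) (auto simp: indicator_def)
    also have "\<dots> < \<infinity>" using R s(1) by blast
    finally show "(\<integral>\<^sup>+ z\<in>K. ennreal ((cmod (F z))\<^sup>2) * ereal_exp (- 2 * \<phi> z) \<partial>lborel) < \<infinity>" .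
  qed
qed

lemma weight_on_measurable:
  assumes psh: "psh_on (polydisk r) \<phi>" and F: "continuous_on (polydisk r) F"
    and s: "cpolydisk s \<subseteq> polydisk r"
  shows "weight_on \<phi> s F \<in> borel_measurable borel"
proof -
  have [measurable]: "polydisk r \<in> sets borel" using open_polydisk by (rule borel_open)
  \<comment> \<open>Nothing is known about \<phi> and \<open>F\<close> off the polydisk, so both are
    replaced by 0 there; the indicator of \<open>cpolydisk s\<close> hides the change.\<close>
  define \<phi>' where "\<phi>' z = (if z \<in> polydisk r then \<phi> z else 0)" for z
  have [measurable]: "\<phi>' \<in> borel_measurable borel"
  proof (rule borel_measurableI_less)
    fix a
    have "open {z \<in> polydisk r. \<phi> z < a}"
      using psh open_polydisk unfolding psh_on_def usc_on_def by (blast intro: openin_open_trans)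
    then have 1: "{z \<in> polydisk r. \<phi> z < a} \<in> sets borel" by (rule borel_open)
    have 2: "(if 0 < a then - polydisk r else {}) \<in> sets borel"
      using open_polydisk by (auto intro: borel_comp borel_open)
    have "{z \<in> space borel. \<phi>' z < a} = {z \<in> polydisk r. \<phi> z < a} \<union> (if 0 < a then - polydisk r else {})"
      by (auto simp: \<phi>'_def)
    also have "\<dots> \<in> sets borel" using 1 2 by (rule sets.Un)
    finally show "{z \<in> space borel. \<phi>' z < a} \<in> sets borel" .
  qed
  define F' where "F' z = indicator (polydisk r) z *\<^sub>R F z" for z
  have [measurable]: "F' \<in> borel_measurable borel"
    unfolding F'_def using F by (intro borel_measurable_continuous_on_indicator) auto
  have "weight_on \<phi> s F = (\<lambda>z. ennreal ((cmod (F' z))\<^sup>2) * ereal_exp (- 2 * \<phi>' z) * indicator (cpolydisk s) z)"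
    using s by (auto simp: weight_on_def F'_def \<phi>'_def indicator_def fun_eq_iff)
  also have "\<dots> \<in> borel_measurable borel" by measurable
  finally show ?thesis .
qed

text \<open>The substitution x = -y undoes both signs in \<open>concave_profile\<close>: membership
  means that f has an affine minorant of slope \<mu>.\<close>

lemma newton_body_iff:
  "\<mu> \<in> newton_body r \<phi> \<longleftrightarrow> (\<exists>C. \<forall>y\<in>log_domain r. ereal (\<mu> \<bullet> y - C) \<le> log_profile \<phi> y)"
proof -
  have eq: "concave_profile \<phi> (- y) - ereal (\<mu> \<bullet> (- y)) \<le> ereal C \<longleftrightarrow> ereal (\<mu> \<bullet> y - C) \<le> log_profile \<phi> y" for C y
    unfolding concave_profile_def by (cases "log_profile \<phi> y") auto
  have "{x. \<forall>i. - ln (r $ i) < x $ i} = uminus ` log_domain r"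
  proof (intro equalityI subsetI)
    fix x assume "x \<in> {x. \<forall>i. - ln (r $ i) < x $ i}"
    then have "- x \<in> log_domain r" by (auto simp: log_domain_def) (metis minus_less_iff)
    then show "x \<in> uminus ` log_domain r" by (metis image_eqI minus_minus)
  qed (auto simp: log_domain_def)
  then have "\<mu> \<in> newton_body r \<phi> \<longleftrightarrow> (\<exists>C. \<forall>y\<in>log_domain r. concave_profile \<phi> (- y) - ereal (\<mu> \<bullet> (- y)) \<le> ereal C)"
    unfolding newton_body_def newton_body_on_def by (simp del: inner_minus_right)
  then show ?thesis unfolding eq .
qed

text \<open>If \<open>p\<close> is not an interior point, \<open>h = \<langle>p, \<cdot>\<rangle> - f\<close> does not decrease linearly: a limit of
  the directions of points where \<open>h\<close> is nearly unbounded is a direction along which the concave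
  function \<open>h\<close> never decreases.\<close>

lemma convex_recession_direction:
  fixes f :: "real ^ 'n \<Rightarrow> real"
  assumes f: "convex_on (log_domain r) f"
    and p: "p \<notin> interior {\<mu>. \<exists>C. \<forall>y\<in>log_domain r. \<mu> \<bullet> y - C \<le> f y}"
  shows "\<exists>d. d \<noteq> 0 \<and> (\<forall>i. d $ i \<le> 0) \<and> (\<forall>y\<in>log_domain r. f (y + d) \<le> f y + p \<bullet> d)"
proof -
  let ?P = "{\<mu>. \<exists>C. \<forall>y\<in>log_domain r. \<mu> \<bullet> y - C \<le> f y}"
  define h where "h y = p \<bullet> y - f y" for y
  have h_concave: "(1 - t) * h x + t * h y \<le> h ((1 - t) *\<^sub>R x + t *\<^sub>R y)"
    if "0 \<le> t" "t \<le> 1" "x \<in> log_domain r" "y \<in> log_domain r" for t x y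
    using convex_onD[OF f, of t x y] that by (simp add: h_def inner_add_right algebra_simps)
  have h_cont: "continuous_on (log_domain r) h"
    unfolding h_def by (intro continuous_intros convex_on_continuous[OF open_log_domain f])
  \<comment> \<open>The ball of radius 1 / (k + 1) around \<open>p\<close> contains a slope outside
    the Newton body, for which the bound with constant \<open>k\<close> fails at some point. There h
    is at least k up to an error of the norm of the point divided by k + 1.\<close>
  have "\<exists>q y. norm (q - p) < 1 / real (Suc k) \<and> y \<in> log_domain r \<and> f y < q \<bullet> y - real k" for k
  proof -
    have "\<not> ball p (1 / real (Suc k)) \<subseteq> ?P"
      using p by (metis (no_types, lifting) mem_interior divide_pos_pos of_nat_0_less_iff zero_less_Suc zero_less_one)
    then obtain q where q: "q \<in> ball p (1 / real (Suc k))" "q \<notin> ?P" by blast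
    then have "\<not> (\<forall>y\<in>log_domain r. q \<bullet> y - real k \<le> f y)" by blast
    then obtain y where "y \<in> log_domain r" "f y < q \<bullet> y - real k" by (auto simp: not_le)
    moreover have "norm (q - p) < 1 / real (Suc k)" using q(1) by (simp add: dist_norm norm_minus_commute)
    ultimately show ?thesis by blast
  qed
  then obtain q Y where qY: "\<And>k. norm (q k - p) < 1 / real (Suc k)" "\<And>k. Y k \<in> log_domain r"
    "\<And>k. f (Y k) < q k \<bullet> Y k - real k" by metis
  have hY: "real k - norm (Y k) / real (Suc k) \<le> h (Y k)" for k
  proof -
    have "(q k - p) \<bullet> Y k \<le> norm (q k - p) * norm (Y k)" by (rule norm_cauchy_schwarz)
    also have "\<dots> \<le> 1 / real (Suc k) * norm (Y k)" using qY(1)[of k] by (intro mult_right_mono) auto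
    finally show ?thesis using qY(3)[of k] by (simp add: h_def inner_diff_left)
  qed
  define y0 where "y0 = (\<chi> i. ln (r $ i) - 1)"
  have y0: "y0 \<in> log_domain r" by (simp add: y0_def log_domain_def)
  then obtain e where e: "0 < e" "cball y0 e \<subseteq> log_domain r"
    using open_log_domain open_contains_cball by blast
  have "continuous_on (cball y0 e) h" using h_cont e(2) by (rule continuous_on_subset)
  then obtain x0 where x0: "\<And>x. x \<in> cball y0 e \<Longrightarrow> h x0 \<le> h x" "x0 \<in> cball y0 e"
    using continuous_attains_inf[of "cball y0 e" h] e(1) by fastforce
  define B where "B = (h y0 - h x0) / e"
  have B: "0 \<le> B" using x0(1)[of y0] e(1) by (simp add: B_def)
  define A where "A = h y0 + B * (norm y0 + 1)"
  \<comment> \<open>A concave function grows at most linearly: \<open>y0\<close> lies between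
    \<open>y\<close> and a point \<open>x\<close> of the ball around \<open>y0\<close>, where h is
    at least \<open>h x0\<close>. Against the lower bound on \<open>h (Y k)\<close> this forces
    \<open>norm (Y k)\<close> to infinity.\<close>
  have h_upper: "h y \<le> A + B * norm y" if y: "y \<in> log_domain r" for y
  proof -
    define n where "n = norm (y - y0) + 1"
    have n: "0 < n" by (simp add: n_def add_nonneg_pos)
    define \<tau> where "\<tau> = e / n"
    have \<tau>: "0 < \<tau>" using e(1) n by (simp add: \<tau>_def)
    define x where "x = y0 - \<tau> *\<^sub>R (y - y0)"
    have "\<tau> * norm (y - y0) \<le> e"
      using e(1) n by (simp add: \<tau>_def divide_le_eq n_def)
    then have x: "x \<in> cball y0 e" using \<tau> by (simp add: x_def dist_norm)
    define t where "t = \<tau> / (1 + \<tau>)"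
    have t: "0 \<le> t" "t \<le> 1" "1 - t = 1 / (1 + \<tau>)" using \<tau> by (auto simp: t_def field_simps)
    have "(1 + \<tau>) *\<^sub>R ((1 - t) *\<^sub>R x + t *\<^sub>R y) = x + \<tau> *\<^sub>R y"
      unfolding t(3) using \<tau> by (simp add: t_def scaleR_add_right)
    also have "\<dots> = (1 + \<tau>) *\<^sub>R y0" by (simp add: x_def algebra_simps)
    finally have "(1 - t) *\<^sub>R x + t *\<^sub>R y = y0" using \<tau> by simp
    then have "(1 - t) * h x + t * h y \<le> h y0"
      using h_concave[OF t(1,2), of x y] x e(2) y by auto
    then have "(1 + \<tau>) * ((1 - t) * h x + t * h y) \<le> (1 + \<tau>) * h y0"
      using \<tau> by (intro mult_left_mono) auto
    moreover have "(1 + \<tau>) * ((1 - t) * h x + t * h y) = h x + \<tau> * h y"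
    proof -
      have "(1 + \<tau>) * (1 - t) = 1" "(1 + \<tau>) * t = \<tau>"
        unfolding t(3) using \<tau> by (simp_all add: t_def)
      then show ?thesis by (simp add: distrib_left mult.assoc[symmetric])
    qed
    ultimately have "\<tau> * h y \<le> \<tau> * h y0 + (h y0 - h x0)"
      using x0(1)[OF x] by (simp add: algebra_simps)
    also have "h y0 - h x0 = \<tau> * (B * n)" using e(1) n by (simp add: \<tau>_def B_def)
    finally have "\<tau> * h y \<le> \<tau> * (h y0 + B * n)" by (simp add: algebra_simps)
    then have "h y \<le> h y0 + B * n" using \<tau> by simp
    also have "\<dots> \<le> h y0 + B * (norm y + norm y0 + 1)"
      using B norm_triangle_ineq4[of y y0] by (intro add_left_mono mult_left_mono) (auto simp: n_def)
    finally show ?thesis by (simp add: A_def algebra_simps)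
  qed
  have Y_lower: "(real k - A) / (B + 1) \<le> norm (Y k)" for k
  proof -
    have "norm (Y k) / real (Suc k) \<le> norm (Y k)" by (simp add: divide_le_eq mult_le_cancel_left1)
    then have "real k - A \<le> (B + 1) * norm (Y k)"
      using hY[of k] h_upper[OF qY(2), of k] by (simp add: algebra_simps)
    then show ?thesis using B by (simp add: divide_le_eq mult.commute)
  qed
  have "filterlim (\<lambda>k. (real k - A) / (B + 1)) at_top sequentially"
    using B by real_asymp
  then have Y_top: "filterlim (\<lambda>k. norm (Y k)) at_top sequentially"
    by (rule filterlim_at_top_mono) (simp add: Y_lower)
  have "compact (cball 0 1 :: (real ^ 'n) set)" by simp
  moreover have "\<forall>k. sgn (Y k) \<in> cball 0 1" by (simp add: norm_sgn)
  ultimately obtain d g where d: "strict_mono g" "((\<lambda>k. sgn (Y k)) \<circ> g) \<longlonglongrightarrow> d"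
    unfolding compact_def by (metis (no_types, lifting))
  define Z where "Z k = Y (g k)" for k
  have sgnZ: "(\<lambda>k. sgn (Z k)) \<longlonglongrightarrow> d" using d(2) by (simp add: Z_def o_def)
  have Z_top: "filterlim (\<lambda>k. norm (Z k)) at_top sequentially"
    unfolding Z_def using Y_top filterlim_subseq[OF d(1)] by (rule filterlim_compose)
  then have Z_large: "eventually (\<lambda>k. 1 \<le> norm (Z k)) sequentially"
    by (simp add: filterlim_at_top)
  have inv_lim: "(\<lambda>k. inverse (norm (Z k))) \<longlonglongrightarrow> 0"
    using Z_top by (rule tendsto_inverse_0_at_top)
  have hZ: "- norm (Z k) / real (Suc (g k)) \<le> h (Z k)" for k
    using hY[of "g k"] by (simp add: Z_def)
  have "norm d = 1"
  proof -
    have "eventually (\<lambda>k. norm (sgn (Z k)) = 1) sequentially"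
      using Z_large by eventually_elim (auto simp: norm_sgn)
    then have "(\<lambda>k. norm (sgn (Z k))) \<longlonglongrightarrow> 1" by (rule tendsto_eventually)
    with tendsto_norm[OF sgnZ] show ?thesis by (rule LIMSEQ_unique)
  qed
  then have "d \<noteq> 0" by auto
  \<comment> \<open>The coordinates of \<open>Z k\<close> are bounded above by
    \<open>ln (r $ i)\<close>, and division by \<open>norm (Z k)\<close> makes this bound tend to
    0.\<close>
  have d_le: "d $ i \<le> 0" for i
  proof -
    have "(\<lambda>k. sgn (Z k) $ i) \<longlonglongrightarrow> d $ i" using sgnZ by (rule tendsto_vec_nth)
    moreover have "(\<lambda>k. inverse (norm (Z k)) * ln (r $ i)) \<longlonglongrightarrow> 0"
      using tendsto_mult_right[OF inv_lim, of "ln (r $ i)"] by (simp add: mult.commute)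
    moreover have "sgn (Z k) $ i \<le> inverse (norm (Z k)) * ln (r $ i)" for k
    proof -
      have "Z k $ i \<le> ln (r $ i)" using qY(2)[of "g k"] by (simp add: log_domain_def Z_def less_imp_le)
      then show ?thesis by (simp add: sgn_div_norm divide_inverse_commute[symmetric] divide_right_mono)
    qed
    ultimately show ?thesis by (intro LIMSEQ_le) auto
  qed
  have "f (y + d) \<le> f y + p \<bullet> d" if y: "y \<in> log_domain r" for y
  proof -
    have yd: "y + d \<in> log_domain r"
    proof -
      have "(y + d) $ i < ln (r $ i)" for i
        using spec[OF y[unfolded log_domain_def mem_Collect_eq], of i] d_le[of i] by simp
      then show ?thesis by (simp add: log_domain_def)
    qed
    \<comment> \<open>Moving from \<open>y\<close> towards \<open>Z k\<close> by the fraction 1 /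
      norm (Z k) is a step that tends to \<open>d\<close>. Concavity and the bound -1 / (g k + 1)
      for \<open>\<kappa> k * h (Z k)\<close> from below yield h (y + d) \<ge> h y in the
      limit.\<close>
    define \<kappa> where "\<kappa> k = inverse (norm (Z k))" for k
    define x where "x k = (1 - \<kappa> k) *\<^sub>R y + \<kappa> k *\<^sub>R Z k" for k
    have \<kappa>0: "\<kappa> \<longlonglongrightarrow> 0" using inv_lim by (simp add: \<kappa>_def[abs_def])
    have "x \<longlonglongrightarrow> (1 - 0) *\<^sub>R y + d"
      unfolding x_def using sgnZ
      by (intro tendsto_intros \<kappa>0) (simp add: \<kappa>_def sgn_div_norm)
    then have "x \<longlonglongrightarrow> y + d" by simp
    moreover have "isCont h (y + d)"
      using h_cont yd by (simp add: continuous_on_eq_continuous_at[OF open_log_domain])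
    ultimately have "(\<lambda>k. h (x k)) \<longlonglongrightarrow> h (y + d)" by (rule isCont_tendsto_compose[rotated])
    moreover have "(\<lambda>k. (1 - \<kappa> k) * h y - inverse (real (Suc (g k)))) \<longlonglongrightarrow> (1 - 0) * h y - 0"
      using LIMSEQ_subseq_LIMSEQ[OF LIMSEQ_inverse_real_of_nat d(1)]
      by (intro tendsto_intros \<kappa>0) (simp add: o_def)
    moreover have "eventually (\<lambda>k. (1 - \<kappa> k) * h y - inverse (real (Suc (g k))) \<le> h (x k)) sequentially"
      using Z_large
    proof eventually_elim
      case (elim k)
      then have \<kappa>: "0 \<le> \<kappa> k" "\<kappa> k \<le> 1" by (auto simp: \<kappa>_def inverse_le_1_iff)
      have "- inverse (real (Suc (g k))) = \<kappa> k * (- norm (Z k) / real (Suc (g k)))"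
        using elim by (auto simp: \<kappa>_def field_simps)
      also have "\<dots> \<le> \<kappa> k * h (Z k)" using \<kappa>(1) hZ by (intro mult_left_mono)
      finally show ?case
        using h_concave[OF \<kappa> y, of "Z k"] qY(2) by (simp add: x_def Z_def)
    qed
    ultimately have "(1 - 0) * h y - 0 \<le> h (y + d)"
      by (intro tendsto_le[OF sequentially_bot])
    then show ?thesis by (simp add: h_def inner_add_right)
  qed
  with \<open>d \<noteq> 0\<close> d_le show ?thesis by blast
qed


text \<open>Interiority leaves room for the slope \<mu> obtained by lowering all coordinates of
  \<alpha> + 1 by \<open>e\<close>. The affine minorant of f with this slope bounds the weight by a
  multiple of the product of the |z_i|^(2e - 2), which is integrable as e > 0.\<close>

lemma weight_integral_finite_of_interior:
  fixes r :: "real ^ 'n" and \<alpha> :: "nat ^ 'n"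
  assumes r: "\<And>i. 0 < r $ i" and psh: "psh_on (polydisk r) \<phi>" and toric: "toric_on (polydisk r) \<phi>"
    and p: "(\<chi> i. real (\<alpha> $ i) + 1) \<in> interior (newton_body r \<phi>)"
    and s: "\<And>i. 0 < s $ i" "\<And>i. s $ i < r $ i"
  shows "(\<integral>\<^sup>+ z. weight_on \<phi> s (\<lambda>z. \<Prod>i\<in>UNIV. z $ i ^ (\<alpha> $ i)) z \<partial>lborel) < \<infinity>"
proof -
  define p where "p = (\<chi> i. real (\<alpha> $ i) + 1)"
  obtain e0 where e0: "0 < e0" "ball p e0 \<subseteq> newton_body r \<phi>"
    using p unfolding mem_interior p_def by blast
  define n where "n = real CARD('n)"
  have n: "1 \<le> n" unfolding n_def by (simp add: Suc_leI)
  \<comment> \<open>The second bound gives norm (p - \<mu>) \<le> n e < e0 through the l1 norm; the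
    first one ensures e < 1, as the power weight lemma requires.\<close>
  define e where "e = min (1/2) (e0 / (2 * n))"
  have e: "0 < e" "e < 1" using e0(1) n by (auto simp: e_def)
  define \<mu> where "\<mu> = (\<chi> i. real (\<alpha> $ i) + 1 - e)"
  have "norm (p - \<mu>) \<le> (\<Sum>i\<in>UNIV. \<bar>(p - \<mu>) $ i\<bar>)" by (rule norm_le_l1_cart)
  also have "\<dots> = n * e" using e by (simp add: p_def \<mu>_def n_def)
  also have "\<dots> \<le> n * (e0 / (2 * n))" using n by (intro mult_left_mono) (auto simp: e_def)
  also have "\<dots> < e0" using n e0(1) by simp
  finally have "\<mu> \<in> newton_body r \<phi>" using e0(2) by (auto simp: dist_norm subset_iff)
  then obtain C where C: "\<And>y. y \<in> log_domain r \<Longrightarrow> ereal (\<mu> \<bullet> y - C) \<le> log_profile \<phi> y"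
    unfolding newton_body_iff by blast
  let ?w = "\<lambda>z. ennreal (\<Prod>i\<in>UNIV. cmod (z $ i) powr (2 * e - 2)) * indicator (cpolydisk s) z"
  have "weight_on \<phi> s (\<lambda>z. \<Prod>i\<in>UNIV. z $ i ^ (\<alpha> $ i)) z \<le> ennreal (exp (2 * C)) * ?w z"
    if nz: "\<forall>i. z $ i \<noteq> 0" for z
  proof (cases "z \<in> cpolydisk s")
    case True
    then have z: "z \<in> polydisk r" using cpolydisk_subset[of s r] s(2) by blast
    define y where "y = (\<chi> i. ln (cmod (z $ i)))"
    have "\<phi> z = log_profile \<phi> y" "y \<in> log_domain r"
      using toric_eq_log_profile[OF r psh toric z] log_in_domain[OF r psh toric z] nz by (auto simp: y_def)
    then have "ereal_exp (- 2 * \<phi> z) \<le> ennreal (exp (- 2 * (\<mu> \<bullet> y - C)))"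
      using C by (simp only: ereal_exp_minus2_le)
    then have "ennreal ((cmod (\<Prod>i\<in>UNIV. z $ i ^ (\<alpha> $ i)))\<^sup>2) * ereal_exp (- 2 * \<phi> z)
      \<le> ennreal ((cmod (\<Prod>i\<in>UNIV. z $ i ^ (\<alpha> $ i)))\<^sup>2) * ennreal (exp (- 2 * (\<mu> \<bullet> y - C)))"
      by (intro mult_left_mono) auto
    also have "\<dots> = ennreal ((cmod (\<Prod>i\<in>UNIV. z $ i ^ (\<alpha> $ i)))\<^sup>2 * exp (- 2 * (\<mu> \<bullet> y - C)))"
      by (simp add: ennreal_mult)
    also have "(cmod (\<Prod>i\<in>UNIV. z $ i ^ (\<alpha> $ i)))\<^sup>2 * exp (- 2 * (\<mu> \<bullet> y - C))
      = exp (2 * C) * (\<Prod>i\<in>UNIV. cmod (z $ i) powr (2 * e - 2))"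
    proof -
      have "cmod (z $ i) ^ (\<alpha> $ i) = exp (\<alpha> $ i * ln (cmod (z $ i)))" for i
        using nz by (simp add: exp_of_nat_mult)
      then have "cmod (\<Prod>i\<in>UNIV. z $ i ^ (\<alpha> $ i)) = exp (\<Sum>i\<in>UNIV. \<alpha> $ i * ln (cmod (z $ i)))"
        by (simp add: prod_norm[symmetric] norm_power exp_sum)
      then have "(cmod (\<Prod>i\<in>UNIV. z $ i ^ (\<alpha> $ i)))\<^sup>2 * exp (- 2 * (\<mu> \<bullet> y - C))
        = exp (2 * (\<Sum>i\<in>UNIV. \<alpha> $ i * ln (cmod (z $ i))) - 2 * (\<mu> \<bullet> y - C))"
        by (simp add: exp_double[symmetric] mult_exp_exp)
      also have "2 * (\<Sum>i\<in>UNIV. \<alpha> $ i * ln (cmod (z $ i))) - 2 * (\<mu> \<bullet> y - C)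
        = 2 * C + (\<Sum>i\<in>UNIV. (2 * e - 2) * ln (cmod (z $ i)))"
        by (simp add: inner_vec_def \<mu>_def y_def algebra_simps sum.distrib sum_subtractf sum_distrib_left)
      also have "exp \<dots> = exp (2 * C) * (\<Prod>i\<in>UNIV. cmod (z $ i) powr (2 * e - 2))"
        using nz by (simp add: exp_add exp_sum powr_def)
      finally show ?thesis .
    qed
    finally show ?thesis using True by (simp add: weight_on_def ennreal_mult prod_nonneg)
  qed (simp add: weight_on_def)
  then have "(\<integral>\<^sup>+ z. weight_on \<phi> s (\<lambda>z. \<Prod>i\<in>UNIV. z $ i ^ (\<alpha> $ i)) z \<partial>lborel)
    \<le> (\<integral>\<^sup>+ z. ennreal (exp (2 * C)) * ?w z \<partial>lborel)"
    using AE_coordinates_nonzero by (intro nn_integral_mono_AE) auto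
  also have "\<dots> = ennreal (exp (2 * C)) * (\<integral>\<^sup>+ z. ?w z \<partial>lborel)"
  proof (rule nn_integral_cmult)
    have [measurable]: "(\<lambda>z :: complex ^ 'n. z $ i) \<in> borel_measurable borel" for i
      by (intro borel_measurable_continuous_onI continuous_intros)
    show "?w \<in> borel_measurable lborel" by measurable
  qed
  also have "\<dots> < \<infinity>"
    using nn_integral_power_weight_finite[OF s(1) e] by (simp add: ennreal_mult_less_top)
  finally show ?thesis .
qed

text \<open>Finiteness permits subtraction: if the scaled polydisk \<open>K'\<close> carries the
  whole integral over \<open>K\<close>, the weight vanishes almost everywhere on
  \<open>K - K'\<close>. But it is positive off the coordinate hyperplanes, and
  \<open>K - K'\<close> contains a nonempty open set.\<close>

lemma interior_of_weight_integral_finite: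
  fixes r :: "real ^ 'n" and \<alpha> :: "nat ^ 'n"
  assumes r: "\<And>i. 0 < r $ i" and psh: "psh_on (polydisk r) \<phi>" and toric: "toric_on (polydisk r) \<phi>"
    and s: "\<And>i. 0 < s $ i" "\<And>i. s $ i < r $ i"
    and fin: "(\<integral>\<^sup>+ z. weight_on \<phi> s (\<lambda>z. \<Prod>i\<in>UNIV. z $ i ^ (\<alpha> $ i)) z \<partial>lborel) < \<infinity>"
  shows "(\<chi> i. real (\<alpha> $ i) + 1) \<in> interior (newton_body r \<phi>)"
proof (rule ccontr)
  define p where "p = (\<chi> i. real (\<alpha> $ i) + 1)"
  define F where "F z = (\<Prod>i\<in>UNIV. z $ i ^ (\<alpha> $ i))" for z :: "complex ^ 'n"
  define \<Phi> where "\<Phi> = weight_on \<phi> s F"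
  have sub: "cpolydisk s \<subseteq> polydisk r" using s(2) by (rule cpolydisk_subset)
  have [measurable]: "\<Phi> \<in> borel_measurable borel"
    unfolding \<Phi>_def using psh sub
    by (intro weight_on_measurable) (auto simp: F_def intro!: continuous_intros)
  have fin': "(\<integral>\<^sup>+ z. \<Phi> z \<partial>lborel) < \<infinity>" using fin by (simp add: \<Phi>_def F_def[abs_def])
  have F_pos: "0 < (cmod (F z))\<^sup>2" if "\<forall>i. z $ i \<noteq> 0" for z
    using that by (simp add: F_def)
  have \<Phi>_pos: "0 < \<Phi> z" if "z \<in> cpolydisk s" "\<forall>i. z $ i \<noteq> 0" for z
  proof -
    have "\<phi> z < \<infinity>" using that(1) sub psh by (auto simp: psh_on_def)
    then show ?thesis
      using that F_pos[OF that(2)] ereal_exp_minus2_pos[of "\<phi> z"]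
      by (simp add: \<Phi>_def weight_on_def ennreal_zero_less_mult_iff)
  qed
  have psub: "polydisk s \<subseteq> cpolydisk s"
    by (auto simp: polydisk_def cpolydisk_def less_imp_le)
  have open_null: False if U: "open U" "U \<subseteq> cpolydisk s" "U \<noteq> {}" and "AE z in lborel. z \<notin> U" for U
  proof -
    have "U \<in> null_sets lborel"
      using that(4) U(1) by (subst AE_iff_null_sets) auto
    then have "negligible U" by (simp add: negligible_iff_null_sets null_sets_completionI)
    then show False using U(1,3) open_not_negligible by blast
  qed
  assume "\<not> ?thesis"
  then have p: "p \<notin> interior (newton_body r \<phi>)" by (simp add: p_def)
  show False
  proof (cases "\<exists>y\<in>log_domain r. log_profile \<phi> y = - \<infinity>")
    case True
    \<comment> \<open>By convexity f is then -\<infinity> throughout, so the weight is infinite off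
      the coordinate hyperplanes.\<close>
    then have MInf: "log_profile \<phi> y = - \<infinity>" if "y \<in> log_domain r" for y
      using log_profile_eq_MInf[OF r psh toric] that by blast
    have inf: "\<Phi> z = \<infinity>" if z: "z \<in> cpolydisk s" "\<forall>i. z $ i \<noteq> 0" for z
    proof -
      have "z \<in> polydisk r" using z(1) sub by blast
      then have "\<phi> z = - \<infinity>"
        using toric_eq_log_profile[OF r psh toric] log_in_domain[OF r psh toric] z(2) MInf by simp
      then show ?thesis
        using F_pos[OF z(2)] z(1) ereal_exp_minus2_MInf
        by (simp add: \<Phi>_def weight_on_def ennreal_mult_eq_top_iff)
    qed
    have "AE z in lborel. \<Phi> z \<noteq> \<infinity>"
      using fin' by (intro nn_integral_PInf_AE) auto
    with AE_coordinates_nonzero have "AE z in lborel. z \<notin> polydisk s"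
      by eventually_elim (use inf psub in blast)
    moreover have "0 \<in> polydisk s" using s(1) by (simp add: polydisk_def)
    ultimately show False
      using psub by (intro open_null[OF open_polydisk]) auto
  next
    case False
    define f where "f y = real_of_ereal (log_profile \<phi> y)" for y
    have f: "log_profile \<phi> y = ereal (f y)" if "y \<in> log_domain r" for y
      using False that log_profile_less_PInf[OF r psh toric that]
      unfolding f_def by (cases "log_profile \<phi> y") auto
    have "newton_body r \<phi> = {\<mu>. \<exists>C. \<forall>y\<in>log_domain r. \<mu> \<bullet> y - C \<le> f y}"
      by (simp add: set_eq_iff newton_body_iff f)
    moreover have "convex_on (log_domain r) f"
      unfolding f_def using False by (intro log_profile_convex_on[OF r psh toric]) auto
    ultimately obtain d where d: "d \<noteq> 0" "\<And>i. d $ i \<le> 0"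
        "\<And>y. y \<in> log_domain r \<Longrightarrow> f (y + d) \<le> f y + p \<bullet> d"
      using convex_recession_direction[of r f p] p by metis
    define c where "c i = exp (d $ i)" for i
    have c: "0 < c i" "c i \<le> 1" for i using d(2)[of i] by (auto simp: c_def)
    define S where "S z = (\<chi> i. c i *\<^sub>R z $ i)" for z :: "complex ^ 'n"
    have S_norm: "cmod (S z $ i) = c i * cmod (z $ i)" for z i
      using c(1)[of i] by (simp add: S_def)
    define K where "K = cpolydisk s"
    define K' where "K' = cpolydisk (\<chi> i. c i * s $ i)"
    have [measurable]: "K \<in> sets borel" "K' \<in> sets borel" by (auto simp: K_def K'_def)
    have S_K': "S z \<in> K' \<longleftrightarrow> z \<in> K" for z
      using c(1) by (simp add: K_def K'_def cpolydisk_def S_norm)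
    have "K' \<subseteq> K"
    proof
      fix z assume z: "z \<in> K'"
      have "c i * s $ i \<le> s $ i" for i using c(2)[of i] s(1)[of i] by (simp add: mult_left_le_one_le less_imp_le c(1))
      then show "z \<in> K" using z unfolding K_def K'_def cpolydisk_def by (auto intro: order_trans)
    qed
    have grow: "\<Phi> z \<le> ennreal (\<Prod>i\<in>UNIV. (c i)\<^sup>2) * (\<Phi> (S z) * indicator K' (S z))"
      if nz: "\<forall>i. z $ i \<noteq> 0" for z
    proof (cases "z \<in> K")
      case True
      then have Sz: "S z \<in> K'" "S z \<in> K" using S_K' \<open>K' \<subseteq> K\<close> by auto
      have zX: "z \<in> polydisk r" "S z \<in> polydisk r" using True Sz sub by (auto simp: K_def)
      have nzS: "\<forall>i. S z $ i \<noteq> 0" using nz by (simp add: S_def c_def)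
      define y where "y = (\<chi> i. ln (cmod (z $ i)))"
      have ySz: "(\<chi> i. ln (cmod (S z $ i))) = y + d"
        using nz c(1) by (simp add: S_norm vec_eq_iff y_def ln_mult c_def)
      have y: "y \<in> log_domain r"
        using log_in_domain[OF r psh toric zX(1)] nz by (simp add: y_def)
      have yd: "y + d \<in> log_domain r"
        using log_in_domain[OF r psh toric zX(2)] nzS unfolding ySz by blast
      have \<phi>z: "\<phi> z = ereal (f y)"
        using toric_eq_log_profile[OF r psh toric zX(1)] nz f[OF y] by (simp add: y_def)
      have \<phi>Sz: "\<phi> (S z) = ereal (f (y + d))"
        using toric_eq_log_profile[OF r psh toric zX(2)] nzS f[OF yd] unfolding ySz by simp
      note \<phi> = \<phi>z \<phi>Sz
      \<comment> \<open>Each coordinate contributes c_i^(2 \<alpha>_i) = exp (2 (\<alpha>_i + 1)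
        d_i) / c_i^2. The division cancels the Jacobian of \<open>S\<close>, which is how \<alpha> +
        1 arises.\<close>
      have FS: "(cmod (F (S z)))\<^sup>2 = exp (2 * (p \<bullet> d)) / (\<Prod>i\<in>UNIV. (c i)\<^sup>2) * (cmod (F z))\<^sup>2"
      proof -
        have "cmod (F (S z)) = (\<Prod>i\<in>UNIV. c i ^ (\<alpha> $ i)) * cmod (F z)"
          by (simp add: F_def prod_norm[symmetric] norm_power S_norm power_mult_distrib prod.distrib)
        moreover have "exp (2 * (p \<bullet> d)) = (\<Prod>i\<in>UNIV. c i ^ (\<alpha> $ i))\<^sup>2 * (\<Prod>i\<in>UNIV. (c i)\<^sup>2)"
        proof -
          have "exp (p \<bullet> d) = (\<Prod>i\<in>UNIV. c i ^ (\<alpha> $ i) * c i)"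
            by (simp add: inner_vec_def exp_sum p_def c_def algebra_simps exp_add exp_of_nat_mult[symmetric])
          then show ?thesis by (simp add: exp_double prod.distrib power_mult_distrib prod_power_distrib)
        qed
        moreover have "(\<Prod>i\<in>UNIV. (c i)\<^sup>2) \<noteq> 0" by (simp add: c_def)
        ultimately show ?thesis by (simp add: power_mult_distrib)
      qed
      have P: "0 < (\<Prod>i\<in>UNIV. (c i)\<^sup>2)" by (intro prod_pos) (simp add: c_def)
      have "\<Phi> z = ennreal ((cmod (F z))\<^sup>2 * exp (- 2 * f y))"
        using True by (simp add: \<Phi>_def weight_on_def K_def \<phi> ennreal_mult)
      also have "\<dots> \<le> ennreal ((\<Prod>i\<in>UNIV. (c i)\<^sup>2) * ((cmod (F (S z)))\<^sup>2 * exp (- 2 * f (y + d))))"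
      proof (rule ennreal_leI)
        have "exp (- 2 * f y) \<le> exp (2 * (p \<bullet> d) + (- 2 * f (y + d)))"
          using d(3)[OF y] by simp
        then have "(cmod (F z))\<^sup>2 * exp (- 2 * f y) \<le> (cmod (F z))\<^sup>2 * (exp (2 * (p \<bullet> d)) * exp (- 2 * f (y + d)))"
          unfolding exp_add by (intro mult_left_mono) auto
        also have "\<dots> = (\<Prod>i\<in>UNIV. (c i)\<^sup>2) * ((cmod (F (S z)))\<^sup>2 * exp (- 2 * f (y + d)))"
          unfolding FS by (simp add: c_def)
        finally show "(cmod (F z))\<^sup>2 * exp (- 2 * f y) \<le> (\<Prod>i\<in>UNIV. (c i)\<^sup>2) * ((cmod (F (S z)))\<^sup>2 * exp (- 2 * f (y + d)))" .
      qed
      also have "\<dots> = ennreal (\<Prod>i\<in>UNIV. (c i)\<^sup>2) * (\<Phi> (S z) * indicator K' (S z))"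
        using Sz P by (simp add: \<Phi>_def weight_on_def K_def \<phi> ennreal_mult)
      finally show ?thesis .
    qed (simp add: \<Phi>_def weight_on_def K_def)
    have S_meas [measurable]: "S \<in> borel_measurable borel"
      unfolding S_def by (intro borel_measurable_continuous_onI continuous_intros)
    have "(\<integral>\<^sup>+ z. \<Phi> z \<partial>lborel) \<le> (\<integral>\<^sup>+ z. ennreal (\<Prod>i\<in>UNIV. (c i)\<^sup>2) * (\<Phi> (S z) * indicator K' (S z)) \<partial>lborel)"
      using AE_coordinates_nonzero grow by (intro nn_integral_mono_AE) auto
    also have "\<dots> = ennreal (\<Prod>i\<in>UNIV. (c i)\<^sup>2) * (\<integral>\<^sup>+ z. \<Phi> (S z) * indicator K' (S z) \<partial>lborel)"
      by (intro nn_integral_cmult) measurable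
    also have "\<dots> = (\<integral>\<^sup>+ z. \<Phi> z * indicator K' z \<partial>lborel)"
      unfolding S_def using c(1) by (intro nn_integral_scale_coordinates[symmetric]) measurable
    finally have le: "(\<integral>\<^sup>+ z. \<Phi> z \<partial>lborel) \<le> (\<integral>\<^sup>+ z. \<Phi> z * indicator K' z \<partial>lborel)" .
    have "(\<integral>\<^sup>+ z. \<Phi> z \<partial>lborel) = (\<integral>\<^sup>+ z. \<Phi> z * indicator K' z + \<Phi> z * indicator (- K') z \<partial>lborel)"
      by (intro nn_integral_cong) (auto simp: indicator_def)
    also have "\<dots> = (\<integral>\<^sup>+ z. \<Phi> z * indicator K' z \<partial>lborel) + (\<integral>\<^sup>+ z. \<Phi> z * indicator (- K') z \<partial>lborel)"
      by (intro nn_integral_add) auto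
    finally have split: "(\<integral>\<^sup>+ z. \<Phi> z \<partial>lborel) = (\<integral>\<^sup>+ z. \<Phi> z * indicator K' z \<partial>lborel) + (\<integral>\<^sup>+ z. \<Phi> z * indicator (- K') z \<partial>lborel)" .
    have "(\<integral>\<^sup>+ z. \<Phi> z * indicator (- K') z \<partial>lborel) = 0"
    proof -
      define a where "a = (\<integral>\<^sup>+ z. \<Phi> z * indicator K' z \<partial>lborel)"
      define b where "b = (\<integral>\<^sup>+ z. \<Phi> z * indicator (- K') z \<partial>lborel)"
      have "a + b \<le> a" "a + b < \<infinity>" using le split fin' by (auto simp: a_def b_def)
      then have "b = 0" by (cases a; cases b) (auto simp: ennreal_plus[symmetric] simp del: ennreal_plus)
      then show ?thesis by (simp add: b_def)
    qed
    then have "AE z in lborel. \<Phi> z * indicator (- K') z = 0"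
      by (subst (asm) nn_integral_0_iff_AE) auto
    then have AE: "AE z in lborel. z \<notin> K - K'"
      using AE_coordinates_nonzero
      by eventually_elim (use \<Phi>_pos in \<open>auto simp: K_def indicator_def less_le\<close>)
    \<comment> \<open>In this coordinate \<open>K'\<close> is strictly smaller than
      \<open>K\<close>, which makes \<open>U\<close> nonempty.\<close>
    obtain j where j: "d $ j < 0" using d(1,2) by (metis less_le vec_eq_iff zero_index)
    define U where "U = polydisk s \<inter> {z. c j * s $ j < cmod (z $ j)}"
    have "U \<subseteq> K - K'"
    proof
      fix z assume z: "z \<in> U"
      then have "z \<in> K" using psub by (auto simp: U_def K_def)
      moreover have "\<not> cmod (z $ j) \<le> c j * s $ j" using z by (simp add: U_def)
      then have "z \<notin> K'" unfolding K'_def cpolydisk_def by auto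
      ultimately show "z \<in> K - K'" by blast
    qed
    show False
    proof (rule open_null)
      show "open U" unfolding U_def
        by (intro open_Int open_polydisk open_Collect_less continuous_intros)
      show "U \<subseteq> cpolydisk s" using \<open>U \<subseteq> K - K'\<close> by (auto simp: K_def)
      show "AE z in lborel. z \<notin> U" using AE by eventually_elim (use \<open>U \<subseteq> K - K'\<close> in auto)
      have "c j * s $ j < s $ j" using j s(1)[of j] by (simp add: c_def)
      then obtain a where a: "c j * s $ j < a" "a < s $ j" using dense by blast
      have "0 < a" using a(1) c(1)[of j] s(1)[of j] by (meson less_trans mult_pos_pos)
      then have "(\<chi> i. if i = j then of_real a else 0) \<in> U"
        using a s(1) by (simp add: U_def polydisk_def)
      then show "U \<noteq> {}" by blast
    qed
  qed
qed

section \<open>Averaging over rotations\<close>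

lemma monotone_coordinates_subseq:
  fixes a :: "nat \<Rightarrow> nat ^ 'n"
  shows "\<exists>g. strict_mono g \<and> (\<forall>i. monoseq (\<lambda>k. a (g k) $ i))"
proof -
  have "\<exists>g. strict_mono g \<and> (\<forall>i\<in>S. monoseq (\<lambda>k. a (g k) $ i))" for S :: "'n set"
    using finite[of S]
  proof (induction S rule: finite_induct)
    case empty
    show ?case by (intro exI[of _ id]) (simp add: strict_mono_def)
  next
    case (insert j S)
    then obtain g where g: "strict_mono g" "\<forall>i\<in>S. monoseq (\<lambda>k. a (g k) $ i)" by blast
    obtain g' where g': "strict_mono g'" "monoseq (\<lambda>k. a (g (g' k)) $ j)"
      using seq_monosub[of "\<lambda>k. a (g k) $ j"] by auto
    have "monoseq (\<lambda>k. a (g (g' k)) $ i)" if "i \<in> S" for i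
      using g(2) that strict_mono_less_eq[OF g'(1)] unfolding monoseq_def by blast
    then show ?case
      using g'(2) strict_mono_o[OF g(1) g'(1)] by (intro exI[of _ "\<lambda>k. g (g' k)"]) (auto simp: o_def)
  qed
  from this[of UNIV] show ?thesis by simp
qed

text \<open>A non-increasing sequence of naturals is constant once it attains its minimum, so
  monotone sequences of either kind are non-decreasing from some index on.\<close>

lemma monoseq_nat_eventually_ge:
  fixes b :: "nat \<Rightarrow> nat"
  assumes "monoseq b"
  shows "\<exists>k0. \<forall>k\<ge>k0. \<forall>l\<ge>k. b k \<le> b l"
proof -
  consider "\<forall>m n. m \<le> n \<longrightarrow> b m \<le> b n" | "\<forall>m n. m \<le> n \<longrightarrow> b n \<le> b m"
    using assms unfolding monoseq_def by blast
  then show ?thesis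
  proof cases
    case 2
    obtain k0 where k0: "\<And>k. b k0 \<le> b k"
      using ex_has_least_nat[of "\<lambda>_. True" 0 b] by auto
    have "b k = b k0" if "k0 \<le> k" for k
      using 2 that k0[of k] by (simp add: le_antisym)
    then show ?thesis by (metis le_trans order_refl)
  qed blast
qed

text \<open>A form of Dickson's lemma.\<close>

lemma upward_closed_truncation:
  fixes A :: "(nat ^ 'n) set"
  assumes up: "\<And>\<alpha> \<beta>. \<alpha> \<in> A \<Longrightarrow> (\<And>i. \<alpha> $ i \<le> \<beta> $ i) \<Longrightarrow> \<beta> \<in> A"
  shows "\<exists>m. \<forall>\<alpha>\<in>A. (\<chi> i. min (\<alpha> $ i) m) \<in> A"
proof (rule ccontr)
  assume "\<not> ?thesis"
  then have "\<forall>m. \<exists>\<alpha>. \<alpha> \<in> A \<and> (\<chi> i. min (\<alpha> $ i) m) \<notin> A" by blast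
  then obtain a where a: "\<And>m. a m \<in> A" "\<And>m. (\<chi> i. min (a m $ i) m) \<notin> A" by metis
  obtain g where g: "strict_mono g" "\<And>i. monoseq (\<lambda>k. a (g k) $ i)"
    using monotone_coordinates_subseq[of a] by blast
  have "\<exists>k0. \<forall>k\<ge>k0. \<forall>l\<ge>k. a (g k) $ i \<le> a (g l) $ i" for i
    using monoseq_nat_eventually_ge[OF g(2)] .
  then obtain k0 where k0: "\<And>i k l. k0 i \<le> k \<Longrightarrow> k \<le> l \<Longrightarrow> a (g k) $ i \<le> a (g l) $ i" by metis
  \<comment> \<open>From \<open>k\<close> on, all coordinates along the subsequence are
    non-decreasing, and \<open>l\<close> is so late that \<open>g l\<close> also dominates the
    coordinates of \<open>a (g k)\<close>. Truncating \<open>a (g l)\<close> at \<open>g l\<close>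
    then stays above \<open>a (g k)\<close>, hence in \<open>A\<close>.\<close>
  define k where "k = Max (range k0)"
  define l where "l = max k (Max (range (\<lambda>i. a (g k) $ i)))"
  have k: "k0 i \<le> k" for i unfolding k_def by (intro Max_ge) auto
  have kl: "k \<le> l" by (simp add: l_def)
  have "a (g k) $ i \<le> g l" for i
  proof -
    have "a (g k) $ i \<le> Max (range (\<lambda>i. a (g k) $ i))" by (intro Max_ge) auto
    also have "\<dots> \<le> l" by (simp add: l_def)
    also have "\<dots> \<le> g l" using g(1) by (rule strict_mono_imp_increasing)
    finally show ?thesis .
  qed
  then have "(\<chi> i. min (a (g l) $ i) (g l)) \<in> A"
    using k0[OF k kl] by (intro up[OF a(1)[of "g k"]]) simp
  with a(2) show False by blast
qed

section \<open>Monomials and the averaging inequality\<close>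

definition monomial :: "nat ^ 'n \<Rightarrow> complex ^ 'n \<Rightarrow> complex" where
  "monomial \<alpha> z = (\<Prod>i\<in>UNIV. z $ i ^ (\<alpha> $ i))"

lemma monomial_fun_eq: "monomial_fun X \<alpha> = restrict (monomial \<alpha>) X"
  by (simp add: monomial_fun_def monomial_def fun_eq_iff restrict_def)

lemma sep_holomorphic_monomial: "sep_holomorphic r (monomial \<alpha>)"
  unfolding monomial_def
  by (intro sep_holomorphic_prod sep_holomorphic_power sep_holomorphic_coord)

lemma monomial_add: "monomial (\<alpha> + \<beta>) z = monomial \<alpha> z * monomial \<beta> z"
  by (simp add: monomial_def power_add prod.distrib)

lemma monomial_zero [simp]: "monomial 0 z = 1"
  by (simp add: monomial_def)

lemma monomial_axis: "monomial (axis j k) z = z $ j ^ k"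
proof -
  have "monomial (axis j k) z = (\<Prod>i\<in>UNIV. if i = j then z $ j ^ k else 1)"
    unfolding monomial_def by (intro prod.cong) (auto simp: axis_def)
  then show ?thesis by simp
qed

lemma monomial_upd_coord_mult:
  "monomial \<beta> (upd_coord z j (c * z $ j)) = c ^ (\<beta> $ j) * monomial \<beta> z"
proof -
  have "monomial \<beta> (upd_coord z j (c * z $ j))
    = (\<Prod>i\<in>UNIV. (if i = j then c ^ (\<beta> $ j) else 1) * z $ i ^ (\<beta> $ i))"
    unfolding monomial_def by (intro prod.cong) (auto simp: power_mult_distrib)
  then show ?thesis by (simp add: prod.distrib monomial_def)
qed

text \<open>The weight \<open>W\<close> may be \<infinity>, where multiplication by 0 is
  discontinuous; but if \<open>ennreal a\<close> is 0, so is the left side.\<close>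

lemma Liminf_ennreal_mult_le:
  fixes b :: "nat \<Rightarrow> real" and W :: ennreal
  assumes "b \<longlonglongrightarrow> a"
  shows "ennreal a * W \<le> liminf (\<lambda>n. ennreal (b n) * W)"
proof (cases "ennreal a = 0")
  case False
  have "(\<lambda>n. ennreal (b n) * W) \<longlonglongrightarrow> ennreal a * W"
    using False assms by (intro tendsto_mult_ennreal tendsto_ennrealI tendsto_const) auto
  then show ?thesis by (simp add: lim_imp_Liminf)
qed simp

lemma orthogonal_transformation_rotate_coord:
  assumes "cmod c = 1"
  shows "orthogonal_transformation (\<lambda>z :: complex ^ 'n. upd_coord z j (c * z $ j))"
  unfolding orthogonal_transformation
proof (intro conjI allI)
  have "upd_coord z j (c * z $ j) = (\<chi> i. (if i = j then c else 1) * z $ i)" for z :: "complex ^ 'n"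
    by (simp add: vec_eq_iff)
  then show "linear (\<lambda>z :: complex ^ 'n. upd_coord z j (c * z $ j))"
    by (auto intro!: linearI simp: vec_eq_iff algebra_simps)
  fix z :: "complex ^ 'n"
  show "norm (upd_coord z j (c * z $ j)) = norm z"
    unfolding norm_vec_def using assms by (intro L2_set_cong) (auto simp: norm_mult)
qed

text \<open>The mean of \<open>z\<^sup>\<beta> G\<close> over the rotations of the coordinate \<open>z\<^sub>j\<close> by roots of unity, twisted by
  \<open>\<omega>\<^sup>-\<^sup>\<beta>\<^sup>j\<close>, has at most the weighted norm of \<open>z\<^sup>\<beta> G\<close>, and it converges to
  the restriction of \<open>G\<close> to \<open>z\<^sub>j = 0\<close> times \<open>z\<^sup>\<beta>\<close>; now apply Fatou's lemma.\<close>

lemma weight_integral_upd_zero_le: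
  fixes r :: "real ^ 'n"
  assumes psh: "psh_on (polydisk r) \<phi>" and toric: "toric_on (polydisk r) \<phi>"
    and s: "\<And>i. s $ i < r $ i" and G: "sep_holomorphic r G"
  shows "(\<integral>\<^sup>+ z. weight_on \<phi> s (\<lambda>z. monomial \<beta> z * G (upd_coord z j 0)) z \<partial>lborel)
    \<le> (\<integral>\<^sup>+ z. weight_on \<phi> s (\<lambda>z. monomial \<beta> z * G z) z \<partial>lborel)"
proof -
  define H where "H z = monomial \<beta> z * G z" for z
  define \<omega> where "\<omega> N l = cis (2 * pi * real l / real N)" for N l :: nat
  define R where "R N l z = upd_coord z j (\<omega> N l * z $ j)" for N l and z :: "complex ^ 'n"
  have sub: "cpolydisk s \<subseteq> polydisk r" using s by (rule cpolydisk_subset)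
  have \<omega>: "cmod (\<omega> N l) = 1" for N l by (simp add: \<omega>_def)
  have \<omega>0: "\<omega> N l \<noteq> 0" for N l using \<omega>[of N l] by auto
  have R_K: "R N l z \<in> cpolydisk s \<longleftrightarrow> z \<in> cpolydisk s" for N l z
    by (auto simp: R_def cpolydisk_def norm_mult \<omega>)
  have R_\<phi>: "\<phi> (R N l z) = \<phi> z" if "z \<in> polydisk r" for N l z
  proof -
    have "R N l z = (\<chi> i. cis ((\<chi> i. if i = j then 2 * pi * real l / real N else 0) $ i) * z $ i)"
      by (simp add: vec_eq_iff R_def \<omega>_def)
    then show ?thesis using toric that unfolding toric_on_def by metis
  qed
  have H_cont: "continuous_on (polydisk r) H"
    unfolding H_def using sep_holomorphic_mult[OF sep_holomorphic_monomial G] by (simp add: sep_holomorphic_def)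
  have H_meas [measurable]: "weight_on \<phi> s H \<in> borel_measurable borel"
    by (rule weight_on_measurable[OF psh H_cont sub])
  have R_int: "(\<integral>\<^sup>+ z. weight_on \<phi> s H (R N l z) \<partial>lborel) = (\<integral>\<^sup>+ z. weight_on \<phi> s H z \<partial>lborel)" for N l
    unfolding R_def
    by (rule nn_integral_orthogonal_transformation[OF orthogonal_transformation_rotate_coord[OF \<omega>] H_meas])
  have R_cont: "continuous_on UNIV (R N l)" for N l
    unfolding R_def by (intro continuous_intros)
  have R_meas [measurable]: "R N l \<in> borel_measurable borel" for N l
    using R_cont by (rule borel_measurable_continuous_onI)
  define A where "A N z = (\<Sum>l<N. inverse (\<omega> N l) ^ (\<beta> $ j) * H (R N l z)) / of_nat N" for N z
  have A_eq: "A N z = monomial \<beta> z * ((\<Sum>l<N. G (R N l z)) / of_nat N)" for N z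
  proof -
    have "inverse (\<omega> N l) ^ (\<beta> $ j) * H (R N l z) = monomial \<beta> z * G (R N l z)" for l
      using \<omega>0[of N l] unfolding H_def R_def monomial_upd_coord_mult by (simp add: power_inverse)
    then show ?thesis by (simp add: A_def sum_distrib_left)
  qed
  have A_lim: "(\<lambda>N. A N z) \<longlonglongrightarrow> monomial \<beta> z * G (upd_coord z j 0)" if z: "z \<in> polydisk r" for z
    unfolding A_eq R_def \<omega>_def
    using rotation_average_tendsto[of "\<lambda>w. G (upd_coord z j w)" "r $ j" "z $ j"] G z polydisk_coord[OF z]
    by (intro tendsto_mult tendsto_const) (simp add: sep_holomorphic_def)
  have A_meas [measurable]: "weight_on \<phi> s (A N) \<in> borel_measurable borel" for N
  proof (rule weight_on_measurable[OF psh _ sub])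
    have RX: "R N l z \<in> polydisk r" if "z \<in> polydisk r" for l z
      using that polydisk_coord[OF that, of j] by (simp add: R_def upd_coord_in_polydisk norm_mult \<omega>)
    have "continuous_on (polydisk r) (\<lambda>z. H (R N l z))" for l
      by (rule continuous_on_compose2[OF H_cont continuous_on_subset[OF R_cont]]) (use RX in auto)
    then show "continuous_on (polydisk r) (A N)"
      unfolding A_def divide_inverse by (intro continuous_intros)
  qed
  have A_le: "(\<integral>\<^sup>+ z. weight_on \<phi> s (A N) z \<partial>lborel) \<le> (\<integral>\<^sup>+ z. weight_on \<phi> s H z \<partial>lborel)" if N: "0 < N" for N
  proof -
    \<comment> \<open>Cauchy-Schwarz bounds the square of the mean by the mean of the squares. As
      \<phi> and the polydisk are invariant under the rotations, each term is the weight of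
      \<open>H\<close> at a rotated point, with the same integral by \<open>R_int\<close>.\<close>
    have "weight_on \<phi> s (A N) z \<le> ennreal (1 / N) * (\<Sum>l<N. weight_on \<phi> s H (R N l z))" for z
    proof (cases "z \<in> cpolydisk s")
      case True
      then have z: "z \<in> polydisk r" using sub by blast
      have "cmod (A N z) \<le> (\<Sum>l<N. cmod (H (R N l z))) / N"
      proof -
        have "cmod (A N z) = cmod (\<Sum>l<N. inverse (\<omega> N l) ^ (\<beta> $ j) * H (R N l z)) / N"
          by (simp add: A_def norm_divide)
        also have "\<dots> \<le> (\<Sum>l<N. cmod (inverse (\<omega> N l) ^ (\<beta> $ j) * H (R N l z))) / N"
          by (intro divide_right_mono norm_sum) auto
        also have "\<dots> = (\<Sum>l<N. cmod (H (R N l z))) / N"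
          by (simp add: norm_mult norm_power norm_inverse \<omega>)
        finally show ?thesis .
      qed
      then have "(cmod (A N z))\<^sup>2 \<le> ((\<Sum>l<N. cmod (H (R N l z))) / N)\<^sup>2"
        by (intro power_mono) auto
      also have "\<dots> \<le> ((\<Sum>l<N. (cmod (H (R N l z)))\<^sup>2) * N) / (real N)\<^sup>2"
        using sum_squared_le_sum_of_squares[of "\<lambda>l. cmod (H (R N l z))" "{..<N}"]
        by (simp add: power_divide divide_right_mono)
      also have "\<dots> = (1 / N) * (\<Sum>l<N. (cmod (H (R N l z)))\<^sup>2)"
        using N by (simp add: power2_eq_square)
      finally have "ennreal ((cmod (A N z))\<^sup>2) \<le> ennreal (1 / N) * (\<Sum>l<N. ennreal ((cmod (H (R N l z)))\<^sup>2))"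
        by (simp add: sum_ennreal ennreal_mult[symmetric] sum_nonneg ennreal_leI)
      then have "ennreal ((cmod (A N z))\<^sup>2) * ereal_exp (- 2 * \<phi> z)
        \<le> ennreal (1 / N) * (\<Sum>l<N. ennreal ((cmod (H (R N l z)))\<^sup>2)) * ereal_exp (- 2 * \<phi> z)"
        by (rule mult_right_mono) simp
      then show ?thesis
        using True R_K R_\<phi>[OF z] by (simp add: weight_on_def sum_distrib_right mult.assoc del: sum_ennreal)
    qed (simp add: weight_on_def)
    then have "(\<integral>\<^sup>+ z. weight_on \<phi> s (A N) z \<partial>lborel)
      \<le> (\<integral>\<^sup>+ z. ennreal (1 / N) * (\<Sum>l<N. weight_on \<phi> s H (R N l z)) \<partial>lborel)"
      by (intro nn_integral_mono)
    also have "\<dots> = ennreal (1 / N) * (\<Sum>l<N. \<integral>\<^sup>+ z. weight_on \<phi> s H (R N l z) \<partial>lborel)"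
      by (subst nn_integral_cmult) (auto intro!: arg_cong2[of _ _ _ _ "(*)"] nn_integral_sum)
    also have "\<dots> = ennreal (1 / N) * (of_nat N * (\<integral>\<^sup>+ z. weight_on \<phi> s H z \<partial>lborel))"
      by (simp add: R_int)
    also have "\<dots> = (\<integral>\<^sup>+ z. weight_on \<phi> s H z \<partial>lborel)"
    proof -
      have "ennreal (1 / N) * of_nat N = 1"
        using N by (simp add: ennreal_of_nat_eq_real_of_nat ennreal_mult[symmetric])
      then show ?thesis by (simp add: mult.assoc[symmetric])
    qed
    finally show ?thesis .
  qed
  have "weight_on \<phi> s (\<lambda>z. monomial \<beta> z * G (upd_coord z j 0)) z \<le> liminf (\<lambda>N. weight_on \<phi> s (A N) z)" for z
  proof (cases "z \<in> cpolydisk s")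
    case True
    then have "(\<lambda>N. (cmod (A N z))\<^sup>2) \<longlonglongrightarrow> (cmod (monomial \<beta> z * G (upd_coord z j 0)))\<^sup>2"
      using sub by (intro tendsto_power tendsto_norm A_lim) auto
    from Liminf_ennreal_mult_le[OF this, of "ereal_exp (- 2 * \<phi> z)"]
    show ?thesis using True by (simp add: weight_on_def)
  qed (simp add: weight_on_def)
  then have "(\<integral>\<^sup>+ z. weight_on \<phi> s (\<lambda>z. monomial \<beta> z * G (upd_coord z j 0)) z \<partial>lborel)
    \<le> (\<integral>\<^sup>+ z. liminf (\<lambda>N. weight_on \<phi> s (A N) z) \<partial>lborel)"
    by (intro nn_integral_mono)
  also have "\<dots> \<le> liminf (\<lambda>N. \<integral>\<^sup>+ z. weight_on \<phi> s (A N) z \<partial>lborel)"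
    by (intro nn_integral_liminf) measurable
  also have "\<dots> \<le> (\<integral>\<^sup>+ z. weight_on \<phi> s H z \<partial>lborel)"
  proof -
    have "eventually (\<lambda>N. (\<integral>\<^sup>+ z. weight_on \<phi> s (A N) z \<partial>lborel) \<le> (\<integral>\<^sup>+ z. weight_on \<phi> s H z \<partial>lborel)) sequentially"
      using eventually_gt_at_top[of 0] by eventually_elim (rule A_le)
    then have "liminf (\<lambda>N. \<integral>\<^sup>+ z. weight_on \<phi> s (A N) z \<partial>lborel) \<le> liminf (\<lambda>_ :: nat. \<integral>\<^sup>+ z. weight_on \<phi> s H z \<partial>lborel)"
      by (rule Liminf_mono)
    then show ?thesis by (simp add: Liminf_const)
  qed
  finally show ?thesis unfolding H_def .
qed

section \<open>The multiplier ideal is monomial\<close>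

lemma holo_ring_carrier_iff:
  "F \<in> carrier (holo_ring (polydisk r)) \<longleftrightarrow> F \<in> extensional (polydisk r) \<and> sep_holomorphic r F"
  by (simp add: holo_ring_def holomorphic_on_Cn_iff_sep)

lemma restrict_in_holo_ring:
  "sep_holomorphic r F \<Longrightarrow> restrict F (polydisk r) \<in> carrier (holo_ring (polydisk r))"
  using sep_holomorphic_cong[of r "restrict F (polydisk r)" F] by (simp add: holo_ring_carrier_iff)

lemma holo_ring_simps:
  "F \<otimes>\<^bsub>holo_ring X\<^esub> G = restrict (\<lambda>z. F z * G z) X"
  "F \<oplus>\<^bsub>holo_ring X\<^esub> G = restrict (\<lambda>z. F z + G z) X"
  "\<one>\<^bsub>holo_ring X\<^esub> = restrict (\<lambda>z. 1) X"
  "\<zero>\<^bsub>holo_ring X\<^esub> = restrict (\<lambda>z. 0) X"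
  by (simp_all add: holo_ring_def)

lemma holo_ring_add_restrict:
  "restrict F X \<oplus>\<^bsub>holo_ring X\<^esub> restrict G X = restrict (\<lambda>z. F z + G z) X"
  by (auto simp: holo_ring_simps restrict_def fun_eq_iff)

lemma holo_ring_mult_restrict:
  "restrict F X \<otimes>\<^bsub>holo_ring X\<^esub> restrict G X = restrict (\<lambda>z. F z * G z) X"
  by (auto simp: holo_ring_simps restrict_def fun_eq_iff)

lemma holo_ring_carrierE:
  assumes "F \<in> carrier (holo_ring (polydisk r))"
  obtains G where "F = restrict G (polydisk r)" "sep_holomorphic r G"
  using assms extensional_restrict[of F "polydisk r"] unfolding holo_ring_carrier_iff by metis

lemma ring_holo_ring: "ring (holo_ring (polydisk r))"
proof (rule ringI)
  let ?X = "polydisk r" and ?R = "holo_ring (polydisk r)"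
  have mult: "F \<otimes>\<^bsub>?R\<^esub> G \<in> carrier ?R" and add: "F \<oplus>\<^bsub>?R\<^esub> G \<in> carrier ?R"
    if "F \<in> carrier ?R" "G \<in> carrier ?R" for F G
    using that unfolding holo_ring_simps
    by (auto simp: holo_ring_carrier_iff[of F] holo_ring_carrier_iff[of G]
        intro!: restrict_in_holo_ring sep_holomorphic_mult sep_holomorphic_add)
  have one: "\<one>\<^bsub>?R\<^esub> \<in> carrier ?R" and zero: "\<zero>\<^bsub>?R\<^esub> \<in> carrier ?R"
    unfolding holo_ring_simps by (auto intro!: restrict_in_holo_ring sep_holomorphic_const)
  show "abelian_group ?R"
  proof (rule abelian_groupI)
    fix F assume "F \<in> carrier ?R"
    then obtain G where G: "F = restrict G ?X" "sep_holomorphic r G" by (rule holo_ring_carrierE)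
    have "restrict (\<lambda>z. (- 1) * G z) ?X \<in> carrier ?R"
      using G(2) by (intro restrict_in_holo_ring sep_holomorphic_mult sep_holomorphic_const)
    moreover have "restrict (\<lambda>z. (- 1) * G z) ?X \<oplus>\<^bsub>?R\<^esub> F = \<zero>\<^bsub>?R\<^esub>"
      unfolding G(1) holo_ring_add_restrict holo_ring_simps(4) by simp
    ultimately show "\<exists>H\<in>carrier ?R. H \<oplus>\<^bsub>?R\<^esub> F = \<zero>\<^bsub>?R\<^esub>" by blast
  qed (auto simp: add zero elim!: holo_ring_carrierE, auto simp: holo_ring_simps restrict_def fun_eq_iff)
  show "monoid ?R"
    by (rule monoidI) (auto simp: mult one elim!: holo_ring_carrierE, auto simp: holo_ring_simps restrict_def fun_eq_iff)
qed (auto simp: holo_ring_simps restrict_def fun_eq_iff algebra_simps)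

section \<open>Locally square integrable functions\<close>

context
  fixes r :: "real ^ 'n" and \<phi> :: "complex ^ 'n \<Rightarrow> ereal"
  assumes r_pos: "\<And>i. 0 < r $ i"
    and psh: "psh_on (polydisk r) \<phi>"
    and toric: "toric_on (polydisk r) \<phi>"
begin

text \<open>Membership in the multiplier ideal for total functions, freed of the normalisation
  outside the polydisk; it depends only on the values inside.\<close>

definition L2_loc :: "(complex ^ 'n \<Rightarrow> complex) \<Rightarrow> bool" where
  "L2_loc F \<longleftrightarrow> sep_holomorphic r F \<and>
    (\<forall>s. (\<forall>i. 0 < s $ i \<and> s $ i < r $ i) \<longrightarrow> (\<integral>\<^sup>+ z. weight_on \<phi> s F z \<partial>lborel) < \<infinity>)"

lemma weight_on_cong:
  assumes "\<And>i. s $ i < r $ i" "\<And>z. z \<in> polydisk r \<Longrightarrow> F z = G z"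
  shows "weight_on \<phi> s F = weight_on \<phi> s G"
  using assms(2) cpolydisk_subset[of s r, OF assms(1)]
  by (auto simp: weight_on_def fun_eq_iff indicator_def)

lemma L2_loc_cong:
  assumes "\<And>z. z \<in> polydisk r \<Longrightarrow> F z = G z"
  shows "L2_loc F \<longleftrightarrow> L2_loc G"
proof -
  have "weight_on \<phi> s F = weight_on \<phi> s G" if "\<forall>i. 0 < s $ i \<and> s $ i < r $ i" for s
    using that assms by (intro weight_on_cong) auto
  then show ?thesis
    unfolding L2_loc_def using sep_holomorphic_cong[of r F G, OF assms] by auto
qed

lemma multiplier_ideal_iff:
  "F \<in> multiplier_ideal (polydisk r) \<phi> \<longleftrightarrow> F \<in> extensional (polydisk r) \<and> L2_loc F"
  unfolding multiplier_ideal_def mem_Collect_eq holo_ring_carrier_iff L2_loc_def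
    locally_integrable_iff_cpolydisk[OF r_pos] by blast

lemma restrict_in_multiplier_ideal:
  "restrict F (polydisk r) \<in> multiplier_ideal (polydisk r) \<phi> \<longleftrightarrow> L2_loc F"
  using L2_loc_cong[of "restrict F (polydisk r)" F] by (simp add: multiplier_ideal_iff)

lemma weight_on_meas:
  "sep_holomorphic r F \<Longrightarrow> \<forall>i. 0 < s $ i \<and> s $ i < r $ i \<Longrightarrow> weight_on \<phi> s F \<in> borel_measurable borel"
  by (intro weight_on_measurable[OF psh] cpolydisk_subset) (auto simp: sep_holomorphic_def)

lemma L2_loc_add:
  assumes F: "L2_loc F" and G: "L2_loc G"
  shows "L2_loc (\<lambda>z. F z + G z)"
  unfolding L2_loc_def
proof (intro conjI allI impI)
  show "sep_holomorphic r (\<lambda>z. F z + G z)"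
    using F G by (intro sep_holomorphic_add) (auto simp: L2_loc_def)
  fix s :: "real ^ 'n" assume s: "\<forall>i. 0 < s $ i \<and> s $ i < r $ i"
  have [measurable]: "weight_on \<phi> s F \<in> borel_measurable borel" "weight_on \<phi> s G \<in> borel_measurable borel"
    using F G s by (auto intro!: weight_on_meas simp: L2_loc_def)
  have "weight_on \<phi> s (\<lambda>z. F z + G z) z \<le> 2 * weight_on \<phi> s F z + 2 * weight_on \<phi> s G z" for z
  proof -
    have "(cmod (F z + G z))\<^sup>2 \<le> (cmod (F z) + cmod (G z))\<^sup>2"
      by (intro power_mono norm_triangle_ineq) auto
    also have "\<dots> \<le> 2 * (cmod (F z))\<^sup>2 + 2 * (cmod (G z))\<^sup>2"
      using sum_squares_bound[of "cmod (F z)" "cmod (G z)"] by (simp add: power2_sum)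
    finally have "ennreal ((cmod (F z + G z))\<^sup>2) \<le> ennreal (2 * (cmod (F z))\<^sup>2 + 2 * (cmod (G z))\<^sup>2)"
      by (rule ennreal_leI)
    also have "\<dots> = 2 * ennreal ((cmod (F z))\<^sup>2) + 2 * ennreal ((cmod (G z))\<^sup>2)"
      by (simp add: ennreal_plus ennreal_mult)
    finally have "ennreal ((cmod (F z + G z))\<^sup>2) * (ereal_exp (- 2 * \<phi> z) * indicator (cpolydisk s) z)
      \<le> (2 * ennreal ((cmod (F z))\<^sup>2) + 2 * ennreal ((cmod (G z))\<^sup>2)) * (ereal_exp (- 2 * \<phi> z) * indicator (cpolydisk s) z)"
      by (rule mult_right_mono) simp
    then show ?thesis by (simp add: weight_on_def distrib_right mult.assoc)
  qed
  then have "(\<integral>\<^sup>+ z. weight_on \<phi> s (\<lambda>z. F z + G z) z \<partial>lborel)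
    \<le> (\<integral>\<^sup>+ z. 2 * weight_on \<phi> s F z + 2 * weight_on \<phi> s G z \<partial>lborel)"
    by (intro nn_integral_mono)
  also have "\<dots> = 2 * (\<integral>\<^sup>+ z. weight_on \<phi> s F z \<partial>lborel) + 2 * (\<integral>\<^sup>+ z. weight_on \<phi> s G z \<partial>lborel)"
    by (simp add: nn_integral_add nn_integral_cmult)
  also have "\<dots> < \<infinity>"
    using F G s by (simp add: L2_loc_def ennreal_mult_less_top)
  finally show "(\<integral>\<^sup>+ z. weight_on \<phi> s (\<lambda>z. F z + G z) z \<partial>lborel) < \<infinity>" .
qed

lemma L2_loc_mult:
  assumes F: "sep_holomorphic r F" and G: "L2_loc G"
  shows "L2_loc (\<lambda>z. F z * G z)"
  unfolding L2_loc_def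
proof (intro conjI allI impI)
  show "sep_holomorphic r (\<lambda>z. F z * G z)"
    using F G by (intro sep_holomorphic_mult) (auto simp: L2_loc_def)
  fix s :: "real ^ 'n" assume s: "\<forall>i. 0 < s $ i \<and> s $ i < r $ i"
  have [measurable]: "weight_on \<phi> s G \<in> borel_measurable borel"
    using G s by (auto intro!: weight_on_meas simp: L2_loc_def)
  have "compact (F ` cpolydisk s)"
  proof (rule compact_continuous_image[OF _ compact_cpolydisk])
    have "cpolydisk s \<subseteq> polydisk r" using s by (intro cpolydisk_subset) auto
    then show "continuous_on (cpolydisk s) F"
      using F continuous_on_subset unfolding sep_holomorphic_def by blast
  qed
  then have "bounded (F ` cpolydisk s)" by (rule compact_imp_bounded)
  then obtain M where M: "\<And>z. z \<in> cpolydisk s \<Longrightarrow> cmod (F z) \<le> M"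
    by (auto simp: bounded_iff)
  have "weight_on \<phi> s (\<lambda>z. F z * G z) z \<le> ennreal (M\<^sup>2) * weight_on \<phi> s G z" for z
  proof (cases "z \<in> cpolydisk s")
    case True
    have "(cmod (F z * G z))\<^sup>2 \<le> M\<^sup>2 * (cmod (G z))\<^sup>2"
      using M[OF True] by (simp add: norm_mult power_mult_distrib mult_right_mono power_mono)
    then have "ennreal ((cmod (F z * G z))\<^sup>2) \<le> ennreal (M\<^sup>2) * ennreal ((cmod (G z))\<^sup>2)"
      by (simp add: ennreal_mult[symmetric] ennreal_leI)
    from mult_right_mono[OF this, of "ereal_exp (- 2 * \<phi> z)"]
    show ?thesis using True by (simp add: weight_on_def mult.assoc)
  qed (simp add: weight_on_def)
  then have "(\<integral>\<^sup>+ z. weight_on \<phi> s (\<lambda>z. F z * G z) z \<partial>lborel) \<le> (\<integral>\<^sup>+ z. ennreal (M\<^sup>2) * weight_on \<phi> s G z \<partial>lborel)"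
    by (intro nn_integral_mono)
  also have "\<dots> = ennreal (M\<^sup>2) * (\<integral>\<^sup>+ z. weight_on \<phi> s G z \<partial>lborel)"
    by (simp add: nn_integral_cmult)
  also have "\<dots> < \<infinity>"
    using G s by (simp add: L2_loc_def ennreal_mult_less_top)
  finally show "(\<integral>\<^sup>+ z. weight_on \<phi> s (\<lambda>z. F z * G z) z \<partial>lborel) < \<infinity>" .
qed

lemma L2_loc_zero: "L2_loc (\<lambda>z. 0)"
  by (simp add: L2_loc_def weight_on_def sep_holomorphic_const)

lemma L2_loc_diff: "L2_loc F \<Longrightarrow> L2_loc G \<Longrightarrow> L2_loc (\<lambda>z. F z - G z)"
  using L2_loc_add[of F "\<lambda>z. (- 1) * G z"] L2_loc_mult[OF sep_holomorphic_const[of r "- 1"], of G] by simp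

lemma ideal_multiplier_ideal:
  "ideal (multiplier_ideal (polydisk r) \<phi>) (holo_ring (polydisk r))"
proof (rule idealI[OF ring_holo_ring])
  let ?R = "holo_ring (polydisk r)" and ?I = "multiplier_ideal (polydisk r) \<phi>"
  interpret R: ring ?R by (rule ring_holo_ring)
  have carr: "F \<in> carrier ?R" if "F \<in> ?I" for F
    using that by (simp add: multiplier_ideal_def)
  have mult: "F \<otimes>\<^bsub>?R\<^esub> G \<in> ?I" if "F \<in> carrier ?R" "G \<in> ?I" for F G
  proof -
    have "sep_holomorphic r F" "L2_loc G"
      using that by (auto simp: multiplier_ideal_iff holo_ring_carrier_iff)
    then show ?thesis
      unfolding holo_ring_simps restrict_in_multiplier_ideal by (rule L2_loc_mult)
  qed
  show "G \<otimes>\<^bsub>?R\<^esub> F \<in> ?I" if "F \<in> ?I" "G \<in> carrier ?R" for F G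
    using that mult by blast
  have comm: "F \<otimes>\<^bsub>?R\<^esub> G = G \<otimes>\<^bsub>?R\<^esub> F" for F G
    by (simp add: holo_ring_simps mult.commute)
  then show "F \<otimes>\<^bsub>?R\<^esub> G \<in> ?I" if "F \<in> ?I" "G \<in> carrier ?R" for F G
    using that mult by metis
  show "subgroup ?I (add_monoid ?R)"
  proof
    show "?I \<subseteq> carrier (add_monoid ?R)" using carr by auto
    show "F \<otimes>\<^bsub>add_monoid ?R\<^esub> G \<in> ?I" if "F \<in> ?I" "G \<in> ?I" for F G
    proof -
      have "F \<oplus>\<^bsub>?R\<^esub> G \<in> ?I"
      proof -
        have "L2_loc F" "L2_loc G" using that by (auto simp: multiplier_ideal_iff)
        then show ?thesis
          unfolding holo_ring_simps restrict_in_multiplier_ideal by (rule L2_loc_add)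
      qed
      then show ?thesis by simp
    qed
    show "\<one>\<^bsub>add_monoid ?R\<^esub> \<in> ?I"
      using L2_loc_zero by (simp add: holo_ring_simps restrict_in_multiplier_ideal)
    show "inv\<^bsub>add_monoid ?R\<^esub> F \<in> ?I" if F: "F \<in> ?I" for F
    proof -
      have "inv\<^bsub>add_monoid ?R\<^esub> F = \<ominus>\<^bsub>?R\<^esub> F" by (simp add: a_inv_def)
      also have "\<dots> = (\<ominus>\<^bsub>?R\<^esub> \<one>\<^bsub>?R\<^esub>) \<otimes>\<^bsub>?R\<^esub> F"
        using carr[OF F] by (simp add: R.l_minus)
      also have "\<dots> \<in> ?I" using F by (intro mult) auto
      finally show ?thesis .
    qed
  qed
qed

section \<open>Monomial components of elements of the multiplier ideal\<close>

lemma L2_loc_monomial_upd_zero: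
  assumes "sep_holomorphic r G" "L2_loc (\<lambda>z. monomial \<beta> z * G z)"
  shows "L2_loc (\<lambda>z. monomial \<beta> z * G (upd_coord z j 0))"
  unfolding L2_loc_def
proof (intro conjI allI impI)
  show "sep_holomorphic r (\<lambda>z. monomial \<beta> z * G (upd_coord z j 0))"
    using assms(1) by (intro sep_holomorphic_mult sep_holomorphic_monomial sep_holomorphic_upd_zero)
  fix s :: "real ^ 'n" assume s: "\<forall>i. 0 < s $ i \<and> s $ i < r $ i"
  have "(\<integral>\<^sup>+ z. weight_on \<phi> s (\<lambda>z. monomial \<beta> z * G (upd_coord z j 0)) z \<partial>lborel)
    \<le> (\<integral>\<^sup>+ z. weight_on \<phi> s (\<lambda>z. monomial \<beta> z * G z) z \<partial>lborel)"
    using s by (intro weight_integral_upd_zero_le[OF psh toric _ assms(1)]) auto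
  also have "\<dots> < \<infinity>" using assms(2) s by (simp add: L2_loc_def)
  finally show "(\<integral>\<^sup>+ z. weight_on \<phi> s (\<lambda>z. monomial \<beta> z * G (upd_coord z j 0)) z \<partial>lborel) < \<infinity>" .
qed

text \<open>Subtracting its constant term in z_j from a function leaves z_j times its quotient, and
  this factor z_j is absorbed into the monomial. So each division is paid for by one degree in the
  exponent.\<close>

lemma L2_loc_monomial_coord_quot:
  assumes "sep_holomorphic r G" "L2_loc (\<lambda>z. monomial \<beta> z * G z)"
  shows "L2_loc (\<lambda>z. monomial (\<beta> + axis j k) z * ((\<lambda>G. coord_quot G j 0) ^^ k) G z)"
proof (induction k)
  case 0
  have axis_0: "axis j 0 = (0 :: nat ^ 'n)" by (simp add: axis_eq_0_iff)
  show ?case unfolding axis_0 using assms(2) by simp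
next
  case (Suc k)
  let ?T = "\<lambda>k. ((\<lambda>G. coord_quot G j 0) ^^ k) G"
  let ?b = "\<lambda>k. \<beta> + axis j k"
  have "L2_loc (\<lambda>z. monomial (?b k) z * ?T k z - monomial (?b k) z * ?T k (upd_coord z j 0))"
    using assms(1) Suc.IH
    by (intro L2_loc_diff L2_loc_monomial_upd_zero sep_holomorphic_coord_quot_funpow)
  also have "(\<lambda>z. monomial (?b k) z * ?T k z - monomial (?b k) z * ?T k (upd_coord z j 0))
    = (\<lambda>z. monomial (?b (Suc k)) z * ?T (Suc k) z)"
  proof
    fix z
    have "?T k z = ?T k (upd_coord z j 0) + z $ j * ?T (Suc k) z"
      using coord_quot_mult[of "?T k" z j 0] by simp
    then show "monomial (?b k) z * ?T k z - monomial (?b k) z * ?T k (upd_coord z j 0)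
      = monomial (?b (Suc k)) z * ?T (Suc k) z"
      by (simp add: monomial_add monomial_axis algebra_simps del: funpow.simps)
  qed
  finally show ?case .
qed

text \<open>\<open>V\<close> contains the coordinates on which \<open>G\<close> may still depend. A
  Taylor coefficient of \<open>G\<close> in z_j that is not identically 0 replaces \<open>G\<close>,
  which removes the dependence on z_j and adds its degree to the exponent. At the end
  \<open>G\<close> is a nonzero constant and is divided out.\<close>

lemma ex_monomial_L2_loc:
  assumes "finite V" "sep_holomorphic r G" "L2_loc (\<lambda>z. monomial \<beta> z * G z)"
    and "\<And>i. i \<notin> V \<Longrightarrow> indep_coord r i G" and "\<exists>z\<in>polydisk r. G z \<noteq> 0"
  shows "\<exists>\<gamma>. L2_loc (monomial (\<beta> + \<gamma>)) \<and> (\<forall>i. i \<notin> V \<longrightarrow> \<gamma> $ i = 0)"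
  using assms
proof (induction V arbitrary: \<beta> G rule: finite_induct)
  case empty
  obtain z0 where z0: "z0 \<in> polydisk r" "G z0 \<noteq> 0" using empty.prems(4) by blast
  have const: "G z = G 0" if "z \<in> polydisk r" for z
    using indep_all_coords_const[of r G z] empty.prems(3) that by blast
  then have "G 0 \<noteq> 0" using z0 by metis
  have "L2_loc (\<lambda>z. inverse (G 0) * (monomial \<beta> z * G z))"
    by (intro L2_loc_mult sep_holomorphic_const empty.prems)
  moreover have "inverse (G 0) * (monomial \<beta> z * G z) = monomial \<beta> z" if "z \<in> polydisk r" for z
    using const[OF that] \<open>G 0 \<noteq> 0\<close> by simp
  ultimately have "L2_loc (monomial \<beta>)"
    using L2_loc_cong[of "\<lambda>z. inverse (G 0) * (monomial \<beta> z * G z)" "monomial \<beta>"] by simp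
  then show ?case by (intro exI[of _ 0]) simp
next
  case (insert j V)
  let ?T = "\<lambda>k. ((\<lambda>G. coord_quot G j 0) ^^ k) G"
  obtain z where "z \<in> polydisk r" "G z \<noteq> 0" using insert.prems(4) by blast
  from ex_nonzero_coefficient[OF insert.prems(1) this, of j]
  obtain k y where y: "y \<in> polydisk r" "?T k (upd_coord y j 0) \<noteq> 0" by blast
  let ?G = "\<lambda>z. ?T k (upd_coord z j 0)"
  have "\<exists>\<gamma>. L2_loc (monomial ((\<beta> + axis j k) + \<gamma>)) \<and> (\<forall>i. i \<notin> V \<longrightarrow> \<gamma> $ i = 0)"
  proof (rule insert.IH)
    show "sep_holomorphic r ?G"
      by (intro sep_holomorphic_upd_zero sep_holomorphic_coord_quot_funpow insert.prems)
    show "L2_loc (\<lambda>z. monomial (\<beta> + axis j k) z * ?G z)"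
      by (intro L2_loc_monomial_upd_zero L2_loc_monomial_coord_quot sep_holomorphic_coord_quot_funpow insert.prems)
    show "indep_coord r i ?G" if "i \<notin> V" for i
      using that insert.prems(3)[of i]
      by (cases "i = j") (auto intro: indep_coord_upd_zero_same indep_coord_upd_zero indep_coord_quot_funpow)
    show "\<exists>z\<in>polydisk r. ?G z \<noteq> 0" using y by blast
  qed
  then obtain \<gamma> where \<gamma>: "L2_loc (monomial ((\<beta> + axis j k) + \<gamma>))" "\<forall>i. i \<notin> V \<longrightarrow> \<gamma> $ i = 0" by blast
  then show ?case
    by (intro exI[of _ "axis j k + \<gamma>"]) (auto simp: add.assoc axis_def)
qed

text \<open>Expand \<open>F\<close> in each variable to order \<open>m\<close>, with \<open>m\<close> from Dickson's lemma. This writes \<open>F\<close> as a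
  finite sum of terms \<open>z\<^sup>\<beta> G\<close> of the multiplier ideal, where \<open>G\<close> depends on \<open>z\<^sub>i\<close> only if
  \<open>\<beta>\<^sub>i = m\<close>. Unless \<open>G = 0\<close>, some \<open>z\<^sup>\<beta>\<^sup>+\<^sup>\<gamma>\<close> with \<open>\<gamma>\<close> supported on these \<open>i\<close> is in the multiplier
  ideal, hence so is \<open>z\<^sup>\<beta>\<close> by the choice of \<open>m\<close>.\<close>

lemma multiplier_ideal_subset_of_monomials:
  assumes J: "ideal J (holo_ring (polydisk r))"
    and mono: "\<And>\<alpha>. L2_loc (monomial \<alpha>) \<Longrightarrow> monomial_fun (polydisk r) \<alpha> \<in> J"
  shows "multiplier_ideal (polydisk r) \<phi> \<subseteq> J"
proof
  interpret J: ideal J "holo_ring (polydisk r)" by (rule J)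
  let ?r = "\<lambda>F. restrict F (polydisk r)"
  have up: "L2_loc (monomial \<beta>)" if "L2_loc (monomial \<alpha>)" "\<And>i. \<alpha> $ i \<le> \<beta> $ i" for \<alpha> \<beta> :: "nat ^ 'n"
  proof -
    have "\<beta> = (\<chi> i. \<beta> $ i - \<alpha> $ i) + \<alpha>" using that(2) by (simp add: vec_eq_iff)
    then have "monomial \<beta> = (\<lambda>z. monomial (\<chi> i. \<beta> $ i - \<alpha> $ i) z * monomial \<alpha> z)"
      by (metis monomial_add ext)
    then show ?thesis using that(1) by (simp add: L2_loc_mult sep_holomorphic_monomial)
  qed
  have "\<exists>m. \<forall>\<alpha>\<in>{\<alpha>. L2_loc (monomial \<alpha>)}. (\<chi> i. min (\<alpha> $ i) m) \<in> {\<alpha>. L2_loc (monomial \<alpha>)}"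
    by (rule upward_closed_truncation) (use up in blast)
  then obtain m where m: "\<And>\<alpha>. L2_loc (monomial \<alpha>) \<Longrightarrow> L2_loc (monomial (\<chi> i. min (\<alpha> $ i) m))"
    by blast
  \<comment> \<open>The induction is over \<open>U\<close>, the set of coordinates not yet expanded,
    where \<beta> is 0. At an expanded coordinate either \<beta>_i < m and \<open>G\<close> is
    independent of z_i, or \<beta>_i = m and \<open>G\<close> is a remainder that may depend on
    z_i.\<close>
  have main: "?r (\<lambda>z. monomial \<beta> z * G z) \<in> J"
    if "sep_holomorphic r G" "L2_loc (\<lambda>z. monomial \<beta> z * G z)" "\<And>i. i \<in> U \<Longrightarrow> \<beta> $ i = 0"
      "\<And>i. i \<notin> U \<Longrightarrow> \<beta> $ i \<le> m" "\<And>i. i \<notin> U \<Longrightarrow> \<beta> $ i < m \<Longrightarrow> indep_coord r i G"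
    for U \<beta> G
    using finite[of U] that
  proof (induction U arbitrary: \<beta> G rule: finite_induct)
    case empty
    show ?case
    proof (cases "\<exists>z\<in>polydisk r. G z \<noteq> 0")
      case True
      obtain \<gamma> where \<gamma>: "L2_loc (monomial (\<beta> + \<gamma>))" "\<And>i. i \<notin> {i. \<beta> $ i = m} \<Longrightarrow> \<gamma> $ i = 0"
      proof -
        have "indep_coord r i G" if "i \<notin> {i. \<beta> $ i = m}" for i
          using that empty.prems(4)[of i] empty.prems(5)[of i] by auto
        from ex_monomial_L2_loc[OF finite empty.prems(1,2) this True] show ?thesis
          using that by blast
      qed
      \<comment> \<open>Truncation at \<open>m\<close> undoes \<gamma>, which only raised exponents
        that were already equal to \<open>m\<close>.\<close>
      have "(\<chi> i. min ((\<beta> + \<gamma>) $ i) m) = \<beta>"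
      proof (subst vec_eq_iff, rule allI)
        fix i show "(\<chi> i. min ((\<beta> + \<gamma>) $ i) m) $ i = \<beta> $ i"
          using empty.prems(4)[of i] \<gamma>(2)[of i] by (cases "\<beta> $ i = m") auto
      qed
      then have "monomial_fun (polydisk r) \<beta> \<in> J" using m[OF \<gamma>(1)] mono by simp
      then have "monomial_fun (polydisk r) \<beta> \<otimes>\<^bsub>holo_ring (polydisk r)\<^esub> ?r G \<in> J"
        using empty.prems(1) by (intro J.I_r_closed restrict_in_holo_ring)
      then show ?thesis unfolding monomial_fun_eq holo_ring_mult_restrict .
    next
      case False
      then have "?r (\<lambda>z. monomial \<beta> z * G z) = \<zero>\<^bsub>holo_ring (polydisk r)\<^esub>"
        by (auto simp: holo_ring_simps restrict_def fun_eq_iff)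
      then show ?thesis using additive_subgroup.zero_closed[OF J.additive_subgroup_axioms] by simp
    qed
  next
    case (insert j U)
    let ?T = "\<lambda>k. ((\<lambda>G. coord_quot G j 0) ^^ k) G"
    let ?b = "\<lambda>k. \<beta> + axis j k"
    have b: "?b k $ i = (if i = j then k else \<beta> $ i)" for k i
      using insert.prems(3)[of j] by (simp add: axis_def)
    \<comment> \<open>Descending from the remainder at k = m to \<open>G\<close> itself at k = 0,
      each step adds one Taylor term, whose coefficient no longer depends on z_j.\<close>
    have "?r (\<lambda>z. monomial (?b k) z * ?T k z) \<in> J" if "k \<le> m" for k
      using that
    proof (induction k rule: inc_induct)
      case base
      show ?case
      proof (rule insert.IH)
        show "sep_holomorphic r (?T m)"
          by (intro sep_holomorphic_coord_quot_funpow insert.prems)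
        show "L2_loc (\<lambda>z. monomial (?b m) z * ?T m z)"
          by (intro L2_loc_monomial_coord_quot insert.prems)
        show "?b m $ i = 0" if "i \<in> U" for i
          using that insert.hyps insert.prems(3)[of i] unfolding b by auto
        show "?b m $ i \<le> m" if "i \<notin> U" for i
          using that insert.prems(4)[of i] unfolding b by auto
        show "indep_coord r i (?T m)" if "i \<notin> U" "?b m $ i < m" for i
          using that insert.prems(5)[of i] unfolding b by (auto intro: indep_coord_quot_funpow split: if_splits)
      qed
    next
      case (step k)
      have "?r (\<lambda>z. monomial (?b k) z * ?T k (upd_coord z j 0)) \<in> J"
      proof (rule insert.IH)
        show "sep_holomorphic r (\<lambda>z. ?T k (upd_coord z j 0))"
          by (intro sep_holomorphic_upd_zero sep_holomorphic_coord_quot_funpow insert.prems)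
        show "L2_loc (\<lambda>z. monomial (?b k) z * ?T k (upd_coord z j 0))"
          by (intro L2_loc_monomial_upd_zero L2_loc_monomial_coord_quot sep_holomorphic_coord_quot_funpow insert.prems)
        show "?b k $ i = 0" if "i \<in> U" for i
          using that insert.hyps insert.prems(3)[of i] unfolding b by auto
        show "?b k $ i \<le> m" if "i \<notin> U" for i
          using that insert.prems(4)[of i] step.hyps unfolding b by auto
        show "indep_coord r i (\<lambda>z. ?T k (upd_coord z j 0))" if "i \<notin> U" "?b k $ i < m" for i
          using that insert.prems(5)[of i] unfolding b
          by (auto intro: indep_coord_upd_zero_same indep_coord_upd_zero indep_coord_quot_funpow split: if_splits)
      qed
      from additive_subgroup.a_closed[OF J.additive_subgroup_axioms this step.IH]
      have "?r (\<lambda>z. monomial (?b k) z * ?T k (upd_coord z j 0) + monomial (?b (Suc k)) z * ?T (Suc k) z) \<in> J"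
        unfolding holo_ring_add_restrict .
      also have "(\<lambda>z. monomial (?b k) z * ?T k (upd_coord z j 0) + monomial (?b (Suc k)) z * ?T (Suc k) z)
        = (\<lambda>z. monomial (?b k) z * ?T k z)"
      proof
        fix z
        have "?T k z = ?T k (upd_coord z j 0) + z $ j * ?T (Suc k) z"
          using coord_quot_mult[of "?T k" z j 0] by simp
        then show "monomial (?b k) z * ?T k (upd_coord z j 0) + monomial (?b (Suc k)) z * ?T (Suc k) z
          = monomial (?b k) z * ?T k z"
          by (simp add: monomial_add monomial_axis algebra_simps del: funpow.simps)
      qed
      finally show ?case .
    qed
    from this[of 0] have "?r (\<lambda>z. monomial (?b 0) z * ?T 0 z) \<in> J" by blast
    moreover have b_0: "?b 0 = \<beta>" by (simp add: vec_eq_iff axis_def)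
    moreover have T_0: "?T 0 = G" by simp
    ultimately show ?case by (simp only:)
  qed
  fix F assume "F \<in> multiplier_ideal (polydisk r) \<phi>"
  then have F: "F \<in> extensional (polydisk r)" "L2_loc F" by (auto simp: multiplier_ideal_iff)
  then have "?r (\<lambda>z. monomial 0 z * F z) \<in> J"
    by (intro main[of F 0 UNIV]) (auto simp: L2_loc_def)
  moreover have "?r (\<lambda>z. monomial 0 z * F z) = F"
    using extensional_restrict[OF F(1)] by simp
  ultimately show "F \<in> J" by (simp only:)
qed

lemma monomial_ideal_multiplier_ideal:
  "monomial_ideal (polydisk r) (multiplier_ideal (polydisk r) \<phi>)"
  unfolding monomial_ideal_def
proof (intro conjI exI)
  let ?I = "multiplier_ideal (polydisk r) \<phi>"
  show "ideal ?I (holo_ring (polydisk r))" by (rule ideal_multiplier_ideal)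
  have iff: "monomial_fun (polydisk r) \<alpha> \<in> ?I \<longleftrightarrow> L2_loc (monomial \<alpha>)" for \<alpha>
    by (simp add: monomial_fun_eq restrict_in_multiplier_ideal)
  show "?I = genideal (holo_ring (polydisk r)) (monomial_fun (polydisk r) ` {\<alpha>. L2_loc (monomial \<alpha>)})"
  proof
    show "?I \<subseteq> genideal (holo_ring (polydisk r)) (monomial_fun (polydisk r) ` {\<alpha>. L2_loc (monomial \<alpha>)})"
      \<comment> \<open>The generated ideal is the intersection of all ideals containing the
        generators, so the inclusion is checked for each such ideal; hence the arbitrary
        \<open>J\<close> in \<open>multiplier_ideal_subset_of_monomials\<close>.\<close>
      unfolding genideal_def by (intro Inter_greatest multiplier_ideal_subset_of_monomials) auto
    show "genideal (holo_ring (polydisk r)) (monomial_fun (polydisk r) ` {\<alpha>. L2_loc (monomial \<alpha>)}) \<subseteq> ?I"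
      unfolding genideal_def using ideal_multiplier_ideal iff by (intro Inter_lower) auto
  qed
qed

lemma monomial_in_multiplier_ideal_iff:
  "monomial_fun (polydisk r) \<alpha> \<in> multiplier_ideal (polydisk r) \<phi> \<longleftrightarrow>
    (\<chi> i. real (\<alpha> $ i) + 1) \<in> interior (newton_body r \<phi>)"
proof -
  have mono: "monomial \<alpha> = (\<lambda>z. \<Prod>i\<in>UNIV. z $ i ^ (\<alpha> $ i))"
    by (simp add: monomial_def fun_eq_iff)
  have "L2_loc (monomial \<alpha>) \<longleftrightarrow> (\<chi> i. real (\<alpha> $ i) + 1) \<in> interior (newton_body r \<phi>)"
  proof
    \<comment> \<open>Half radii are one admissible choice: finiteness over a single polydisk
      already implies interiority, and therefore finiteness over all.\<close>
    assume L: "L2_loc (monomial \<alpha>)"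
    have "(\<integral>\<^sup>+ z. weight_on \<phi> (\<chi> i. r $ i / 2) (monomial \<alpha>) z \<partial>lborel) < \<infinity>"
      using L r_pos unfolding L2_loc_def by simp
    then show "(\<chi> i. real (\<alpha> $ i) + 1) \<in> interior (newton_body r \<phi>)"
      unfolding mono
      by (intro interior_of_weight_integral_finite[OF r_pos psh toric, of "\<chi> i. r $ i / 2"])
        (use r_pos in auto)
  next
    assume "(\<chi> i. real (\<alpha> $ i) + 1) \<in> interior (newton_body r \<phi>)"
    then show "L2_loc (monomial \<alpha>)"
      using weight_integral_finite_of_interior[OF r_pos psh toric, of \<alpha>] sep_holomorphic_monomial[of r \<alpha>]
      unfolding L2_loc_def mono by auto
  qed
  then show ?thesis by (simp add: monomial_fun_eq restrict_in_multiplier_ideal)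
qed

end

theorem theoremA:
  fixes r :: "real ^ 'n" and \<phi> :: "complex ^ 'n \<Rightarrow> ereal"
  assumes "\<And>i. 0 < r $ i"
    and "psh_on (polydisk r) \<phi>"
    and "toric_on (polydisk r) \<phi>"
  shows "monomial_ideal (polydisk r) (multiplier_ideal (polydisk r) \<phi>) \<and>
    (\<forall>\<alpha> :: nat ^ 'n.
       monomial_fun (polydisk r) \<alpha> \<in> multiplier_ideal (polydisk r) \<phi> \<longleftrightarrow>
       (\<chi> i. real (\<alpha> $ i) + 1) \<in> interior (newton_body r \<phi>))"
  using monomial_ideal_multiplier_ideal[OF assms] monomial_in_multiplier_ideal_iff[OF assms]
  by blast

end
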